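(* Let $R \supseteq S$ be a separable extension of rings, and let $e \in T = (R \otimes_S R)^S$ be a separability idempotent. Then $R \supseteq S$ is an H-separable extension if and only if $e$ is a full idempotent of the ring $T$, i.e. $TeT = T$. In this case, the center $Z(R)$ is Morita equivalent to the endomorphism ring $\mathrm{End}({}_R (R \otimes_S R)_R)$ of the $R$-$R$-bimodule $R \otimes_S R$.
   Context: Rings are unital and associative, not necessarily commutative. A ring extension $R \supseteq S$ means that $S$ is a subring of $R$ with $1_S = 1_R$. $R \supseteq S$ is a separable extension if the multiplication map $\mu : R \otimes_S R \to R$ splits as an $R$-$R$-bimodule epimorphism; equivalently, there is an element $e = e^1 \otimes_S e^2 \in R \otimes_S R$ (summation suppressed) with $re = er$ for all $r \in R$ (i.e. $e \in (R\otimes_S R)^R$) and $e^1 e^2 = 1$. Such an $e$ is called a separability element or separability idempotent. $R \supseteq S$ is H-separable if for some positive integer $q$ the $R$-$R$-bimodule $R \otimes_S R$ is isomorphic to a direct summand of the direct sum of $q$ copies of ${}_R R_R$. $T := (R \otimes_S R)^S = \{ t \in R \otimes_S R : st = ts \text{ for all } s \in S\}$. It is a ring with multiplication $t t' = t'^1 t^1 \otimes_S t^2 t'^2$ and unit $1 \otimes_S 1$; this is the ring structure transported from $\mathrm{End}({}_R (R \otimes_S R)_R)$ via the bijection $t \mapsto (r \otimes r' \mapsto r t r')$. A separability element lies in $T$ and is an idempotent for this multiplication. *)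

theory Defs
  imports
    "HOL-Algebra.Module"
    "HOL-Algebra.Subrings"
    "HOL-Algebra.Generated_Groups"
    "HOL-Algebra.Free_Abelian_Groups"
begin

section \<open>Bimodules\<close>

text \<open>
  An \<open>R\<close>-\<open>R\<close>-bimodule is an abelian group with a left and a right action of \<open>R\<close>. As for the
  library's modules, the record inherits the fields \<open>mult\<close> and \<open>one\<close> of rings, which play no role.
\<close>

record ('a, 'b) bimodule = "('a, 'b) module" +
  rsmult :: "'b \<Rightarrow> 'a \<Rightarrow> 'b" (infixl \<open>\<boxdot>\<index>\<close> 70)

definition bimod_hom ::
  "('a, 'x) ring_scheme \<Rightarrow> ('a, 'b, 'y) bimodule_scheme \<Rightarrow> ('a, 'c, 'z) bimodule_scheme \<Rightarrow> ('b \<Rightarrow> 'c) set"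
  where "bimod_hom R M N = {f \<in> carrier M \<rightarrow>\<^sub>E carrier N.
     (\<forall>x\<in>carrier M. \<forall>y\<in>carrier M. f (x \<oplus>\<^bsub>M\<^esub> y) = f x \<oplus>\<^bsub>N\<^esub> f y) \<and>
     (\<forall>r\<in>carrier R. \<forall>x\<in>carrier M. f (r \<odot>\<^bsub>M\<^esub> x) = r \<odot>\<^bsub>N\<^esub> f x) \<and>
     (\<forall>r\<in>carrier R. \<forall>x\<in>carrier M. f (x \<boxdot>\<^bsub>M\<^esub> r) = f x \<boxdot>\<^bsub>N\<^esub> r)}"

definition bimod_isomorphic ::
  "('a, 'x) ring_scheme \<Rightarrow> ('a, 'b, 'y) bimodule_scheme \<Rightarrow> ('a, 'c, 'z) bimodule_scheme \<Rightarrow> bool"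
  where "bimod_isomorphic R M N \<longleftrightarrow> (\<exists>f\<in>bimod_hom R M N. bij_betw f (carrier M) (carrier N))"

definition bimod_End :: "('a, 'x) ring_scheme \<Rightarrow> ('a, 'b, 'y) bimodule_scheme \<Rightarrow> ('b \<Rightarrow> 'b) ring"
  where "bimod_End R M =
    \<lparr>carrier = bimod_hom R M M,
     monoid.mult = (\<lambda>f g. compose (carrier M) f g),
     one = (\<lambda>x\<in>carrier M. x),
     ring.zero = (\<lambda>x\<in>carrier M. \<zero>\<^bsub>M\<^esub>),
     add = (\<lambda>f g. \<lambda>x\<in>carrier M. f x \<oplus>\<^bsub>M\<^esub> g x)\<rparr>"

definition sub_bimodule :: "('a, 'x) ring_scheme \<Rightarrow> 'b set \<Rightarrow> ('a, 'b, 'y) bimodule_scheme \<Rightarrow> bool"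
  where "sub_bimodule R K M \<longleftrightarrow>
     subgroup K (add_monoid M) \<and>
     (\<forall>r\<in>carrier R. \<forall>x\<in>K. r \<odot>\<^bsub>M\<^esub> x \<in> K \<and> x \<boxdot>\<^bsub>M\<^esub> r \<in> K)"

definition bimod_direct_summand ::
  "('a, 'x) ring_scheme \<Rightarrow> 'b set \<Rightarrow> ('a, 'b, 'y) bimodule_scheme \<Rightarrow> bool"
  where "bimod_direct_summand R K M \<longleftrightarrow>
     sub_bimodule R K M \<and>
     (\<exists>L. sub_bimodule R L M \<and> K \<inter> L = {\<zero>\<^bsub>M\<^esub>} \<and> K <+>\<^bsub>M\<^esub> L = carrier M)"

definition regular_bimodule :: "('a, 'x) ring_scheme \<Rightarrow> ('a, 'a) bimodule"
  where "regular_bimodule R =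
    \<lparr>carrier = carrier R, monoid.mult = monoid.mult R, one = \<one>\<^bsub>R\<^esub>,
     ring.zero = \<zero>\<^bsub>R\<^esub>, add = ring.add R,
     smult = monoid.mult R, rsmult = monoid.mult R\<rparr>"

definition bimod_power :: "nat \<Rightarrow> ('a, 'b, 'y) bimodule_scheme \<Rightarrow> ('a, nat \<Rightarrow> 'b) bimodule"
  where "bimod_power q M =
    \<lparr>carrier = {..<q} \<rightarrow>\<^sub>E carrier M, monoid.mult = undefined, one = undefined,
     ring.zero = (\<lambda>i\<in>{..<q}. \<zero>\<^bsub>M\<^esub>),
     add = (\<lambda>x y. \<lambda>i\<in>{..<q}. x i \<oplus>\<^bsub>M\<^esub> y i),
     smult = (\<lambda>r x. \<lambda>i\<in>{..<q}. r \<odot>\<^bsub>M\<^esub> x i),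
     rsmult = (\<lambda>x r. \<lambda>i\<in>{..<q}. x i \<boxdot>\<^bsub>M\<^esub> r)\<rparr>"


section \<open>The tensor square \<open>R \<otimes>\<^sub>S R\<close>\<close>

text \<open>
  The free abelian group on \<open>R \<times> R\<close> modulo biadditivity and \<open>S\<close>-balancedness. The library writes
  the free abelian group and its quotients multiplicatively.
\<close>

definition tensor_relations :: "('a, 'x) ring_scheme \<Rightarrow> 'a set \<Rightarrow> ('a \<times> 'a \<Rightarrow>\<^sub>0 int) set"
  where "tensor_relations R S =
     {frag_of (a \<oplus>\<^bsub>R\<^esub> a', b) - frag_of (a, b) - frag_of (a', b) | a a' b.
        a \<in> carrier R \<and> a' \<in> carrier R \<and> b \<in> carrier R} \<union>
     {frag_of (a, b \<oplus>\<^bsub>R\<^esub> b') - frag_of (a, b) - frag_of (a, b') | a b b'.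
        a \<in> carrier R \<and> b \<in> carrier R \<and> b' \<in> carrier R} \<union>
     {frag_of (a \<otimes>\<^bsub>R\<^esub> s, b) - frag_of (a, s \<otimes>\<^bsub>R\<^esub> b) | a s b.
        a \<in> carrier R \<and> s \<in> S \<and> b \<in> carrier R}"

definition tensor_kernel :: "('a, 'x) ring_scheme \<Rightarrow> 'a set \<Rightarrow> ('a \<times> 'a \<Rightarrow>\<^sub>0 int) set"
  where "tensor_kernel R S =
     generate (free_Abelian_group (carrier R \<times> carrier R)) (tensor_relations R S)"

type_synonym 'a tensor = "('a \<times> 'a \<Rightarrow>\<^sub>0 int) set"

definition tensor_group :: "('a, 'x) ring_scheme \<Rightarrow> 'a set \<Rightarrow> 'a tensor ring"
  where "tensor_group R S =
    (let Q = free_Abelian_group (carrier R \<times> carrier R) Mod tensor_kernel R S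
     in \<lparr>carrier = carrier Q, monoid.mult = undefined, one = undefined,
         ring.zero = \<one>\<^bsub>Q\<^esub>, add = monoid.mult Q\<rparr>)"

definition tens :: "('a, 'x) ring_scheme \<Rightarrow> 'a set \<Rightarrow> 'a \<Rightarrow> 'a \<Rightarrow> 'a tensor"
  where "tens R S a b =
     tensor_kernel R S #>\<^bsub>free_Abelian_group (carrier R \<times> carrier R)\<^esub> frag_of (a, b)"

text \<open>
  The additive map sending each \<open>a \<otimes> b\<close> to \<open>f a b\<close>, evaluated at \<open>z = \<Sum> n\<^sub>i (a\<^sub>i \<otimes> b\<^sub>i)\<close>, is
  \<open>\<Sum> n\<^sub>i f a\<^sub>i b\<^sub>i\<close>. The choice of representative is immaterial when \<open>f\<close> is biadditive and
  \<open>S\<close>-balanced; it is only used for such \<open>f\<close>.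
\<close>

definition tensor_lift :: "('c, 'x) ring_scheme \<Rightarrow> ('a \<Rightarrow> 'a \<Rightarrow> 'c) \<Rightarrow> 'a tensor \<Rightarrow> 'c"
  where "tensor_lift G f z =
    (let c = (SOME c. c \<in> z)
     in \<Oplus>\<^bsub>G\<^esub>p\<in>Poly_Mapping.keys c. [Poly_Mapping.lookup c p] \<cdot>\<^bsub>G\<^esub> f (fst p) (snd p))"

definition tensor_bimodule :: "('a, 'x) ring_scheme \<Rightarrow> 'a set \<Rightarrow> ('a, 'a tensor) bimodule"
  where "tensor_bimodule R S =
    \<lparr>carrier = carrier (tensor_group R S), monoid.mult = undefined, one = undefined,
     ring.zero = \<zero>\<^bsub>tensor_group R S\<^esub>, add = ring.add (tensor_group R S),
     smult = (\<lambda>r. tensor_lift (tensor_group R S) (\<lambda>a b. tens R S (r \<otimes>\<^bsub>R\<^esub> a) b)),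
     rsmult = (\<lambda>z r. tensor_lift (tensor_group R S) (\<lambda>a b. tens R S a (b \<otimes>\<^bsub>R\<^esub> r)) z)\<rparr>"

definition tensor_mu :: "('a, 'x) ring_scheme \<Rightarrow> 'a tensor \<Rightarrow> 'a"
  where "tensor_mu R = tensor_lift R (\<lambda>a b. a \<otimes>\<^bsub>R\<^esub> b)"


section \<open>Separable and H-separable extensions\<close>

definition separable_extension :: "('a, 'x) ring_scheme \<Rightarrow> 'a set \<Rightarrow> bool"
  where "separable_extension R S \<longleftrightarrow>
     (\<exists>\<sigma>\<in>bimod_hom R (regular_bimodule R) (tensor_bimodule R S).
        \<forall>r\<in>carrier R. tensor_mu R (\<sigma> r) = r)"

definition separability_element :: "('a, 'x) ring_scheme \<Rightarrow> 'a set \<Rightarrow> 'a tensor \<Rightarrow> bool"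
  where "separability_element R S e \<longleftrightarrow>
     e \<in> carrier (tensor_bimodule R S) \<and>
     (\<forall>r\<in>carrier R. r \<odot>\<^bsub>tensor_bimodule R S\<^esub> e = e \<boxdot>\<^bsub>tensor_bimodule R S\<^esub> r) \<and>
     tensor_mu R e = \<one>\<^bsub>R\<^esub>"

definition H_separable_extension :: "('a, 'x) ring_scheme \<Rightarrow> 'a set \<Rightarrow> bool"
  where "H_separable_extension R S \<longleftrightarrow>
     (\<exists>q>0. \<exists>K. bimod_direct_summand R K (bimod_power q (regular_bimodule R)) \<and>
        bimod_isomorphic R (tensor_bimodule R S)
          ((bimod_power q (regular_bimodule R))\<lparr>carrier := K\<rparr>))"

text \<open>
  The ring \<open>T = (R \<otimes>\<^sub>S R)\<^sup>S\<close>. Its product \<open>t t' = t'\<^sup>1 t\<^sup>1 \<otimes> t\<^sup>2 t'\<^sup>2\<close> is \<open>t'\<^sup>1 \<cdot> t \<cdot> t'\<^sup>2\<close> in terms of the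
  bimodule actions, and \<open>(a, b) \<mapsto> a \<cdot> t \<cdot> b\<close> is \<open>S\<close>-balanced exactly because \<open>t\<close> commutes
  with \<open>S\<close>.
\<close>

definition tensor_T :: "('a, 'x) ring_scheme \<Rightarrow> 'a set \<Rightarrow> 'a tensor ring"
  where "tensor_T R S =
    \<lparr>carrier = {t \<in> carrier (tensor_bimodule R S).
        \<forall>s\<in>S. s \<odot>\<^bsub>tensor_bimodule R S\<^esub> t = t \<boxdot>\<^bsub>tensor_bimodule R S\<^esub> s},
     monoid.mult = (\<lambda>t t'. tensor_lift (tensor_group R S)
        (\<lambda>a b. (a \<odot>\<^bsub>tensor_bimodule R S\<^esub> t) \<boxdot>\<^bsub>tensor_bimodule R S\<^esub> b) t'),
     one = tens R S \<one>\<^bsub>R\<^esub> \<one>\<^bsub>R\<^esub>,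
     ring.zero = \<zero>\<^bsub>tensor_bimodule R S\<^esub>,
     add = ring.add (tensor_bimodule R S)\<rparr>"

text \<open>\<open>TeT\<close> is the additive group generated by the products \<open>t e t'\<close>, i.e. their finite sums.\<close>

definition full_idempotent :: "('a, 'x) ring_scheme \<Rightarrow> 'a \<Rightarrow> bool"
  where "full_idempotent T e \<longleftrightarrow>
     e \<in> carrier T \<and> e \<otimes>\<^bsub>T\<^esub> e = e \<and>
     generate (add_monoid T) {t \<otimes>\<^bsub>T\<^esub> e \<otimes>\<^bsub>T\<^esub> t' | t t'. t \<in> carrier T \<and> t' \<in> carrier T} = carrier T"


section \<open>Morita equivalence\<close>

definition ring_center :: "('a, 'x) ring_scheme \<Rightarrow> ('a, 'x) ring_scheme"
  where "ring_center R =
     R\<lparr>carrier := {z \<in> carrier R. \<forall>r\<in>carrier R. z \<otimes>\<^bsub>R\<^esub> r = r \<otimes>\<^bsub>R\<^esub> z}\<rparr>"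

text \<open>The library's locale \<open>module\<close> without commutativity of the base ring.\<close>

locale left_module = A?: ring A + M?: abelian_group M
  for A :: "('a, 'x) ring_scheme" (structure) and M :: "('a, 'b, 'y) module_scheme" (structure) +
  assumes smult_closed: "\<lbrakk>a \<in> carrier A; x \<in> carrier M\<rbrakk> \<Longrightarrow> a \<odot>\<^bsub>M\<^esub> x \<in> carrier M"
    and smult_l_distr: "\<lbrakk>a \<in> carrier A; b \<in> carrier A; x \<in> carrier M\<rbrakk> \<Longrightarrow>
      (a \<oplus>\<^bsub>A\<^esub> b) \<odot>\<^bsub>M\<^esub> x = a \<odot>\<^bsub>M\<^esub> x \<oplus>\<^bsub>M\<^esub> b \<odot>\<^bsub>M\<^esub> x"
    and smult_r_distr: "\<lbrakk>a \<in> carrier A; x \<in> carrier M; y \<in> carrier M\<rbrakk> \<Longrightarrow>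
      a \<odot>\<^bsub>M\<^esub> (x \<oplus>\<^bsub>M\<^esub> y) = a \<odot>\<^bsub>M\<^esub> x \<oplus>\<^bsub>M\<^esub> a \<odot>\<^bsub>M\<^esub> y"
    and smult_assoc1: "\<lbrakk>a \<in> carrier A; b \<in> carrier A; x \<in> carrier M\<rbrakk> \<Longrightarrow>
      (a \<otimes>\<^bsub>A\<^esub> b) \<odot>\<^bsub>M\<^esub> x = a \<odot>\<^bsub>M\<^esub> (b \<odot>\<^bsub>M\<^esub> x)"
    and smult_one: "x \<in> carrier M \<Longrightarrow> \<one>\<^bsub>A\<^esub> \<odot>\<^bsub>M\<^esub> x = x"

definition lmod_hom ::
  "('a, 'x) ring_scheme \<Rightarrow> ('a, 'b, 'y) module_scheme \<Rightarrow> ('a, 'c, 'z) module_scheme \<Rightarrow> ('b \<Rightarrow> 'c) set"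
  where "lmod_hom A M N = {f \<in> carrier M \<rightarrow>\<^sub>E carrier N.
     (\<forall>x\<in>carrier M. \<forall>y\<in>carrier M. f (x \<oplus>\<^bsub>M\<^esub> y) = f x \<oplus>\<^bsub>N\<^esub> f y) \<and>
     (\<forall>a\<in>carrier A. \<forall>x\<in>carrier M. f (a \<odot>\<^bsub>M\<^esub> x) = a \<odot>\<^bsub>N\<^esub> f x)}"

definition lmod_iso ::
  "('a, 'x) ring_scheme \<Rightarrow> ('a, 'b, 'y) module_scheme \<Rightarrow> ('a, 'c, 'z) module_scheme \<Rightarrow> ('b \<Rightarrow> 'c) set"
  where "lmod_iso A M N = {f \<in> lmod_hom A M N. bij_betw f (carrier M) (carrier N)}"

text \<open>
  For a type \<open>'u\<close> (the universe), the category of left \<open>A\<close>-modules has as objects the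
  \<open>M :: ('a, 'u) module\<close> with \<open>left_module A M\<close>, and as morphisms the elements of \<open>lmod_hom A M N\<close>.
  A functor consists of an object map \<open>F\<close> and maps \<open>\<Phi> M N\<close> on morphisms \<open>M \<rightarrow> N\<close>.
\<close>

type_synonym ('a, 'b, 'u) lmod_obj_map = "('a, 'u) module \<Rightarrow> ('b, 'u) module"
type_synonym ('a, 'u) lmod_arr_map = "('a, 'u) module \<Rightarrow> ('a, 'u) module \<Rightarrow> ('u \<Rightarrow> 'u) \<Rightarrow> ('u \<Rightarrow> 'u)"

definition lmod_functor ::
  "('a, 'x) ring_scheme \<Rightarrow> ('b, 'y) ring_scheme \<Rightarrow>
   ('a, 'b, 'u) lmod_obj_map \<Rightarrow> ('a, 'u) lmod_arr_map \<Rightarrow> bool"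
  where "lmod_functor A B F \<Phi> \<longleftrightarrow>
     (\<forall>M. left_module A M \<longrightarrow> left_module B (F M)) \<and>
     (\<forall>M N. left_module A M \<longrightarrow> left_module A N \<longrightarrow>
        (\<forall>f\<in>lmod_hom A M N. \<Phi> M N f \<in> lmod_hom B (F M) (F N))) \<and>
     (\<forall>M. left_module A M \<longrightarrow> \<Phi> M M (\<lambda>x\<in>carrier M. x) = (\<lambda>x\<in>carrier (F M). x)) \<and>
     (\<forall>M N P. left_module A M \<longrightarrow> left_module A N \<longrightarrow> left_module A P \<longrightarrow>
        (\<forall>f\<in>lmod_hom A M N. \<forall>g\<in>lmod_hom A N P.
           \<Phi> M P (compose (carrier M) g f) = compose (carrier (F M)) (\<Phi> N P g) (\<Phi> M N f)))"

definition lmod_nat_iso ::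
  "('a, 'x) ring_scheme \<Rightarrow> ('b, 'y) ring_scheme \<Rightarrow>
   ('a, 'b, 'u) lmod_obj_map \<Rightarrow> ('a, 'u) lmod_arr_map \<Rightarrow>
   ('a, 'b, 'u) lmod_obj_map \<Rightarrow> ('a, 'u) lmod_arr_map \<Rightarrow>
   (('a, 'u) module \<Rightarrow> 'u \<Rightarrow> 'u) \<Rightarrow> bool"
  where "lmod_nat_iso A B F \<Phi> G \<Psi> \<eta> \<longleftrightarrow>
     (\<forall>M. left_module A M \<longrightarrow> \<eta> M \<in> lmod_iso B (F M) (G M)) \<and>
     (\<forall>M N. left_module A M \<longrightarrow> left_module A N \<longrightarrow>
        (\<forall>f\<in>lmod_hom A M N.
           compose (carrier (F M)) (\<eta> N) (\<Phi> M N f) = compose (carrier (F M)) (\<Psi> M N f) (\<eta> M)))"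

text \<open>
  \<open>A\<close> and \<open>B\<close> are Morita equivalent if their categories of left modules are equivalent. HOL cannot
  quantify over the universe \<open>'u\<close> inside a formula, so it is a parameter. For finite \<open>'u\<close> only
  modules of bounded finite size occur and the notion is meaningless; over an infinite \<open>'u\<close> the
  modules are, up to isomorphism, those of cardinality at most that of \<open>'u\<close>.
\<close>

definition morita_equivalent ::
  "'u itself \<Rightarrow> ('a, 'x) ring_scheme \<Rightarrow> ('b, 'y) ring_scheme \<Rightarrow> bool"
  where "morita_equivalent (u :: 'u itself) A B \<longleftrightarrow>
     ring A \<and> ring B \<and>
     (\<exists>(F :: ('a, 'b, 'u) lmod_obj_map) \<Phi> (G :: ('b, 'a, 'u) lmod_obj_map) \<Psi> \<eta> \<epsilon>.
        lmod_functor A B F \<Phi> \<and> lmod_functor B A G \<Psi> \<and>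
        lmod_nat_iso A A (\<lambda>M. M) (\<lambda>M N f. f)
          (\<lambda>M. G (F M)) (\<lambda>M N f. \<Psi> (F M) (F N) (\<Phi> M N f)) \<eta> \<and>
        lmod_nat_iso B B (\<lambda>N. F (G N)) (\<lambda>M N f. \<Phi> (G M) (G N) (\<Psi> M N f))
          (\<lambda>N. N) (\<lambda>M N f. f) \<epsilon>)"

end

theory Submission
  imports Defs
begin

text \<open>
  Write \<open>M = R \<otimes>\<^sub>S R\<close> and let \<open>\<mu> : M \<rightarrow> R\<close> be the multiplication. Since \<open>r e = e r\<close> and \<open>\<mu>(e) = 1\<close>, the map
  \<open>\<sigma> : R \<rightarrow> M\<close>, \<open>r \<mapsto> r e\<close>, is a bimodule homomorphism with \<open>\<mu> \<sigma> = id\<close>. Hence \<open>\<epsilon> = \<sigma> \<mu>\<close> is an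
  idempotent of \<open>E = End(M)\<close>. Evaluation at \<open>1 \<otimes> 1\<close> is a ring isomorphism \<open>E \<cong> T\<close>
  (\<open>ring_iso_End_T\<close>), and it sends \<open>\<epsilon>\<close> to \<open>\<mu>(1 \<otimes> 1) e = e\<close>; thus \<open>e\<close> is full in \<open>T\<close> if and only if
  \<open>\<epsilon>\<close> is full in \<open>E\<close>.

  On the other side, \<open>M\<close> is isomorphic to a direct summand of \<open>R\<^sup>q\<close> if and only if the identity of \<open>M\<close>
  is a sum \<open>u\<^sub>1 b\<^sub>1 + \<dots> + u\<^sub>q b\<^sub>q\<close> with homomorphisms \<open>b\<^sub>i : M \<rightarrow> R\<close> and \<open>u\<^sub>i : R \<rightarrow> M\<close>
  (\<open>summand_iff_retract\<close>, \<open>retract_power_iff_dual_basis\<close>). As \<open>u\<^sub>i b\<^sub>i = (u\<^sub>i \<mu>) \<epsilon> (\<sigma> b\<^sub>i)\<close> and,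
  conversely, \<open>x \<epsilon> y = (x \<sigma>) (\<mu> y)\<close> for \<open>x, y \<in> E\<close>, such a sum exists if and only if
  \<open>1 \<in> E \<epsilon> E\<close> (\<open>dual_basis_iff_full\<close>). This is the first claim.

  For the second claim, \<open>\<epsilon> E \<epsilon> \<cong> End(R) \<cong> Z(R)\<close>, where \<open>z\<close> corresponds to \<open>m \<mapsto> \<sigma>(z \<mu>(m))\<close>, and every
  ring \<open>E\<close> is Morita equivalent to each of its full corners \<open>\<epsilon> E \<epsilon>\<close> (\<open>morita_equivalent_corner\<close>). The
  equivalence sends an \<open>E\<close>-module \<open>N\<close> to \<open>\<epsilon> N\<close>, and a module \<open>X\<close> over the corner to the group of
  homomorphisms \<open>\<epsilon> E \<rightarrow> X\<close>. The coinduced module, rather than \<open>E \<epsilon> \<otimes> X\<close>, makes most verifications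
  pointwise. It also stays inside a given infinite universe: if \<open>1 = \<Sum> x\<^sub>i \<epsilon> y\<^sub>i\<close>, then a homomorphism
  \<open>\<epsilon> E \<rightarrow> X\<close> is determined by its finitely many values at \<open>\<epsilon> y\<^sub>i\<close>, and finite tuples over an infinite
  type can be coded by elements of that type.
\<close>

section \<open>Finite sums and module homomorphisms\<close>

lemma (in abelian_group_hom) hom_finsum:
  assumes "finite I" "g \<in> I \<rightarrow> carrier G"
  shows "h (\<Oplus>\<^bsub>G\<^esub>i\<in>I. g i) = (\<Oplus>\<^bsub>H\<^esub>i\<in>I. h (g i))"
  using assms by (induction I rule: finite_induct) (auto simp: Pi_iff)

lemma additive_imp_abelian_group_hom:
  assumes "abelian_group G" "abelian_group H" "f \<in> carrier G \<rightarrow> carrier H"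
    and "\<And>x y. \<lbrakk>x \<in> carrier G; y \<in> carrier G\<rbrakk> \<Longrightarrow> f (x \<oplus>\<^bsub>G\<^esub> y) = f x \<oplus>\<^bsub>H\<^esub> f y"
  shows "abelian_group_hom G H f"
proof -
  interpret G: abelian_group G by fact
  interpret H: abelian_group H by fact
  show ?thesis
    using assms(3,4)
    by (intro abelian_group_homI assms group_hom.intro group_hom_axioms.intro homI
        G.a_group H.a_group) auto
qed

context left_module
begin

lemma smult_hom: "a \<in> carrier A \<Longrightarrow> abelian_group_hom M M (\<lambda>v. a \<odot>\<^bsub>M\<^esub> v)"
  by (intro additive_imp_abelian_group_hom M.abelian_group_axioms)
    (auto simp: smult_closed smult_r_distr)

lemma action_hom: "v \<in> carrier M \<Longrightarrow> abelian_group_hom A M (\<lambda>a. a \<odot>\<^bsub>M\<^esub> v)"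
  by (intro additive_imp_abelian_group_hom M.abelian_group_axioms A.abelian_group_axioms)
    (auto simp: smult_closed smult_l_distr)

lemma smult_zero: "a \<in> carrier A \<Longrightarrow> a \<odot>\<^bsub>M\<^esub> \<zero>\<^bsub>M\<^esub> = \<zero>\<^bsub>M\<^esub>"
  by (rule abelian_group_hom.hom_zero[OF smult_hom])

lemma smult_minus:
  "\<lbrakk>a \<in> carrier A; v \<in> carrier M\<rbrakk> \<Longrightarrow> a \<odot>\<^bsub>M\<^esub> (\<ominus>\<^bsub>M\<^esub> v) = \<ominus>\<^bsub>M\<^esub> (a \<odot>\<^bsub>M\<^esub> v)"
  by (rule abelian_group_hom.hom_a_inv[OF smult_hom])

end

lemma lmod_homI:
  assumes "f \<in> extensional (carrier M)"
    and "\<And>x. x \<in> carrier M \<Longrightarrow> f x \<in> carrier N"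
    and "\<And>x y. \<lbrakk>x \<in> carrier M; y \<in> carrier M\<rbrakk> \<Longrightarrow> f (x \<oplus>\<^bsub>M\<^esub> y) = f x \<oplus>\<^bsub>N\<^esub> f y"
    and "\<And>a x. \<lbrakk>a \<in> carrier A; x \<in> carrier M\<rbrakk> \<Longrightarrow> f (a \<odot>\<^bsub>M\<^esub> x) = a \<odot>\<^bsub>N\<^esub> f x"
  shows "f \<in> lmod_hom A M N"
  using assms by (auto simp: lmod_hom_def PiE_iff)

lemma lmod_homD:
  assumes "f \<in> lmod_hom A M N"
  shows "f \<in> extensional (carrier M)"
    and "x \<in> carrier M \<Longrightarrow> f x \<in> carrier N"
    and "\<lbrakk>x \<in> carrier M; y \<in> carrier M\<rbrakk> \<Longrightarrow> f (x \<oplus>\<^bsub>M\<^esub> y) = f x \<oplus>\<^bsub>N\<^esub> f y"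
    and "\<lbrakk>a \<in> carrier A; x \<in> carrier M\<rbrakk> \<Longrightarrow> f (a \<odot>\<^bsub>M\<^esub> x) = a \<odot>\<^bsub>N\<^esub> f x"
  using assms by (auto simp: lmod_hom_def PiE_iff)

lemma lmod_hom_imp_abelian_group_hom:
  assumes "left_module A M" "left_module A N" "f \<in> lmod_hom A M N"
  shows "abelian_group_hom M N f"
  using assms lmod_homD[OF assms(3)]
  by (intro additive_imp_abelian_group_hom) (auto simp: left_module_def)

lemma lmod_hom_compose:
  assumes "f \<in> lmod_hom A M N" "g \<in> lmod_hom A N P"
    and "left_module A M"
  shows "compose (carrier M) g f \<in> lmod_hom A M P"
proof -
  interpret left_module A M by fact
  show ?thesis
    using lmod_homD[OF assms(1)] lmod_homD[OF assms(2)]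
    by (intro lmod_homI) (auto simp: compose_eq smult_closed)
qed

lemma lmod_iso_inverse:
  assumes "f \<in> lmod_iso A M N" "left_module A M"
  shows "(\<lambda>v\<in>carrier N. inv_into (carrier M) f v) \<in> lmod_iso A N M"
proof -
  interpret left_module A M by fact
  have f: "f \<in> lmod_hom A M N" and bij: "bij_betw f (carrier M) (carrier N)"
    using assms by (auto simp: lmod_iso_def)
  note fD = lmod_homD[OF f]
  let ?g = "\<lambda>v\<in>carrier N. inv_into (carrier M) f v"
  have inv: "?g (f x) = x" if "x \<in> carrier M" for x
    using that bij fD(2) by (auto simp: bij_betw_def)
  have surj: "\<exists>x\<in>carrier M. v = f x" if "v \<in> carrier N" for v
    using that bij by (auto simp: bij_betw_def)
  have "?g \<in> lmod_hom A N M"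
  proof (rule lmod_homI)
    fix v assume "v \<in> carrier N"
    then obtain x where x: "x \<in> carrier M" "v = f x" using surj by blast
    then show "?g v \<in> carrier M" using inv by simp
    fix a assume a: "a \<in> carrier A"
    have "?g (a \<odot>\<^bsub>N\<^esub> v) = ?g (f (a \<odot>\<^bsub>M\<^esub> x))" using x a fD(4) by simp
    also have "\<dots> = a \<odot>\<^bsub>M\<^esub> ?g v" using x a inv smult_closed by simp
    finally show "?g (a \<odot>\<^bsub>N\<^esub> v) = a \<odot>\<^bsub>M\<^esub> ?g v" .
  next
    fix v w assume "v \<in> carrier N" "w \<in> carrier N"
    then obtain x y where x: "x \<in> carrier M" "v = f x" and y: "y \<in> carrier M" "w = f y"
      using surj by meson
    have "?g (v \<oplus>\<^bsub>N\<^esub> w) = ?g (f (x \<oplus>\<^bsub>M\<^esub> y))" using x y fD(3) by simp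
    also have "\<dots> = ?g v \<oplus>\<^bsub>M\<^esub> ?g w" using x y inv by simp
    finally show "?g (v \<oplus>\<^bsub>N\<^esub> w) = ?g v \<oplus>\<^bsub>M\<^esub> ?g w" .
  qed simp
  moreover have "bij_betw ?g (carrier N) (carrier M)"
    using bij_betw_inv_into[OF bij] by (simp cong: bij_betw_cong)
  ultimately show ?thesis by (simp add: lmod_iso_def)
qed

section \<open>Functors between module categories\<close>

lemma lmod_functor_identity: "lmod_functor A A (\<lambda>M. M) (\<lambda>M N f. f)"
  by (simp add: lmod_functor_def)

lemma lmod_nat_iso_inverse:
  assumes F: "lmod_functor A B F \<Phi>"
    and iso: "lmod_nat_iso A B F \<Phi> G \<Psi> \<eta>"
  shows "lmod_nat_iso A B G \<Psi> F \<Phi> (\<lambda>M. \<lambda>v\<in>carrier (G M). inv_into (carrier (F M)) (\<eta> M) v)"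
proof -
  let ?\<theta> = "\<lambda>M. \<lambda>v\<in>carrier (G M). inv_into (carrier (F M)) (\<eta> M) v"
  have F1: "left_module B (F M)" if "left_module A M" for M
    using F that by (simp add: lmod_functor_def)
  have \<eta>: "\<eta> M \<in> lmod_iso B (F M) (G M)" if "left_module A M" for M
    using iso that by (simp add: lmod_nat_iso_def)
  have nat: "compose (carrier (G M)) (?\<theta> N) (\<Psi> M N f) = compose (carrier (G M)) (\<Phi> M N f) (?\<theta> M)"
    if M: "left_module A M" and N: "left_module A N" and f: "f \<in> lmod_hom A M N" for M N f
  proof (rule extensionalityI[of _ "carrier (G M)"])
    fix v assume "v \<in> carrier (G M)"
    then obtain x where x: "x \<in> carrier (F M)" "v = \<eta> M x"
      using \<eta>[OF M] by (auto simp: lmod_iso_def bij_betw_def)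
    have \<eta>N: "\<eta> N y \<in> carrier (G N)" if "y \<in> carrier (F N)" for y
      using \<eta>[OF N] that by (auto simp: lmod_iso_def bij_betw_def)
    have inj: "inj_on (\<eta> M) (carrier (F M))" "inj_on (\<eta> N) (carrier (F N))"
      using \<eta>[OF M] \<eta>[OF N] by (auto simp: lmod_iso_def bij_betw_def)
    have "\<Phi> M N f \<in> lmod_hom B (F M) (F N)"
      using F M N f by (simp add: lmod_functor_def)
    then have \<Phi>x: "\<Phi> M N f x \<in> carrier (F N)" using x by (simp add: lmod_homD(2))
    have "compose (carrier (F M)) (\<eta> N) (\<Phi> M N f) x = compose (carrier (F M)) (\<Psi> M N f) (\<eta> M) x"
      using iso M N f by (simp add: lmod_nat_iso_def)
    then have "\<Psi> M N f v = \<eta> N (\<Phi> M N f x)" using x by (simp add: compose_eq)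
    then show "compose (carrier (G M)) (?\<theta> N) (\<Psi> M N f) v = compose (carrier (G M)) (\<Phi> M N f) (?\<theta> M) v"
      using x inj \<Phi>x \<eta>N \<open>v \<in> carrier (G M)\<close> by (simp add: compose_eq)
  qed auto
  show ?thesis
    using nat lmod_iso_inverse[OF \<eta> F1] by (simp add: lmod_nat_iso_def)
qed

section \<open>Relabelling the elements of a module\<close>

text \<open>
  Modules that are constructed as sets of functions have to be copied into the type that serves as
  the universe.
\<close>

definition relabel :: "('b \<Rightarrow> 'c) \<Rightarrow> ('a, 'b) module \<Rightarrow> ('a, 'c) module"
  where "relabel h M =
    \<lparr>carrier = h ` carrier M, monoid.mult = undefined, one = undefined,
     ring.zero = h \<zero>\<^bsub>M\<^esub>,
     add = (\<lambda>u v. h (inv_into (carrier M) h u \<oplus>\<^bsub>M\<^esub> inv_into (carrier M) h v)),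
     smult = (\<lambda>a u. h (a \<odot>\<^bsub>M\<^esub> inv_into (carrier M) h u))\<rparr>"

lemma carrier_relabel [simp]: "carrier (relabel h M) = h ` carrier M"
  by (simp add: relabel_def)

lemma relabel_simps [simp]:
  assumes "inj_on h (carrier M)"
  shows "\<zero>\<^bsub>relabel h M\<^esub> = h \<zero>\<^bsub>M\<^esub>"
    and "\<lbrakk>x \<in> carrier M; y \<in> carrier M\<rbrakk> \<Longrightarrow> h x \<oplus>\<^bsub>relabel h M\<^esub> h y = h (x \<oplus>\<^bsub>M\<^esub> y)"
    and "x \<in> carrier M \<Longrightarrow> a \<odot>\<^bsub>relabel h M\<^esub> h x = h (a \<odot>\<^bsub>M\<^esub> x)"
  using assms by (auto simp: relabel_def)

lemma left_module_relabel:
  assumes "left_module A M" "inj_on h (carrier M)"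
  shows "left_module A (relabel h M)"
proof -
  interpret left_module A M by fact
  note [simp] = relabel_simps[OF assms(2)] smult_closed
  have "\<exists>y\<in>carrier M. h (x \<oplus>\<^bsub>M\<^esub> y) = h \<zero>\<^bsub>M\<^esub>" if "x \<in> carrier M" for x
    using that by (intro bexI[of _ "\<ominus>\<^bsub>M\<^esub> x"]) (auto simp: M.r_neg)
  then have "abelian_group (relabel h M)"
    by (intro abelian_groupI) (auto simp: M.a_ac)
  then show ?thesis
    by (intro left_module.intro A.ring_axioms left_module_axioms.intro)
      (auto simp: smult_l_distr smult_r_distr smult_assoc1 smult_one)
qed

text \<open>
  An infinite type \<open>'u\<close> is in bijection with \<open>'u \<times> 'u\<close>; iterating such a bijection codes \<open>n\<close>-tuples. The
  tuples are functions on all of \<open>nat\<close>, of which the code sees the first \<open>n\<close> values only.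
\<close>

lemma ex_tuple_code:
  assumes "infinite (UNIV :: 'u set)"
  shows "\<exists>code :: (nat \<Rightarrow> 'u) \<Rightarrow> 'u. \<forall>v w. code v = code w \<longrightarrow> (\<forall>i<n. v i = w i)"
proof (induction n)
  case (Suc n)
  then obtain c :: "(nat \<Rightarrow> 'u) \<Rightarrow> 'u" where c: "\<And>v w. c v = c w \<Longrightarrow> \<forall>i<n. v i = w i" by blast
  have "|(UNIV :: 'u set) \<times> (UNIV :: 'u set)| =o |UNIV :: 'u set|"
    using card_of_Times_same_infinite[OF assms] .
  then obtain p :: "'u \<times> 'u \<Rightarrow> 'u" where "bij_betw p (UNIV \<times> UNIV) UNIV"
    using card_of_ordIso by blast
  then have p: "inj p" by (simp add: bij_betw_def)
  show ?case
    using c by (intro exI[of _ "\<lambda>v. p (v n, c v)"]) (auto simp: inj_eq[OF p] less_Suc_eq)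
qed simp

section \<open>A ring is Morita equivalent to each of its full corners\<close>

text \<open>
  \<open>A\<close> is an isomorphic copy of the corner \<open>\<epsilon> E \<epsilon>\<close>, where \<open>\<epsilon> = \<iota>(1)\<close>: the image of \<open>\<iota>\<close> contains the
  corner by assumption and is contained in it because \<open>\<iota>(a) = \<epsilon> \<iota>(a) \<epsilon>\<close>. Fullness of \<open>\<epsilon>\<close> is
  expressed by explicit witnesses \<open>x\<^sub>i, y\<^sub>i\<close>, as the counit of the equivalence is built from them.
\<close>

locale full_corner = A: ring A + E: ring E
  for A :: "('a, 'x) ring_scheme" and E :: "('b, 'y) ring_scheme" +
  fixes \<iota> :: "'a \<Rightarrow> 'b" and n :: nat and x y :: "nat \<Rightarrow> 'b"
  assumes iota_closed [simp]: "a \<in> carrier A \<Longrightarrow> \<iota> a \<in> carrier E"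
    and iota_add: "\<lbrakk>a \<in> carrier A; b \<in> carrier A\<rbrakk> \<Longrightarrow> \<iota> (a \<oplus>\<^bsub>A\<^esub> b) = \<iota> a \<oplus>\<^bsub>E\<^esub> \<iota> b"
    and iota_mult: "\<lbrakk>a \<in> carrier A; b \<in> carrier A\<rbrakk> \<Longrightarrow> \<iota> (a \<otimes>\<^bsub>A\<^esub> b) = \<iota> a \<otimes>\<^bsub>E\<^esub> \<iota> b"
    and iota_inj: "inj_on \<iota> (carrier A)"
    and corner_subset: "t \<in> carrier E \<Longrightarrow> \<iota> \<one>\<^bsub>A\<^esub> \<otimes>\<^bsub>E\<^esub> t \<otimes>\<^bsub>E\<^esub> \<iota> \<one>\<^bsub>A\<^esub> \<in> \<iota> ` carrier A"
    and x_closed [simp]: "i < n \<Longrightarrow> x i \<in> carrier E"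
    and y_closed [simp]: "i < n \<Longrightarrow> y i \<in> carrier E"
    and full: "(\<Oplus>\<^bsub>E\<^esub>i\<in>{..<n}. x i \<otimes>\<^bsub>E\<^esub> \<iota> \<one>\<^bsub>A\<^esub> \<otimes>\<^bsub>E\<^esub> y i) = \<one>\<^bsub>E\<^esub>"
begin

definition \<epsilon> :: 'b where "\<epsilon> = \<iota> \<one>\<^bsub>A\<^esub>"

text \<open>The compression \<open>t \<mapsto> \<epsilon> t \<epsilon>\<close> onto the corner, with values read in the copy \<open>A\<close>.\<close>

definition \<kappa> :: "'b \<Rightarrow> 'a" where "\<kappa> t = inv_into (carrier A) \<iota> (\<epsilon> \<otimes>\<^bsub>E\<^esub> t \<otimes>\<^bsub>E\<^esub> \<epsilon>)"

lemma eps_closed [simp]: "\<epsilon> \<in> carrier E"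
  by (simp add: \<epsilon>_def)

lemma kappa_closed [simp]: "t \<in> carrier E \<Longrightarrow> \<kappa> t \<in> carrier A"
  unfolding \<kappa>_def \<epsilon>_def by (rule inv_into_into[OF corner_subset])

lemma iota_kappa: "t \<in> carrier E \<Longrightarrow> \<iota> (\<kappa> t) = \<epsilon> \<otimes>\<^bsub>E\<^esub> t \<otimes>\<^bsub>E\<^esub> \<epsilon>"
  unfolding \<kappa>_def \<epsilon>_def by (rule f_inv_into_f[OF corner_subset])

lemma eps_iota [simp]: "a \<in> carrier A \<Longrightarrow> \<epsilon> \<otimes>\<^bsub>E\<^esub> \<iota> a = \<iota> a"
  and iota_eps [simp]: "a \<in> carrier A \<Longrightarrow> \<iota> a \<otimes>\<^bsub>E\<^esub> \<epsilon> = \<iota> a"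
  unfolding \<epsilon>_def by (simp_all flip: iota_mult)

lemma eps_idem [simp]: "\<epsilon> \<otimes>\<^bsub>E\<^esub> \<epsilon> = \<epsilon>"
  using eps_iota[of "\<one>\<^bsub>A\<^esub>"] by (simp add: \<epsilon>_def)

lemma eps_idem_left [simp]: "t \<in> carrier E \<Longrightarrow> \<epsilon> \<otimes>\<^bsub>E\<^esub> (\<epsilon> \<otimes>\<^bsub>E\<^esub> t) = \<epsilon> \<otimes>\<^bsub>E\<^esub> t"
  by (simp flip: E.m_assoc)

lemma eps_iota_left [simp]:
  "\<lbrakk>a \<in> carrier A; t \<in> carrier E\<rbrakk> \<Longrightarrow> \<epsilon> \<otimes>\<^bsub>E\<^esub> (\<iota> a \<otimes>\<^bsub>E\<^esub> t) = \<iota> a \<otimes>\<^bsub>E\<^esub> t"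
  by (simp flip: E.m_assoc)

lemma full': "(\<Oplus>\<^bsub>E\<^esub>i\<in>{..<n}. x i \<otimes>\<^bsub>E\<^esub> (\<epsilon> \<otimes>\<^bsub>E\<^esub> y i)) = \<one>\<^bsub>E\<^esub>"
  unfolding full[symmetric] by (intro E.finsum_cong') (auto simp: E.m_assoc \<epsilon>_def)

lemma kappa_eqI: "\<lbrakk>a \<in> carrier A; t \<in> carrier E; \<epsilon> \<otimes>\<^bsub>E\<^esub> t \<otimes>\<^bsub>E\<^esub> \<epsilon> = \<iota> a\<rbrakk> \<Longrightarrow> \<kappa> t = a"
  using iota_inj by (metis inj_onD iota_kappa kappa_closed)

lemma kappa_add:
  "\<lbrakk>s \<in> carrier E; t \<in> carrier E\<rbrakk> \<Longrightarrow> \<kappa> (s \<oplus>\<^bsub>E\<^esub> t) = \<kappa> s \<oplus>\<^bsub>A\<^esub> \<kappa> t"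
  by (rule kappa_eqI) (simp_all add: iota_add iota_kappa E.l_distr E.r_distr)

lemma kappa_iota_left:
  "\<lbrakk>a \<in> carrier A; t \<in> carrier E\<rbrakk> \<Longrightarrow> \<kappa> (\<iota> a \<otimes>\<^bsub>E\<^esub> t) = a \<otimes>\<^bsub>A\<^esub> \<kappa> t"
  by (rule kappa_eqI) (simp_all add: iota_mult iota_kappa flip: E.m_assoc)

lemma kappa_iota_right:
  "\<lbrakk>a \<in> carrier A; t \<in> carrier E\<rbrakk> \<Longrightarrow> \<kappa> (t \<otimes>\<^bsub>E\<^esub> \<iota> a) = \<kappa> t \<otimes>\<^bsub>A\<^esub> a"
  by (rule kappa_eqI) (simp_all add: iota_mult iota_kappa E.m_assoc)

lemma kappa_eps: "\<kappa> \<epsilon> = \<one>\<^bsub>A\<^esub>"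
  by (rule kappa_eqI) (simp_all, simp add: \<epsilon>_def)

subsection \<open>Restriction to the corner\<close>

text \<open>The \<open>A\<close>-module \<open>\<epsilon> N\<close>; an element lies in \<open>\<epsilon> N\<close> if and only if \<open>\<epsilon>\<close> fixes it.\<close>

definition cut :: "('b, 'c) module \<Rightarrow> ('a, 'c) module"
  where "cut N =
    \<lparr>carrier = {v \<in> carrier N. \<epsilon> \<odot>\<^bsub>N\<^esub> v = v}, monoid.mult = undefined, one = undefined,
     ring.zero = \<zero>\<^bsub>N\<^esub>, add = ring.add N, smult = (\<lambda>a v. \<iota> a \<odot>\<^bsub>N\<^esub> v)\<rparr>"

lemma cut_simps [simp]:
  "v \<in> carrier (cut N) \<longleftrightarrow> v \<in> carrier N \<and> \<epsilon> \<odot>\<^bsub>N\<^esub> v = v"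
  "\<zero>\<^bsub>cut N\<^esub> = \<zero>\<^bsub>N\<^esub>" "v \<oplus>\<^bsub>cut N\<^esub> w = v \<oplus>\<^bsub>N\<^esub> w" "a \<odot>\<^bsub>cut N\<^esub> v = \<iota> a \<odot>\<^bsub>N\<^esub> v"
  by (auto simp: cut_def)

lemma left_module_cut:
  assumes "left_module E N"
  shows "left_module A (cut N)"
proof -
  interpret N: left_module E N by fact
  have "\<exists>w. (w \<in> carrier N \<and> \<epsilon> \<odot>\<^bsub>N\<^esub> w = w) \<and> v \<oplus>\<^bsub>N\<^esub> w = \<zero>\<^bsub>N\<^esub>"
    if "v \<in> carrier N" "\<epsilon> \<odot>\<^bsub>N\<^esub> v = v" for v
    using that by (intro exI[of _ "\<ominus>\<^bsub>N\<^esub> v"]) (simp add: N.smult_minus N.M.r_neg)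
  then have "abelian_group (cut N)"
    by (intro abelian_groupI) (auto simp: N.smult_r_distr N.smult_zero N.M.a_ac Bex_def)
  then show ?thesis
    by (intro left_module.intro A.ring_axioms left_module_axioms.intro)
      (auto simp: N.smult_r_distr N.smult_closed iota_add iota_mult N.smult_l_distr
        simp flip: N.smult_assoc1 \<epsilon>_def)
qed

lemma lmod_hom_cut:
  assumes "f \<in> lmod_hom E N N'" "left_module E N"
  shows "restrict f (carrier (cut N)) \<in> lmod_hom A (cut N) (cut N')"
proof -
  interpret C: left_module A "cut N" by (rule left_module_cut) fact
  show ?thesis
    using lmod_homD[OF assms(1)] C.smult_closed C.M.a_closed
    by (intro lmod_homI) (auto, metis eps_closed)
qed

lemma lmod_functor_cut: "lmod_functor E A cut (\<lambda>N N' f. restrict f (carrier (cut N)))"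
proof -
  have "restrict (compose (carrier N) g f) (carrier (cut N))
      = compose (carrier (cut N)) (restrict g (carrier (cut N'))) (restrict f (carrier (cut N)))"
    if "left_module E N" "f \<in> lmod_hom E N N'" for N N' f g
    using lmod_homD(2)[OF lmod_hom_cut[OF that(2,1)]]
    by (intro extensionalityI[of _ "carrier (cut N)"]) (auto simp: compose_eq compose_def)
  then show ?thesis
    unfolding lmod_functor_def
    by (auto simp: left_module_cut lmod_hom_cut intro!: restrict_ext)
qed


subsection \<open>Coinduction from the corner\<close>

definition regular_lmod :: "('c, 'z) ring_scheme \<Rightarrow> ('c, 'c) module"
  where "regular_lmod B =
    \<lparr>carrier = carrier B, monoid.mult = undefined, one = undefined,
     ring.zero = \<zero>\<^bsub>B\<^esub>, add = ring.add B, smult = monoid.mult B\<rparr>"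

lemma regular_lmod_simps [simp]:
  "carrier (regular_lmod B) = carrier B" "\<zero>\<^bsub>regular_lmod B\<^esub> = \<zero>\<^bsub>B\<^esub>"
  "s \<oplus>\<^bsub>regular_lmod B\<^esub> t = s \<oplus>\<^bsub>B\<^esub> t" "s \<odot>\<^bsub>regular_lmod B\<^esub> t = s \<otimes>\<^bsub>B\<^esub> t"
  by (simp_all add: regular_lmod_def)

lemma left_module_regular:
  assumes "ring B"
  shows "left_module B (regular_lmod B)"
proof -
  interpret ring B by fact
  have "\<exists>y\<in>carrier B. y \<oplus>\<^bsub>B\<^esub> x = \<zero>\<^bsub>B\<^esub>" if "x \<in> carrier B" for x
    using that by (intro bexI[of _ "\<ominus>\<^bsub>B\<^esub> x"]) (auto simp: l_neg)
  then have "abelian_group (regular_lmod B)"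
    by (intro abelian_groupI) (auto simp: a_ac)
  then show ?thesis
    by (intro left_module.intro ring_axioms left_module_axioms.intro)
      (auto simp: l_distr r_distr m_assoc)
qed

text \<open>
  The left \<open>A\<close>-module \<open>\<epsilon> E\<close>. Right multiplication by \<open>E\<close> preserves it, which makes the homomorphisms
  from it to any \<open>A\<close>-module a left \<open>E\<close>-module.
\<close>

definition Q :: "('a, 'b) module" where "Q = cut (regular_lmod E)"

sublocale Q: left_module A Q
  unfolding Q_def by (intro left_module_cut left_module_regular E.ring_axioms)

lemma Q_simps [simp]:
  "q \<in> carrier Q \<longleftrightarrow> q \<in> carrier E \<and> \<epsilon> \<otimes>\<^bsub>E\<^esub> q = q"
  "q \<oplus>\<^bsub>Q\<^esub> r = q \<oplus>\<^bsub>E\<^esub> r" "a \<odot>\<^bsub>Q\<^esub> q = \<iota> a \<otimes>\<^bsub>E\<^esub> q"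
  by (simp_all add: Q_def)

lemma Q_mult: "\<lbrakk>q \<in> carrier Q; t \<in> carrier E\<rbrakk> \<Longrightarrow> q \<otimes>\<^bsub>E\<^esub> t \<in> carrier Q"
  by (simp flip: E.m_assoc)

definition coind :: "('a, 'c) module \<Rightarrow> ('b, 'b \<Rightarrow> 'c) module"
  where "coind M =
    \<lparr>carrier = lmod_hom A Q M, monoid.mult = undefined, one = undefined,
     ring.zero = (\<lambda>q\<in>carrier Q. \<zero>\<^bsub>M\<^esub>),
     add = (\<lambda>f g. \<lambda>q\<in>carrier Q. f q \<oplus>\<^bsub>M\<^esub> g q),
     smult = (\<lambda>t f. \<lambda>q\<in>carrier Q. f (q \<otimes>\<^bsub>E\<^esub> t))\<rparr>"

lemma coind_simps [simp]:
  "carrier (coind M) = lmod_hom A Q M"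
  "\<zero>\<^bsub>coind M\<^esub> = (\<lambda>q\<in>carrier Q. \<zero>\<^bsub>M\<^esub>)"
  "f \<oplus>\<^bsub>coind M\<^esub> g = (\<lambda>q\<in>carrier Q. f q \<oplus>\<^bsub>M\<^esub> g q)"
  "t \<odot>\<^bsub>coind M\<^esub> f = (\<lambda>q\<in>carrier Q. f (q \<otimes>\<^bsub>E\<^esub> t))"
  by (simp_all add: coind_def)

lemma lmod_hom_Q_eqI:
  assumes "f \<in> lmod_hom A Q M" "g \<in> lmod_hom A Q M"
    and "\<And>q. \<lbrakk>q \<in> carrier E; \<epsilon> \<otimes>\<^bsub>E\<^esub> q = q\<rbrakk> \<Longrightarrow> f q = g q"
  shows "f = g"
  using assms lmod_homD(1) by (intro extensionalityI[of _ "carrier Q"]) auto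

lemma left_module_coind:
  assumes "left_module A M"
  shows "left_module E (coind M)"
proof -
  interpret M: left_module A M by fact
  note D = lmod_homD(2-4)[where M = Q and N = M and A = A]
  have add: "f \<oplus>\<^bsub>coind M\<^esub> g \<in> lmod_hom A Q M"
    if "f \<in> lmod_hom A Q M" "g \<in> lmod_hom A Q M" for f g
    using that D[OF that(1)] D[OF that(2)] Q.smult_closed Q.M.a_closed
    by (intro lmod_homI) (auto simp: M.M.a_ac M.smult_r_distr)
  have smult: "t \<odot>\<^bsub>coind M\<^esub> f \<in> lmod_hom A Q M"
    if "f \<in> lmod_hom A Q M" "t \<in> carrier E" for t f
    using that D[OF that(1)] Q.smult_closed Q.M.a_closed Q_mult
    by (intro lmod_homI) (auto simp: E.l_distr E.m_assoc)
  have neg: "\<exists>g\<in>lmod_hom A Q M. g \<oplus>\<^bsub>coind M\<^esub> f = \<zero>\<^bsub>coind M\<^esub>"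
    if "f \<in> lmod_hom A Q M" for f
  proof
    show "(\<lambda>q\<in>carrier Q. \<ominus>\<^bsub>M\<^esub> f q) \<in> lmod_hom A Q M"
      using that D[OF that] Q.smult_closed Q.M.a_closed
      by (intro lmod_homI) (auto simp: M.M.minus_add M.M.a_comm M.smult_minus)
  qed (use D[OF that] in \<open>auto simp: M.M.l_neg\<close>)
  have zero: "\<zero>\<^bsub>coind M\<^esub> \<in> lmod_hom A Q M"
    using Q.smult_closed Q.M.a_closed by (intro lmod_homI) (auto simp: M.smult_zero)
  have "abelian_group (coind M)"
  proof (rule abelian_groupI, unfold coind_simps(1))
    fix f g h assume fgh: "f \<in> lmod_hom A Q M" "g \<in> lmod_hom A Q M" "h \<in> lmod_hom A Q M"
    show "f \<oplus>\<^bsub>coind M\<^esub> g \<oplus>\<^bsub>coind M\<^esub> h = f \<oplus>\<^bsub>coind M\<^esub> (g \<oplus>\<^bsub>coind M\<^esub> h)"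
      using D(1)[OF fgh(1)] D(1)[OF fgh(2)] D(1)[OF fgh(3)]
      by (intro lmod_hom_Q_eqI[where M = M] add fgh) (auto simp: M.M.a_assoc)
    show "f \<oplus>\<^bsub>coind M\<^esub> g = g \<oplus>\<^bsub>coind M\<^esub> f"
      using D(1)[OF fgh(1)] D(1)[OF fgh(2)]
      by (intro lmod_hom_Q_eqI[where M = M] add fgh) (auto simp: M.M.a_comm)
    show "\<exists>g\<in>lmod_hom A Q M. g \<oplus>\<^bsub>coind M\<^esub> f = \<zero>\<^bsub>coind M\<^esub>"
      by (rule neg) fact
    show "\<zero>\<^bsub>coind M\<^esub> \<oplus>\<^bsub>coind M\<^esub> f = f"
      using D(1)[OF fgh(1)] by (intro lmod_hom_Q_eqI[where M = M] add zero fgh) auto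
  qed (use add zero in auto)
  moreover have "left_module_axioms E (coind M)"
  proof (rule left_module_axioms.intro, unfold coind_simps(1))
    fix s t f g assume s: "s \<in> carrier E" and t: "t \<in> carrier E"
      and f: "f \<in> lmod_hom A Q M" and g: "g \<in> lmod_hom A Q M"
    note in_Q = Q_mult[unfolded Q_simps, OF conjI]
    show "s \<odot>\<^bsub>coind M\<^esub> f \<in> lmod_hom A Q M" by (rule smult) fact+
    show "(s \<oplus>\<^bsub>E\<^esub> t) \<odot>\<^bsub>coind M\<^esub> f = s \<odot>\<^bsub>coind M\<^esub> f \<oplus>\<^bsub>coind M\<^esub> t \<odot>\<^bsub>coind M\<^esub> f"
      using s t D[OF f] in_Q
      by (intro lmod_hom_Q_eqI[where M = M] add smult f) (auto simp: E.r_distr)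
    show "s \<odot>\<^bsub>coind M\<^esub> (f \<oplus>\<^bsub>coind M\<^esub> g) = s \<odot>\<^bsub>coind M\<^esub> f \<oplus>\<^bsub>coind M\<^esub> s \<odot>\<^bsub>coind M\<^esub> g"
      using s D(1)[OF f] D(1)[OF g] in_Q
      by (intro lmod_hom_Q_eqI[where M = M] add smult f g) auto
    show "s \<otimes>\<^bsub>E\<^esub> t \<odot>\<^bsub>coind M\<^esub> f = s \<odot>\<^bsub>coind M\<^esub> (t \<odot>\<^bsub>coind M\<^esub> f)"
      using s t D(1)[OF f] in_Q
      by (intro lmod_hom_Q_eqI[where M = M] smult f) (auto simp: E.m_assoc)
  next
    fix f assume f: "f \<in> lmod_hom A Q M"
    show "\<one>\<^bsub>E\<^esub> \<odot>\<^bsub>coind M\<^esub> f = f"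
      by (intro lmod_hom_Q_eqI[where M = M] smult f) auto
  qed
  ultimately show ?thesis
    by (intro left_module.intro E.ring_axioms)
qed


lemma sum_Q: "q \<in> carrier E \<Longrightarrow>
    (\<Oplus>\<^bsub>E\<^esub>i\<in>{..<n}. q \<otimes>\<^bsub>E\<^esub> (x i \<otimes>\<^bsub>E\<^esub> (\<epsilon> \<otimes>\<^bsub>E\<^esub> y i))) = q"
  using E.finsum_rdistr[of "{..<n}" q "\<lambda>i. x i \<otimes>\<^bsub>E\<^esub> (\<epsilon> \<otimes>\<^bsub>E\<^esub> y i)"]
  by (simp add: full' Pi_iff)

text \<open>
  The elements \<open>\<epsilon> y\<^sub>i\<close> generate \<open>\<epsilon> E\<close> over \<open>A\<close>: from \<open>1 = \<Sum> x\<^sub>i \<epsilon> y\<^sub>i\<close> one gets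
  \<open>q = \<Sum> (q x\<^sub>i \<epsilon>) (\<epsilon> y\<^sub>i)\<close>, whose coefficients lie in the corner. Here this is used twice: to code
  homomorphisms by tuples and to prove that the counit is bijective.
\<close>

lemma hom_Q_expansion:
  assumes M: "left_module A M" and f: "f \<in> lmod_hom A Q M" and q: "q \<in> carrier Q"
  shows "f q = (\<Oplus>\<^bsub>M\<^esub>i\<in>{..<n}. \<kappa> (q \<otimes>\<^bsub>E\<^esub> x i) \<odot>\<^bsub>M\<^esub> f (\<epsilon> \<otimes>\<^bsub>E\<^esub> y i))"
proof -
  interpret M: left_module A M by fact
  interpret f: abelian_group_hom Q M f
    using lmod_hom_imp_abelian_group_hom Q.left_module_axioms M f by blast
  have "q \<in> carrier E" "\<epsilon> \<otimes>\<^bsub>E\<^esub> q = q" using q by auto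
  have eq: "\<kappa> (q \<otimes>\<^bsub>E\<^esub> x i) \<odot>\<^bsub>Q\<^esub> (\<epsilon> \<otimes>\<^bsub>E\<^esub> y i) = q \<otimes>\<^bsub>E\<^esub> (x i \<otimes>\<^bsub>E\<^esub> (\<epsilon> \<otimes>\<^bsub>E\<^esub> y i))"
    if "i < n" for i
    using that \<open>q \<in> carrier E\<close> \<open>\<epsilon> \<otimes>\<^bsub>E\<^esub> q = q\<close>
    by (simp add: iota_kappa E.m_assoc flip: E.m_assoc[of \<epsilon> q])
  \<comment> \<open>Finite sums in \<open>Q\<close> are sums in \<open>E\<close> because the inclusion is additive.\<close>
  have incl: "abelian_group_hom Q E (\<lambda>q. q)"
    by (intro additive_imp_abelian_group_hom Q.M.abelian_group_axioms E.abelian_group_axioms) auto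
  have terms: "\<kappa> (q \<otimes>\<^bsub>E\<^esub> x i) \<odot>\<^bsub>Q\<^esub> (\<epsilon> \<otimes>\<^bsub>E\<^esub> y i) \<in> carrier Q" "\<epsilon> \<otimes>\<^bsub>E\<^esub> y i \<in> carrier Q" if "i < n" for i
    using that \<open>q \<in> carrier E\<close> by simp_all
  have "(\<Oplus>\<^bsub>Q\<^esub>i\<in>{..<n}. \<kappa> (q \<otimes>\<^bsub>E\<^esub> x i) \<odot>\<^bsub>Q\<^esub> (\<epsilon> \<otimes>\<^bsub>E\<^esub> y i))
      = (\<Oplus>\<^bsub>E\<^esub>i\<in>{..<n}. \<kappa> (q \<otimes>\<^bsub>E\<^esub> x i) \<odot>\<^bsub>Q\<^esub> (\<epsilon> \<otimes>\<^bsub>E\<^esub> y i))"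
    by (rule abelian_group_hom.hom_finsum[OF incl]) (use terms in auto)
  also have "\<dots> = (\<Oplus>\<^bsub>E\<^esub>i\<in>{..<n}. q \<otimes>\<^bsub>E\<^esub> (x i \<otimes>\<^bsub>E\<^esub> (\<epsilon> \<otimes>\<^bsub>E\<^esub> y i)))"
    using \<open>q \<in> carrier E\<close> by (intro E.finsum_cong' refl eq) auto
  also have "\<dots> = q" by (rule sum_Q) fact
  finally have "f q = f (\<Oplus>\<^bsub>Q\<^esub>i\<in>{..<n}. \<kappa> (q \<otimes>\<^bsub>E\<^esub> x i) \<odot>\<^bsub>Q\<^esub> (\<epsilon> \<otimes>\<^bsub>E\<^esub> y i))" by simp
  also have "\<dots> = (\<Oplus>\<^bsub>M\<^esub>i\<in>{..<n}. f (\<kappa> (q \<otimes>\<^bsub>E\<^esub> x i) \<odot>\<^bsub>Q\<^esub> (\<epsilon> \<otimes>\<^bsub>E\<^esub> y i)))"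
    by (rule f.hom_finsum) (use terms in auto)
  also have "\<dots> = (\<Oplus>\<^bsub>M\<^esub>i\<in>{..<n}. \<kappa> (q \<otimes>\<^bsub>E\<^esub> x i) \<odot>\<^bsub>M\<^esub> f (\<epsilon> \<otimes>\<^bsub>E\<^esub> y i))"
    using terms \<open>q \<in> carrier E\<close>
    by (intro M.M.finsum_cong' refl lmod_homD(4)[OF f]) (auto intro!: M.smult_closed f.hom_closed)
  finally show ?thesis .
qed

subsection \<open>The equivalence\<close>

context
  fixes code :: "(nat \<Rightarrow> 'u) \<Rightarrow> 'u"
  assumes code: "code v = code w \<Longrightarrow> i < n \<Longrightarrow> v i = w i"
begin

text \<open>
  Injective on homomorphisms because the \<open>\<epsilon> y\<^sub>i\<close> generate \<open>\<epsilon> E\<close>. The same map serves all modules.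
\<close>

definition enc :: "('b \<Rightarrow> 'u) \<Rightarrow> 'u" where "enc f = code (\<lambda>i. f (\<epsilon> \<otimes>\<^bsub>E\<^esub> y i))"

lemma inj_on_enc:
  assumes "left_module A M"
  shows "inj_on enc (lmod_hom A Q M)"
proof (rule inj_onI)
  fix f g assume f: "f \<in> lmod_hom A Q M" and g: "g \<in> lmod_hom A Q M" and "enc f = enc g"
  interpret M: left_module A M by fact
  have eq: "f (\<epsilon> \<otimes>\<^bsub>E\<^esub> y i) = g (\<epsilon> \<otimes>\<^bsub>E\<^esub> y i)" if "i < n" for i
    using \<open>enc f = enc g\<close> that unfolding enc_def by (rule code)
  show "f = g"
  proof (rule lmod_hom_Q_eqI[OF f g])
    fix q assume q: "q \<in> carrier E" "\<epsilon> \<otimes>\<^bsub>E\<^esub> q = q"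
    then have "q \<in> carrier Q" by simp
    then show "f q = g q"
      unfolding hom_Q_expansion[OF assms f \<open>q \<in> carrier Q\<close>] hom_Q_expansion[OF assms g \<open>q \<in> carrier Q\<close>]
      using q by (intro M.M.finsum_cong' refl) (auto simp: eq intro!: M.smult_closed lmod_homD(2)[OF g])
  qed
qed

text \<open>The coinduced module, copied into the universe.\<close>

definition F :: "('a, 'u) module \<Rightarrow> ('b, 'u) module" where "F M = relabel enc (coind M)"

lemma left_module_F: "left_module A M \<Longrightarrow> left_module E (F M)"
  unfolding F_def by (intro left_module_relabel left_module_coind) (auto intro: inj_on_enc)

lemma carrier_F [simp]: "carrier (F M) = enc ` lmod_hom A Q M"
  by (simp add: F_def)

lemma F_simps:
  assumes "left_module A M"
  shows "\<lbrakk>f \<in> lmod_hom A Q M; g \<in> lmod_hom A Q M\<rbrakk> \<Longrightarrow>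
      enc f \<oplus>\<^bsub>F M\<^esub> enc g = enc (\<lambda>q\<in>carrier Q. f q \<oplus>\<^bsub>M\<^esub> g q)"
    and "f \<in> lmod_hom A Q M \<Longrightarrow> t \<odot>\<^bsub>F M\<^esub> enc f = enc (\<lambda>q\<in>carrier Q. f (q \<otimes>\<^bsub>E\<^esub> t))"
  using assms by (simp_all add: F_def inj_on_enc)

definition F_map :: "('a, 'u) module \<Rightarrow> ('a, 'u) module \<Rightarrow> ('u \<Rightarrow> 'u) \<Rightarrow> ('u \<Rightarrow> 'u)"
  where "F_map M M' f =
    (\<lambda>u\<in>carrier (F M). enc (compose (carrier Q) f (inv_into (lmod_hom A Q M) enc u)))"

lemma F_map_enc:
  assumes "left_module A M" "g \<in> lmod_hom A Q M"
  shows "F_map M M' f (enc g) = enc (compose (carrier Q) f g)"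
  using assms by (simp add: F_map_def inj_on_enc)

lemma lmod_functor_F: "lmod_functor A E F F_map"
proof -
  have comp: "compose (carrier Q) f g \<in> lmod_hom A Q M'"
    if "g \<in> lmod_hom A Q M" "f \<in> lmod_hom A M M'" for M M' :: "('a, 'u) module" and f g
    using lmod_hom_compose[OF that Q.left_module_axioms] .
  have mod: "(\<lambda>q\<in>carrier Q. g q \<oplus>\<^bsub>M\<^esub> h q) \<in> lmod_hom A Q M"
      "t \<in> carrier E \<Longrightarrow> (\<lambda>q\<in>carrier Q. g (q \<otimes>\<^bsub>E\<^esub> t)) \<in> lmod_hom A Q M"
    if "left_module A M" "g \<in> lmod_hom A Q M" "h \<in> lmod_hom A Q M" for M :: "('a, 'u) module" and g h t
  proof -
    interpret C: left_module E "coind M" by (rule left_module_coind) fact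
    show "(\<lambda>q\<in>carrier Q. g q \<oplus>\<^bsub>M\<^esub> h q) \<in> lmod_hom A Q M"
      "t \<in> carrier E \<Longrightarrow> (\<lambda>q\<in>carrier Q. g (q \<otimes>\<^bsub>E\<^esub> t)) \<in> lmod_hom A Q M"
      using C.M.a_closed[of g h] C.smult_closed[of t g] that by simp_all
  qed
  have hom: "F_map M M' f \<in> lmod_hom E (F M) (F M')"
    if M: "left_module A M" and M': "left_module A M'" and f: "f \<in> lmod_hom A M M'" for M M' f
  proof (rule lmod_homI)
    show "F_map M M' f \<in> extensional (carrier (F M))" by (simp add: F_map_def)
    fix u assume "u \<in> carrier (F M)"
    then obtain g where g: "g \<in> lmod_hom A Q M" "u = enc g" by auto
    show "F_map M M' f u \<in> carrier (F M')"
      using g M comp[OF g(1) f] by (simp add: F_map_enc)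
    {
      fix v assume "v \<in> carrier (F M)"
      then obtain h where h: "h \<in> lmod_hom A Q M" "v = enc h" by auto
      have "compose (carrier Q) f (\<lambda>q\<in>carrier Q. g q \<oplus>\<^bsub>M\<^esub> h q)
          = (\<lambda>q\<in>carrier Q. compose (carrier Q) f g q \<oplus>\<^bsub>M'\<^esub> compose (carrier Q) f h q)"
        using lmod_homD(2)[OF g(1)] lmod_homD(2)[OF h(1)] lmod_homD(3)[OF f]
        by (auto simp: compose_def)
      then show "F_map M M' f (u \<oplus>\<^bsub>F M\<^esub> v) = F_map M M' f u \<oplus>\<^bsub>F M'\<^esub> F_map M M' f v"
        using g h M M' f by (simp add: F_simps F_map_enc mod comp)
    next
      fix t assume t: "t \<in> carrier E"
      have "compose (carrier Q) f (\<lambda>q\<in>carrier Q. g (q \<otimes>\<^bsub>E\<^esub> t))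
          = (\<lambda>q\<in>carrier Q. compose (carrier Q) f g (q \<otimes>\<^bsub>E\<^esub> t))"
        using t Q_mult by (auto simp: compose_def simp del: Q_simps)
      then show "F_map M M' f (t \<odot>\<^bsub>F M\<^esub> u) = t \<odot>\<^bsub>F M'\<^esub> F_map M M' f u"
        using g t M M' f by (simp add: F_simps F_map_enc mod comp)
    }
  qed
  have id: "F_map M M (\<lambda>v\<in>carrier M. v) = (\<lambda>u\<in>carrier (F M). u)" if M: "left_module A M" for M
  proof (rule extensionalityI[of _ "carrier (F M)"])
    fix u assume "u \<in> carrier (F M)"
    then obtain g where g: "g \<in> lmod_hom A Q M" "u = enc g" by auto
    have "compose (carrier Q) (\<lambda>v\<in>carrier M. v) g = g"
      using lmod_homD(1,2)[OF g(1)]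
      by (intro extensionalityI[of _ "carrier Q"]) (auto simp: compose_eq simp del: Q_simps)
    then show "F_map M M (\<lambda>v\<in>carrier M. v) u = (\<lambda>u\<in>carrier (F M). u) u"
      using g M by (simp add: F_map_enc)
  qed (auto simp: F_map_def)
  have compo: "F_map M M'' (compose (carrier M) g f) = compose (carrier (F M)) (F_map M' M'' g) (F_map M M' f)"
    if M: "left_module A M" and M': "left_module A M'" and f: "f \<in> lmod_hom A M M'" for M M' M'' f g
  proof (rule extensionalityI[of _ "carrier (F M)"])
    fix u assume "u \<in> carrier (F M)"
    then obtain h where h: "h \<in> lmod_hom A Q M" "u = enc h" by auto
    have "compose (carrier Q) (compose (carrier M) g f) h = compose (carrier Q) g (compose (carrier Q) f h)"
      using lmod_homD(2)[OF h(1)] by (auto simp: compose_def fun_eq_iff)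
    then show "F_map M M'' (compose (carrier M) g f) u = compose (carrier (F M)) (F_map M' M'' g) (F_map M M' f) u"
      using h M M' f comp by (simp add: F_map_enc compose_eq)
  qed (auto simp: F_map_def)
  show ?thesis
    unfolding lmod_functor_def using left_module_F hom id compo by blast
qed

text \<open>
  The unit \<open>X \<rightarrow> \<epsilon> Hom(\<epsilon> E, X)\<close> sends \<open>m\<close> to \<open>q \<mapsto> \<kappa>(q) m\<close>; evaluation at \<open>\<epsilon>\<close> is its inverse. Indeed
  \<open>f\<close> is fixed by \<open>\<epsilon>\<close> if and only if \<open>f(q) = f(q \<epsilon>)\<close>, and then \<open>f(q) = f(\<kappa>(q) \<epsilon>) = \<kappa>(q) f(\<epsilon>)\<close>.
\<close>

definition unit :: "('a, 'u) module \<Rightarrow> 'u \<Rightarrow> 'u"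
  where "unit M = (\<lambda>m\<in>carrier M. enc (\<lambda>q\<in>carrier Q. \<kappa> q \<odot>\<^bsub>M\<^esub> m))"

lemma kappa_action_hom:
  assumes "left_module A M" "m \<in> carrier M"
  shows "(\<lambda>q\<in>carrier Q. \<kappa> q \<odot>\<^bsub>M\<^esub> m) \<in> lmod_hom A Q M"
proof -
  interpret M: left_module A M by fact
  show ?thesis
    using assms(2) Q.smult_closed Q.M.a_closed
    by (intro lmod_homI)
      (auto simp: M.smult_closed kappa_add M.smult_l_distr kappa_iota_left M.smult_assoc1)
qed

lemma unit_iso:
  assumes "left_module A M"
  shows "unit M \<in> lmod_iso A M (cut (F M))"
proof -
  interpret M: left_module A M by fact
  note [simp] = F_simps[OF assms] kappa_action_hom[OF assms]
  let ?h = "\<lambda>m. \<lambda>q\<in>carrier Q. \<kappa> q \<odot>\<^bsub>M\<^esub> m"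
  have scalar: "(\<lambda>q\<in>carrier Q. ?h m (q \<otimes>\<^bsub>E\<^esub> \<iota> a)) = ?h (a \<odot>\<^bsub>M\<^esub> m)"
    if "m \<in> carrier M" "a \<in> carrier A" for a m
    using that Q_mult by (auto simp: kappa_iota_right M.smult_assoc1 simp flip: E.m_assoc)
  have hom: "unit M \<in> lmod_hom A M (cut (F M))"
  proof (rule lmod_homI)
    fix m assume m: "m \<in> carrier M"
    show "unit M m \<in> carrier (cut (F M))"
      using m scalar[OF m, of "\<one>\<^bsub>A\<^esub>"] by (simp add: unit_def M.smult_one \<epsilon>_def)
    fix m' assume m': "m' \<in> carrier M"
    have "?h (m \<oplus>\<^bsub>M\<^esub> m') = (\<lambda>q\<in>carrier Q. ?h m q \<oplus>\<^bsub>M\<^esub> ?h m' q)"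
      using m m' by (auto simp: M.smult_r_distr)
    then show "unit M (m \<oplus>\<^bsub>M\<^esub> m') = unit M m \<oplus>\<^bsub>cut (F M)\<^esub> unit M m'"
      using m m' by (simp add: unit_def)
  next
    fix a m assume "a \<in> carrier A" "m \<in> carrier M"
    then show "unit M (a \<odot>\<^bsub>M\<^esub> m) = a \<odot>\<^bsub>cut (F M)\<^esub> unit M m"
      using scalar by (simp add: unit_def M.smult_closed)
  qed (simp add: unit_def)
  have "inj_on (unit M) (carrier M)"
  proof (rule inj_onI)
    fix m m' assume m: "m \<in> carrier M" "m' \<in> carrier M" and "unit M m = unit M m'"
    then have "?h m = ?h m'"
      using inj_on_enc[OF assms] by (simp add: unit_def inj_on_eq_iff)
    then have "?h m \<epsilon> = ?h m' \<epsilon>" by simp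
    then show "m = m'" using m by (simp add: kappa_eps M.smult_one)
  qed
  moreover have "carrier (cut (F M)) \<subseteq> unit M ` carrier M"
  proof
    fix u assume "u \<in> carrier (cut (F M))"
    then obtain f where f: "f \<in> lmod_hom A Q M" "u = enc f" "\<epsilon> \<odot>\<^bsub>F M\<^esub> enc f = enc f" by auto
    have "\<epsilon> \<odot>\<^bsub>coind M\<^esub> f \<in> lmod_hom A Q M"
      using left_module.smult_closed[OF left_module_coind[OF assms], of \<epsilon> f] f by simp
    then have *: "(\<lambda>q\<in>carrier Q. f (q \<otimes>\<^bsub>E\<^esub> \<epsilon>)) = f"
      using f inj_on_enc[OF assms] by (simp add: inj_on_eq_iff)
    have eq: "f q = \<kappa> q \<odot>\<^bsub>M\<^esub> f \<epsilon>" if "q \<in> carrier Q" for q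
    proof -
      have "f q = f (q \<otimes>\<^bsub>E\<^esub> \<epsilon>)" using fun_cong[OF *, of q] that by simp
      also have "q \<otimes>\<^bsub>E\<^esub> \<epsilon> = \<kappa> q \<odot>\<^bsub>Q\<^esub> \<epsilon>" using that by (simp add: iota_kappa E.m_assoc)
      also have "f \<dots> = \<kappa> q \<odot>\<^bsub>M\<^esub> f \<epsilon>" using that by (intro lmod_homD(4)[OF f(1)]) auto
      finally show ?thesis .
    qed
    have f_eq: "f = ?h (f \<epsilon>)"
    proof (rule extensionalityI[of _ "carrier Q"])
      fix q assume q: "q \<in> carrier Q"
      show "f q = ?h (f \<epsilon>) q" unfolding restrict_apply'[OF q] by (rule eq[OF q])
    qed (use lmod_homD(1)[OF f(1)] in auto)
    have \<epsilon>: "f \<epsilon> \<in> carrier M" using lmod_homD(2)[OF f(1), of \<epsilon>] by simp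
    have "u = enc (?h (f \<epsilon>))" unfolding f(2) by (rule arg_cong[OF f_eq])
    also have "\<dots> = unit M (f \<epsilon>)" using \<epsilon> by (simp add: unit_def)
    finally have "u = unit M (f \<epsilon>)" .
    with \<epsilon> show "u \<in> unit M ` carrier M" by blast
  qed
  ultimately show ?thesis
    using hom lmod_homD(2)[OF hom] by (auto simp: lmod_iso_def bij_betw_def)
qed

lemma unit_natural:
  "lmod_nat_iso A A (\<lambda>M. M) (\<lambda>M N f. f) (\<lambda>M. cut (F M))
     (\<lambda>M N f. restrict (F_map M N f) (carrier (cut (F M)))) unit"
proof -
  have "compose (carrier M) (unit N) f
      = compose (carrier M) (restrict (F_map M N f) (carrier (cut (F M)))) (unit M)"
    if M: "left_module A M" and N: "left_module A N" and f: "f \<in> lmod_hom A M N" for M N f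
  proof (rule extensionalityI[of _ "carrier M"])
    fix m assume m: "m \<in> carrier M"
    let ?h = "\<lambda>q\<in>carrier Q. \<kappa> q \<odot>\<^bsub>M\<^esub> m"
    have "unit M m \<in> carrier (cut (F M))"
      using unit_iso[OF M] m unfolding lmod_iso_def by (blast intro: lmod_homD(2))
    then have "compose (carrier M) (restrict (F_map M N f) (carrier (cut (F M)))) (unit M) m
        = F_map M N f (unit M m)"
      using m by (simp add: compose_eq)
    also have "\<dots> = enc (compose (carrier Q) f ?h)"
      using m by (simp add: unit_def F_map_enc M kappa_action_hom)
    also have "compose (carrier Q) f ?h = (\<lambda>q\<in>carrier Q. \<kappa> q \<odot>\<^bsub>N\<^esub> f m)"
      using m lmod_homD(4)[OF f] by (auto simp: compose_def)
    also have "enc (\<lambda>q\<in>carrier Q. \<kappa> q \<odot>\<^bsub>N\<^esub> f m) = compose (carrier M) (unit N) f m"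
      using m lmod_homD(2)[OF f] by (simp add: unit_def compose_eq)
    finally show "compose (carrier M) (unit N) f m
      = compose (carrier M) (restrict (F_map M N f) (carrier (cut (F M)))) (unit M) m" ..
  qed auto
  then show ?thesis
    unfolding lmod_nat_iso_def by (auto simp: unit_iso)
qed

text \<open>
  The inverse of the counit \<open>Hom(\<epsilon> E, \<epsilon> N) \<rightarrow> N\<close>. It has a simpler description than the counit itself,
  which sends \<open>f\<close> to \<open>\<Sum> x\<^sub>i f(\<epsilon> y\<^sub>i)\<close>.
\<close>

definition counit_inv :: "('b, 'u) module \<Rightarrow> 'u \<Rightarrow> 'u"
  where "counit_inv N = (\<lambda>v\<in>carrier N. enc (\<lambda>q\<in>carrier Q. q \<odot>\<^bsub>N\<^esub> v))"

lemma action_hom_cut: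
  assumes "left_module E N" "v \<in> carrier N"
  shows "(\<lambda>q\<in>carrier Q. q \<odot>\<^bsub>N\<^esub> v) \<in> lmod_hom A Q (cut N)"
proof -
  interpret N: left_module E N by fact
  show ?thesis
    using assms(2) Q.smult_closed Q.M.a_closed
    by (intro lmod_homI)
      (auto simp: N.smult_closed N.smult_l_distr N.smult_assoc1 simp flip: N.smult_assoc1[of \<epsilon>])
qed

lemma counit_inv_iso:
  assumes N: "left_module E N"
  shows "counit_inv N \<in> lmod_iso E N (F (cut N))"
proof -
  interpret N: left_module E N by fact
  note C = left_module_cut[OF N]
  interpret C: left_module A "cut N" by (rule C)
  note [simp] = F_simps[OF C] action_hom_cut[OF N] N.smult_closed
  let ?h = "\<lambda>v. \<lambda>q\<in>carrier Q. q \<odot>\<^bsub>N\<^esub> v"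
  have hom: "counit_inv N \<in> lmod_hom E N (F (cut N))"
  proof (rule lmod_homI)
    fix v w assume v: "v \<in> carrier N" and w: "w \<in> carrier N"
    have "?h (v \<oplus>\<^bsub>N\<^esub> w) = (\<lambda>q\<in>carrier Q. ?h v q \<oplus>\<^bsub>cut N\<^esub> ?h w q)"
      using v w by (auto simp: N.smult_r_distr)
    then show "counit_inv N (v \<oplus>\<^bsub>N\<^esub> w) = counit_inv N v \<oplus>\<^bsub>F (cut N)\<^esub> counit_inv N w"
      using v w by (simp add: counit_inv_def)
  next
    fix t v assume t: "t \<in> carrier E" and v: "v \<in> carrier N"
    have "(\<lambda>q\<in>carrier Q. ?h v (q \<otimes>\<^bsub>E\<^esub> t)) = ?h (t \<odot>\<^bsub>N\<^esub> v)"
      using t v Q_mult by (auto simp: N.smult_assoc1)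
    then show "counit_inv N (t \<odot>\<^bsub>N\<^esub> v) = t \<odot>\<^bsub>F (cut N)\<^esub> counit_inv N v"
      using t v by (simp add: counit_inv_def)
  qed (simp_all add: counit_inv_def)
  have sum_smult: "q \<odot>\<^bsub>N\<^esub> (\<Oplus>\<^bsub>N\<^esub>i\<in>{..<n}. g i) = (\<Oplus>\<^bsub>N\<^esub>i\<in>{..<n}. q \<odot>\<^bsub>N\<^esub> g i)"
    if "q \<in> carrier E" "g \<in> {..<n} \<rightarrow> carrier N" for q and g :: "nat \<Rightarrow> 'u"
    using abelian_group_hom.hom_finsum[OF N.smult_hom] that by blast
  \<comment> \<open>An element of \<open>N\<close> can be reconstructed from its image, by the formula for the counit.\<close>
  have recover: "v = (\<Oplus>\<^bsub>N\<^esub>i\<in>{..<n}. x i \<odot>\<^bsub>N\<^esub> (\<epsilon> \<otimes>\<^bsub>E\<^esub> y i \<odot>\<^bsub>N\<^esub> v))" if v: "v \<in> carrier N" for v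
  proof -
    have "v = (\<Oplus>\<^bsub>E\<^esub>i\<in>{..<n}. x i \<otimes>\<^bsub>E\<^esub> (\<epsilon> \<otimes>\<^bsub>E\<^esub> y i)) \<odot>\<^bsub>N\<^esub> v"
      using v by (simp add: full' N.smult_one)
    also have "\<dots> = (\<Oplus>\<^bsub>N\<^esub>i\<in>{..<n}. (x i \<otimes>\<^bsub>E\<^esub> (\<epsilon> \<otimes>\<^bsub>E\<^esub> y i)) \<odot>\<^bsub>N\<^esub> v)"
      by (rule abelian_group_hom.hom_finsum[OF N.action_hom[OF v]]) auto
    also have "\<dots> = (\<Oplus>\<^bsub>N\<^esub>i\<in>{..<n}. x i \<odot>\<^bsub>N\<^esub> (\<epsilon> \<otimes>\<^bsub>E\<^esub> y i \<odot>\<^bsub>N\<^esub> v))"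
      using v by (intro N.M.finsum_cong' refl) (auto simp: N.smult_assoc1)
    finally show ?thesis .
  qed
  have "inj_on (counit_inv N) (carrier N)"
  proof (rule inj_onI)
    fix v w assume v: "v \<in> carrier N" and w: "w \<in> carrier N" and "counit_inv N v = counit_inv N w"
    then have "?h v = ?h w"
      using inj_on_enc[OF C] by (simp add: counit_inv_def inj_on_eq_iff)
    then have "?h v (\<epsilon> \<otimes>\<^bsub>E\<^esub> y i) = ?h w (\<epsilon> \<otimes>\<^bsub>E\<^esub> y i)" for i by simp
    then have eq: "\<epsilon> \<otimes>\<^bsub>E\<^esub> y i \<odot>\<^bsub>N\<^esub> v = \<epsilon> \<otimes>\<^bsub>E\<^esub> y i \<odot>\<^bsub>N\<^esub> w" if "i < n" for i
      using that by (metis (no_types, lifting) E.m_closed Q_simps(1) eps_closed eps_idem_left restrict_apply' y_closed)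
    have "(\<Oplus>\<^bsub>N\<^esub>i\<in>{..<n}. x i \<odot>\<^bsub>N\<^esub> (\<epsilon> \<otimes>\<^bsub>E\<^esub> y i \<odot>\<^bsub>N\<^esub> v)) = (\<Oplus>\<^bsub>N\<^esub>i\<in>{..<n}. x i \<odot>\<^bsub>N\<^esub> (\<epsilon> \<otimes>\<^bsub>E\<^esub> y i \<odot>\<^bsub>N\<^esub> w))"
      using w by (intro N.M.finsum_cong' refl) (auto simp: eq)
    then show "v = w" using recover[OF v] recover[OF w] by simp
  qed
  moreover have "carrier (F (cut N)) \<subseteq> counit_inv N ` carrier N"
  proof
    fix u assume "u \<in> carrier (F (cut N))"
    then obtain f where f: "f \<in> lmod_hom A Q (cut N)" "u = enc f" by auto
    \<comment> \<open>The value of the counit at \<open>f\<close>.\<close>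
    define v where "v = (\<Oplus>\<^bsub>N\<^esub>i\<in>{..<n}. x i \<odot>\<^bsub>N\<^esub> f (\<epsilon> \<otimes>\<^bsub>E\<^esub> y i))"
    have fy: "f (\<epsilon> \<otimes>\<^bsub>E\<^esub> y i) \<in> carrier N" "\<epsilon> \<odot>\<^bsub>N\<^esub> f (\<epsilon> \<otimes>\<^bsub>E\<^esub> y i) = f (\<epsilon> \<otimes>\<^bsub>E\<^esub> y i)" if "i < n" for i
      using lmod_homD(2)[OF f(1), of "\<epsilon> \<otimes>\<^bsub>E\<^esub> y i"] that by auto
    have v: "v \<in> carrier N" unfolding v_def using fy by (intro N.M.finsum_closed) auto
    have incl: "abelian_group_hom (cut N) N (\<lambda>v. v)"
      by (intro additive_imp_abelian_group_hom C.M.abelian_group_axioms N.M.abelian_group_axioms) auto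
    have "f q = q \<odot>\<^bsub>N\<^esub> v" if q: "q \<in> carrier Q" for q
    proof -
      have q': "q \<in> carrier E" "\<epsilon> \<otimes>\<^bsub>E\<^esub> q = q" using q by auto
      have "f q = (\<Oplus>\<^bsub>cut N\<^esub>i\<in>{..<n}. \<kappa> (q \<otimes>\<^bsub>E\<^esub> x i) \<odot>\<^bsub>cut N\<^esub> f (\<epsilon> \<otimes>\<^bsub>E\<^esub> y i))"
        by (rule hom_Q_expansion[OF C f(1) q])
      also have "\<dots> = (\<Oplus>\<^bsub>N\<^esub>i\<in>{..<n}. \<kappa> (q \<otimes>\<^bsub>E\<^esub> x i) \<odot>\<^bsub>cut N\<^esub> f (\<epsilon> \<otimes>\<^bsub>E\<^esub> y i))"
        by (rule abelian_group_hom.hom_finsum[OF incl])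
          (use q' in \<open>auto intro!: C.smult_closed lmod_homD(2)[OF f(1)] simp del: cut_simps\<close>)
      also have "\<dots> = (\<Oplus>\<^bsub>N\<^esub>i\<in>{..<n}. q \<odot>\<^bsub>N\<^esub> (x i \<odot>\<^bsub>N\<^esub> f (\<epsilon> \<otimes>\<^bsub>E\<^esub> y i)))"
      proof (intro N.M.finsum_cong' refl)
        fix i assume "i \<in> {..<n}"
        then have i: "i < n" by simp
        have "\<kappa> (q \<otimes>\<^bsub>E\<^esub> x i) \<odot>\<^bsub>cut N\<^esub> f (\<epsilon> \<otimes>\<^bsub>E\<^esub> y i) = \<epsilon> \<otimes>\<^bsub>E\<^esub> (q \<otimes>\<^bsub>E\<^esub> x i) \<otimes>\<^bsub>E\<^esub> \<epsilon> \<odot>\<^bsub>N\<^esub> f (\<epsilon> \<otimes>\<^bsub>E\<^esub> y i)"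
          using i q' by (simp add: iota_kappa)
        also have "\<dots> = q \<otimes>\<^bsub>E\<^esub> x i \<odot>\<^bsub>N\<^esub> (\<epsilon> \<odot>\<^bsub>N\<^esub> f (\<epsilon> \<otimes>\<^bsub>E\<^esub> y i))"
          using i q' fy[OF i] by (simp add: N.smult_assoc1 flip: E.m_assoc)
        finally show "\<kappa> (q \<otimes>\<^bsub>E\<^esub> x i) \<odot>\<^bsub>cut N\<^esub> f (\<epsilon> \<otimes>\<^bsub>E\<^esub> y i) = q \<odot>\<^bsub>N\<^esub> (x i \<odot>\<^bsub>N\<^esub> f (\<epsilon> \<otimes>\<^bsub>E\<^esub> y i))"
          using i q' fy[OF i] by (simp add: N.smult_assoc1)
      qed (use q' fy in auto)
      also have "\<dots> = q \<odot>\<^bsub>N\<^esub> v"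
        unfolding v_def using q' fy by (intro sum_smult[symmetric]) auto
      finally show ?thesis .
    qed
    then have "f = ?h v"
      using lmod_homD(1)[OF f(1)] by (intro extensionalityI[of _ "carrier Q"]) auto
    then show "u \<in> counit_inv N ` carrier N"
      using f(2) v by (auto simp: counit_inv_def)
  qed
  ultimately show ?thesis
    using hom lmod_homD(2)[OF hom] by (auto simp: lmod_iso_def bij_betw_def)
qed

lemma counit_inv_natural:
  "lmod_nat_iso E E (\<lambda>N. N) (\<lambda>N N' f. f) (\<lambda>N. F (cut N))
     (\<lambda>N N' f. F_map (cut N) (cut N') (restrict f (carrier (cut N)))) counit_inv"
proof -
  have "compose (carrier N) (counit_inv N') f
      = compose (carrier N) (F_map (cut N) (cut N') (restrict f (carrier (cut N)))) (counit_inv N)"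
    if N: "left_module E N" and N': "left_module E N'" and f: "f \<in> lmod_hom E N N'" for N N' f
  proof (rule extensionalityI[of _ "carrier N"])
    fix v assume v: "v \<in> carrier N"
    let ?h = "\<lambda>q\<in>carrier Q. q \<odot>\<^bsub>N\<^esub> v"
    have "F_map (cut N) (cut N') (restrict f (carrier (cut N))) (counit_inv N v)
        = enc (compose (carrier Q) (restrict f (carrier (cut N))) ?h)"
      using v N by (simp add: counit_inv_def F_map_enc left_module_cut action_hom_cut)
    also have "compose (carrier Q) (restrict f (carrier (cut N))) ?h = (\<lambda>q\<in>carrier Q. q \<odot>\<^bsub>N'\<^esub> f v)"
      using v lmod_homD(4)[OF f] lmod_homD(2)[OF action_hom_cut[OF N v]]
      by (auto simp: compose_def)
    also have "enc (\<lambda>q\<in>carrier Q. q \<odot>\<^bsub>N'\<^esub> f v) = compose (carrier N) (counit_inv N') f v"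
      using v lmod_homD(2)[OF f] by (simp add: counit_inv_def compose_eq)
    also have "F_map (cut N) (cut N') (restrict f (carrier (cut N))) (counit_inv N v)
        = compose (carrier N) (F_map (cut N) (cut N') (restrict f (carrier (cut N)))) (counit_inv N) v"
      using v by (simp add: compose_eq)
    finally show "compose (carrier N) (counit_inv N') f v
      = compose (carrier N) (F_map (cut N) (cut N') (restrict f (carrier (cut N)))) (counit_inv N) v" ..
  qed auto
  then show ?thesis
    unfolding lmod_nat_iso_def by (auto simp: counit_inv_iso)
qed

lemma morita_equivalent_code: "morita_equivalent TYPE('u) A E"
  unfolding morita_equivalent_def
  by (intro conjI exI A.ring_axioms E.ring_axioms)
    (rule lmod_functor_F lmod_functor_cut unit_natural
      lmod_nat_iso_inverse[OF lmod_functor_identity counit_inv_natural])+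

end

theorem morita_equivalent_corner:
  assumes "infinite (UNIV :: 'u set)"
  shows "morita_equivalent TYPE('u) A E"
proof -
  obtain code :: "(nat \<Rightarrow> 'u) \<Rightarrow> 'u" where "\<And>v w i. code v = code w \<Longrightarrow> i < n \<Longrightarrow> v i = w i"
    using ex_tuple_code[OF assms] by meson
  then show ?thesis by (rule morita_equivalent_code)
qed

end

section \<open>Bimodules and their endomorphism rings\<close>

locale bimod = left_module R M
  for R :: "('a, 'x) ring_scheme" and M :: "('a, 'b, 'y) bimodule_scheme" +
  assumes rsmult_closed: "\<lbrakk>a \<in> carrier R; x \<in> carrier M\<rbrakk> \<Longrightarrow> x \<boxdot>\<^bsub>M\<^esub> a \<in> carrier M"
    and rsmult_l_distr: "\<lbrakk>a \<in> carrier R; x \<in> carrier M; y \<in> carrier M\<rbrakk> \<Longrightarrow>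
      (x \<oplus>\<^bsub>M\<^esub> y) \<boxdot>\<^bsub>M\<^esub> a = x \<boxdot>\<^bsub>M\<^esub> a \<oplus>\<^bsub>M\<^esub> y \<boxdot>\<^bsub>M\<^esub> a"
    and rsmult_r_distr: "\<lbrakk>a \<in> carrier R; b \<in> carrier R; x \<in> carrier M\<rbrakk> \<Longrightarrow>
      x \<boxdot>\<^bsub>M\<^esub> (a \<oplus>\<^bsub>R\<^esub> b) = x \<boxdot>\<^bsub>M\<^esub> a \<oplus>\<^bsub>M\<^esub> x \<boxdot>\<^bsub>M\<^esub> b"
    and rsmult_assoc: "\<lbrakk>a \<in> carrier R; b \<in> carrier R; x \<in> carrier M\<rbrakk> \<Longrightarrow>
      x \<boxdot>\<^bsub>M\<^esub> (a \<otimes>\<^bsub>R\<^esub> b) = (x \<boxdot>\<^bsub>M\<^esub> a) \<boxdot>\<^bsub>M\<^esub> b"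
    and rsmult_one: "x \<in> carrier M \<Longrightarrow> x \<boxdot>\<^bsub>M\<^esub> \<one>\<^bsub>R\<^esub> = x"
    and smult_rsmult: "\<lbrakk>a \<in> carrier R; b \<in> carrier R; x \<in> carrier M\<rbrakk> \<Longrightarrow>
      (a \<odot>\<^bsub>M\<^esub> x) \<boxdot>\<^bsub>M\<^esub> b = a \<odot>\<^bsub>M\<^esub> (x \<boxdot>\<^bsub>M\<^esub> b)"
begin

lemma rsmult_hom: "a \<in> carrier R \<Longrightarrow> abelian_group_hom M M (\<lambda>v. v \<boxdot>\<^bsub>M\<^esub> a)"
  by (intro additive_imp_abelian_group_hom M.abelian_group_axioms)
    (auto simp: rsmult_closed rsmult_l_distr)

lemma rsmult_zero: "a \<in> carrier R \<Longrightarrow> \<zero>\<^bsub>M\<^esub> \<boxdot>\<^bsub>M\<^esub> a = \<zero>\<^bsub>M\<^esub>"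
  by (rule abelian_group_hom.hom_zero[OF rsmult_hom])

lemma rsmult_minus:
  "\<lbrakk>a \<in> carrier R; v \<in> carrier M\<rbrakk> \<Longrightarrow> (\<ominus>\<^bsub>M\<^esub> v) \<boxdot>\<^bsub>M\<^esub> a = \<ominus>\<^bsub>M\<^esub> (v \<boxdot>\<^bsub>M\<^esub> a)"
  by (rule abelian_group_hom.hom_a_inv[OF rsmult_hom])

lemmas closed = M.a_closed M.zero_closed M.a_inv_closed smult_closed rsmult_closed

end

lemma bimod_homI:
  assumes "f \<in> extensional (carrier M)"
    and "\<And>x. x \<in> carrier M \<Longrightarrow> f x \<in> carrier N"
    and "\<And>x y. \<lbrakk>x \<in> carrier M; y \<in> carrier M\<rbrakk> \<Longrightarrow> f (x \<oplus>\<^bsub>M\<^esub> y) = f x \<oplus>\<^bsub>N\<^esub> f y"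
    and "\<And>r x. \<lbrakk>r \<in> carrier R; x \<in> carrier M\<rbrakk> \<Longrightarrow> f (r \<odot>\<^bsub>M\<^esub> x) = r \<odot>\<^bsub>N\<^esub> f x"
    and "\<And>r x. \<lbrakk>r \<in> carrier R; x \<in> carrier M\<rbrakk> \<Longrightarrow> f (x \<boxdot>\<^bsub>M\<^esub> r) = f x \<boxdot>\<^bsub>N\<^esub> r"
  shows "f \<in> bimod_hom R M N"
  using assms by (auto simp: bimod_hom_def PiE_iff)

lemma bimod_homD:
  assumes "f \<in> bimod_hom R M N"
  shows "f \<in> extensional (carrier M)"
    and "x \<in> carrier M \<Longrightarrow> f x \<in> carrier N"
    and "\<lbrakk>x \<in> carrier M; y \<in> carrier M\<rbrakk> \<Longrightarrow> f (x \<oplus>\<^bsub>M\<^esub> y) = f x \<oplus>\<^bsub>N\<^esub> f y"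
    and "\<lbrakk>r \<in> carrier R; x \<in> carrier M\<rbrakk> \<Longrightarrow> f (r \<odot>\<^bsub>M\<^esub> x) = r \<odot>\<^bsub>N\<^esub> f x"
    and "\<lbrakk>r \<in> carrier R; x \<in> carrier M\<rbrakk> \<Longrightarrow> f (x \<boxdot>\<^bsub>M\<^esub> r) = f x \<boxdot>\<^bsub>N\<^esub> r"
  using assms by (auto simp: bimod_hom_def PiE_iff)

lemma bimod_hom_eqI:
  assumes "f \<in> bimod_hom R M N" "g \<in> bimod_hom R M N" "\<And>x. x \<in> carrier M \<Longrightarrow> f x = g x"
  shows "f = g"
  using assms bimod_homD(1) by (intro extensionalityI[of _ "carrier M"])

lemma bimod_hom_imp_abelian_group_hom:
  assumes "bimod R M" "bimod R N" "f \<in> bimod_hom R M N"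
  shows "abelian_group_hom M N f"
  using assms bimod_homD[OF assms(3)]
  by (intro additive_imp_abelian_group_hom) (auto simp: bimod_def left_module_def)

lemma bimod_hom_compose:
  assumes "bimod R M" "f \<in> bimod_hom R M N" "g \<in> bimod_hom R N P"
  shows "compose (carrier M) g f \<in> bimod_hom R M P"
proof -
  interpret bimod R M by fact
  show ?thesis
    using bimod_homD[OF assms(2)] bimod_homD[OF assms(3)]
    by (intro bimod_homI) (auto simp: compose_eq closed)
qed

lemma bimod_regular:
  assumes "ring R"
  shows "bimod R (regular_bimodule R)"
proof -
  interpret ring R by fact
  have "abelian_group (regular_bimodule R)"
    using r_neg by (intro abelian_groupI)
      (auto simp: regular_bimodule_def a_ac intro!: bexI[of _ "\<ominus>\<^bsub>R\<^esub> _"])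
  then show ?thesis
    by (intro bimod.intro bimod_axioms.intro left_module.intro left_module_axioms.intro ring_axioms)
      (auto simp: regular_bimodule_def l_distr r_distr m_assoc)
qed

lemma regular_bimodule_simps [simp]:
  "carrier (regular_bimodule R) = carrier R" "\<zero>\<^bsub>regular_bimodule R\<^esub> = \<zero>\<^bsub>R\<^esub>"
  "x \<oplus>\<^bsub>regular_bimodule R\<^esub> y = x \<oplus>\<^bsub>R\<^esub> y"
  "x \<odot>\<^bsub>regular_bimodule R\<^esub> y = x \<otimes>\<^bsub>R\<^esub> y" "x \<boxdot>\<^bsub>regular_bimodule R\<^esub> y = x \<otimes>\<^bsub>R\<^esub> y"
  by (simp_all add: regular_bimodule_def)

lemma bimod_power_simps [simp]:
  "carrier (bimod_power q M) = {..<q} \<rightarrow>\<^sub>E carrier M"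
  "\<zero>\<^bsub>bimod_power q M\<^esub> = (\<lambda>i\<in>{..<q}. \<zero>\<^bsub>M\<^esub>)"
  "v \<oplus>\<^bsub>bimod_power q M\<^esub> w = (\<lambda>i\<in>{..<q}. v i \<oplus>\<^bsub>M\<^esub> w i)"
  "r \<odot>\<^bsub>bimod_power q M\<^esub> v = (\<lambda>i\<in>{..<q}. r \<odot>\<^bsub>M\<^esub> v i)"
  "v \<boxdot>\<^bsub>bimod_power q M\<^esub> r = (\<lambda>i\<in>{..<q}. v i \<boxdot>\<^bsub>M\<^esub> r)"
  by (simp_all add: bimod_power_def)

lemma bimod_bimod_power:
  assumes "bimod R M"
  shows "bimod R (bimod_power q M)"
proof -
  interpret bimod R M by fact
  have ext: "v = w" if "v \<in> {..<q} \<rightarrow>\<^sub>E carrier M" "w \<in> {..<q} \<rightarrow>\<^sub>E carrier M" "\<And>i. i < q \<Longrightarrow> v i = w i" for v w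
    using that by (intro PiE_ext[of v "{..<q}" "\<lambda>_. carrier M"]) auto
  have "\<exists>w\<in>{..<q} \<rightarrow>\<^sub>E carrier M. w \<oplus>\<^bsub>bimod_power q M\<^esub> v = \<zero>\<^bsub>bimod_power q M\<^esub>"
    if "v \<in> {..<q} \<rightarrow>\<^sub>E carrier M" for v
    using that by (intro bexI[of _ "\<lambda>i\<in>{..<q}. \<ominus>\<^bsub>M\<^esub> v i"]) (auto simp: M.l_neg PiE_iff)
  then have "abelian_group (bimod_power q M)"
    by (intro abelian_groupI; (intro ext)?) (auto simp: PiE_iff M.a_ac)
  then show ?thesis
    by (intro bimod.intro bimod_axioms.intro left_module.intro left_module_axioms.intro A.ring_axioms;
        (intro ext)?)
      (auto simp: PiE_iff closed smult_l_distr smult_r_distr smult_assoc1 smult_one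
        rsmult_l_distr rsmult_r_distr rsmult_assoc rsmult_one smult_rsmult)
qed

lemma bimod_End_simps [simp]:
  "carrier (bimod_End R M) = bimod_hom R M M"
  "f \<otimes>\<^bsub>bimod_End R M\<^esub> g = compose (carrier M) f g"
  "\<one>\<^bsub>bimod_End R M\<^esub> = (\<lambda>x\<in>carrier M. x)"
  "\<zero>\<^bsub>bimod_End R M\<^esub> = (\<lambda>x\<in>carrier M. \<zero>\<^bsub>M\<^esub>)"
  "f \<oplus>\<^bsub>bimod_End R M\<^esub> g = (\<lambda>x\<in>carrier M. f x \<oplus>\<^bsub>M\<^esub> g x)"
  by (simp_all add: bimod_End_def)

context bimod
begin

lemma ring_bimod_End: "ring (bimod_End R M)"
proof -
  let ?H = "bimod_hom R M M" and ?E = "bimod_End R M"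
  note D = bimod_homD(2-5)[where M = M and N = M and R = R]
  note eqI = bimod_hom_eqI[where M = M and N = M and R = R]
  have add: "f \<oplus>\<^bsub>?E\<^esub> g \<in> ?H" if "f \<in> ?H" "g \<in> ?H" for f g
    using D[OF that(1)] D[OF that(2)]
    by (intro bimod_homI) (auto simp: closed smult_r_distr rsmult_l_distr M.a_ac)
  have zero: "\<zero>\<^bsub>?E\<^esub> \<in> ?H" by (intro bimod_homI) (auto simp: closed smult_zero rsmult_zero)
  have mult: "f \<otimes>\<^bsub>?E\<^esub> g \<in> ?H" if "f \<in> ?H" "g \<in> ?H" for f g
    using bimod_hom_compose[OF bimod_axioms that(2,1)] by simp
  have one: "\<one>\<^bsub>?E\<^esub> \<in> ?H" by (intro bimod_homI) (auto simp: closed)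
  show ?thesis
  proof (intro ringI abelian_groupI monoidI; unfold bimod_End_simps(1))
    fix f assume f: "f \<in> ?H"
    have "(\<lambda>x\<in>carrier M. \<ominus>\<^bsub>M\<^esub> f x) \<in> ?H"
      using D[OF f] by (intro bimod_homI) (auto simp: closed smult_minus rsmult_minus M.minus_add M.a_comm)
    moreover have "(\<lambda>x\<in>carrier M. \<ominus>\<^bsub>M\<^esub> f x) \<oplus>\<^bsub>?E\<^esub> f = \<zero>\<^bsub>?E\<^esub>" using D[OF f] by (auto simp: M.l_neg)
    ultimately show "\<exists>g\<in>?H. g \<oplus>\<^bsub>?E\<^esub> f = \<zero>\<^bsub>?E\<^esub>" by (rule bexI[where x = "\<lambda>x\<in>carrier M. \<ominus>\<^bsub>M\<^esub> f x", rotated])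
    show "\<zero>\<^bsub>?E\<^esub> \<oplus>\<^bsub>?E\<^esub> f = f" using D[OF f] by (intro eqI add zero f) auto
    show "\<one>\<^bsub>?E\<^esub> \<otimes>\<^bsub>?E\<^esub> f = f" using D[OF f] by (intro eqI mult one f) (auto simp: compose_eq)
    show "f \<otimes>\<^bsub>?E\<^esub> \<one>\<^bsub>?E\<^esub> = f" using D[OF f] by (intro eqI mult one f) (auto simp: compose_eq)
  next
    fix f g assume fg: "f \<in> ?H" "g \<in> ?H"
    then show "f \<oplus>\<^bsub>?E\<^esub> g = g \<oplus>\<^bsub>?E\<^esub> f" using D by (auto simp: M.a_comm)
  next
    fix f g h assume fgh: "f \<in> ?H" "g \<in> ?H" "h \<in> ?H"
    note D' = D[OF fgh(1)] D[OF fgh(2)] D[OF fgh(3)]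
    show "f \<oplus>\<^bsub>?E\<^esub> g \<oplus>\<^bsub>?E\<^esub> h = f \<oplus>\<^bsub>?E\<^esub> (g \<oplus>\<^bsub>?E\<^esub> h)" using D' by (auto simp: M.a_assoc)
    show "f \<otimes>\<^bsub>?E\<^esub> g \<otimes>\<^bsub>?E\<^esub> h = f \<otimes>\<^bsub>?E\<^esub> (g \<otimes>\<^bsub>?E\<^esub> h)" using D' by (auto simp: compose_def)
    show "(f \<oplus>\<^bsub>?E\<^esub> g) \<otimes>\<^bsub>?E\<^esub> h = f \<otimes>\<^bsub>?E\<^esub> h \<oplus>\<^bsub>?E\<^esub> g \<otimes>\<^bsub>?E\<^esub> h" using D' by (auto simp: compose_def)
    show "h \<otimes>\<^bsub>?E\<^esub> (f \<oplus>\<^bsub>?E\<^esub> g) = h \<otimes>\<^bsub>?E\<^esub> f \<oplus>\<^bsub>?E\<^esub> h \<otimes>\<^bsub>?E\<^esub> g" using D' by (auto simp: compose_def)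
  qed (use add zero mult one in blast)+
qed

lemma End_finsum_apply:
  assumes "finite I" "g \<in> I \<rightarrow> bimod_hom R M M" "m \<in> carrier M"
  shows "(\<Oplus>\<^bsub>bimod_End R M\<^esub>i\<in>I. g i) m = (\<Oplus>\<^bsub>M\<^esub>i\<in>I. g i m)"
proof -
  have "abelian_group_hom (bimod_End R M) M (\<lambda>f. f m)"
    using ring_bimod_End assms(3)
    by (intro additive_imp_abelian_group_hom M.abelian_group_axioms) (auto simp: ring_def bimod_homD(2))
  from abelian_group_hom.hom_finsum[OF this assms(1)] assms(2) show ?thesis by simp
qed

end

section \<open>Direct summands of powers\<close>

text \<open>
  From an isomorphism \<open>\<phi>\<close> of \<open>M\<close> with a summand \<open>K\<close> of \<open>P = K + L\<close>, the retraction is the projection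
  along \<open>L\<close> followed by the inverse of \<open>\<phi>\<close>. Conversely, a retraction \<open>\<psi>\<close> of \<open>\<phi>\<close> splits \<open>P\<close> into the image
  of \<open>\<phi>\<close> and the kernel of \<open>\<psi>\<close>.
\<close>

lemma summand_iff_retract:
  assumes "bimod R M" "bimod R P"
  shows "(\<exists>K. bimod_direct_summand R K P \<and> bimod_isomorphic R M (P\<lparr>carrier := K\<rparr>)) \<longleftrightarrow>
    (\<exists>\<phi>\<in>bimod_hom R M P. \<exists>\<psi>\<in>bimod_hom R P M. \<forall>m\<in>carrier M. \<psi> (\<phi> m) = m)"
proof -
  interpret M: bimod R M by fact
  interpret P: bimod R P by fact
  show ?thesis
  proof (intro iffI; (elim exE conjE bexE)?)
    fix K assume K: "bimod_direct_summand R K P" and "bimod_isomorphic R M (P\<lparr>carrier := K\<rparr>)"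
    then obtain \<phi> where \<phi>: "\<phi> \<in> bimod_hom R M (P\<lparr>carrier := K\<rparr>)" "bij_betw \<phi> (carrier M) K"
      by (auto simp: bimod_isomorphic_def)
    obtain L where L: "sub_bimodule R L P" "K \<inter> L = {\<zero>\<^bsub>P\<^esub>}" "K <+>\<^bsub>P\<^esub> L = carrier P"
      using K by (auto simp: bimod_direct_summand_def)
    have KL: "subgroup K (add_monoid P)" "subgroup L (add_monoid P)"
      using K L by (auto simp: bimod_direct_summand_def sub_bimodule_def)
    note K_closed = subgroup.m_closed[OF KL(1), simplified] subgroup.m_inv_closed[OF KL(1), folded a_inv_def]
    note L_closed = subgroup.m_closed[OF KL(2), simplified] subgroup.m_inv_closed[OF KL(2), folded a_inv_def]
    have sub: "K \<subseteq> carrier P" "L \<subseteq> carrier P" using KL subgroup.subset by fastforce+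
    have \<phi>K: "\<phi> m \<in> K" if "m \<in> carrier M" for m using bimod_homD(2)[OF \<phi>(1)] that by simp
    have \<phi>P: "\<phi> \<in> bimod_hom R M P"
      using bimod_homD[OF \<phi>(1)] \<phi>K sub by (intro bimod_homI) auto
    define \<psi> where "\<psi> = (\<lambda>w\<in>carrier P. THE m. m \<in> carrier M \<and> (\<exists>l\<in>L. w = \<phi> m \<oplus>\<^bsub>P\<^esub> l))"
    \<comment> \<open>The decomposition is unique because \<open>\<phi> m - \<phi> m' = l' - l\<close> lies in \<open>K \<inter> L = 0\<close>.\<close>
    have uniq: "m = m'" if m: "m \<in> carrier M" "m' \<in> carrier M" and l: "l \<in> L" "l' \<in> L"
      and eq: "\<phi> m \<oplus>\<^bsub>P\<^esub> l = \<phi> m' \<oplus>\<^bsub>P\<^esub> l'" for m m' l l'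
    proof -
      have c: "\<phi> m \<in> carrier P" "\<phi> m' \<in> carrier P" "l \<in> carrier P" "l' \<in> carrier P"
        using m l sub \<phi>K by auto
      have "\<ominus>\<^bsub>P\<^esub> \<phi> m' \<oplus>\<^bsub>P\<^esub> \<phi> m = \<ominus>\<^bsub>P\<^esub> \<phi> m' \<oplus>\<^bsub>P\<^esub> (\<phi> m \<oplus>\<^bsub>P\<^esub> l) \<oplus>\<^bsub>P\<^esub> \<ominus>\<^bsub>P\<^esub> l"
        using c by (simp add: P.M.a_assoc P.M.r_neg)
      also have "\<dots> = l' \<oplus>\<^bsub>P\<^esub> \<ominus>\<^bsub>P\<^esub> l"
        unfolding eq using c by (simp add: P.M.l_neg flip: P.M.a_assoc)
      finally have "\<ominus>\<^bsub>P\<^esub> \<phi> m' \<oplus>\<^bsub>P\<^esub> \<phi> m \<in> K \<inter> L"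
        using \<phi>K m l K_closed L_closed by (metis IntI)
      then have "\<phi> m = \<phi> m'"
        using L(2) c by (metis P.M.a_comm P.M.minus_equality P.M.minus_minus singletonD P.M.a_inv_closed)
      then show ?thesis using \<phi>(2) m unfolding bij_betw_def by (blast dest: inj_onD)
    qed
    have \<psi>_eq: "\<psi> (\<phi> m \<oplus>\<^bsub>P\<^esub> l) = m" if "m \<in> carrier M" "l \<in> L" for m l
    proof -
      have "\<phi> m \<oplus>\<^bsub>P\<^esub> l \<in> carrier P" using that sub \<phi>K by (meson P.M.a_closed subsetD)
      then show ?thesis using that uniq unfolding \<psi>_def by (auto intro!: the_equality)
    qed
    have split: "\<exists>m\<in>carrier M. \<exists>l\<in>L. w = \<phi> m \<oplus>\<^bsub>P\<^esub> l" if "w \<in> carrier P" for w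
      using that \<phi>(2) unfolding L(3)[symmetric] set_add_def' bij_betw_def by auto
    have in_P: "\<phi> m \<in> carrier P" "l \<in> L \<Longrightarrow> l \<in> carrier P" if "m \<in> carrier M" for m l
      using that sub \<phi>K by auto
    have "\<psi> \<in> bimod_hom R P M"
    proof (rule bimod_homI)
      fix w assume "w \<in> carrier P"
      then obtain m l where m: "m \<in> carrier M" "l \<in> L" "w = \<phi> m \<oplus>\<^bsub>P\<^esub> l" using split by blast
      then show "\<psi> w \<in> carrier M" using \<psi>_eq by simp
      fix r assume r: "r \<in> carrier R"
      have rl: "r \<odot>\<^bsub>P\<^esub> l \<in> L" "l \<boxdot>\<^bsub>P\<^esub> r \<in> L" using L(1) m r by (auto simp: sub_bimodule_def)
      have "\<psi> (r \<odot>\<^bsub>P\<^esub> w) = \<psi> (\<phi> (r \<odot>\<^bsub>M\<^esub> m) \<oplus>\<^bsub>P\<^esub> r \<odot>\<^bsub>P\<^esub> l)"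
        using m r in_P by (simp add: P.smult_r_distr bimod_homD(4)[OF \<phi>P])
      then show "\<psi> (r \<odot>\<^bsub>P\<^esub> w) = r \<odot>\<^bsub>M\<^esub> \<psi> w" using m r rl \<psi>_eq M.closed by simp
      have "\<psi> (w \<boxdot>\<^bsub>P\<^esub> r) = \<psi> (\<phi> (m \<boxdot>\<^bsub>M\<^esub> r) \<oplus>\<^bsub>P\<^esub> l \<boxdot>\<^bsub>P\<^esub> r)"
        using m r in_P by (simp add: P.rsmult_l_distr bimod_homD(5)[OF \<phi>P])
      then show "\<psi> (w \<boxdot>\<^bsub>P\<^esub> r) = \<psi> w \<boxdot>\<^bsub>M\<^esub> r" using m r rl \<psi>_eq M.closed by simp
    next
      fix w w' assume "w \<in> carrier P" "w' \<in> carrier P"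
      then obtain m l m' l' where m: "m \<in> carrier M" "l \<in> L" "w = \<phi> m \<oplus>\<^bsub>P\<^esub> l"
        and m': "m' \<in> carrier M" "l' \<in> L" "w' = \<phi> m' \<oplus>\<^bsub>P\<^esub> l'" using split by meson
      have "w \<oplus>\<^bsub>P\<^esub> w' = \<phi> (m \<oplus>\<^bsub>M\<^esub> m') \<oplus>\<^bsub>P\<^esub> (l \<oplus>\<^bsub>P\<^esub> l')"
        using m m' in_P by (simp add: bimod_homD(3)[OF \<phi>P] P.M.a_ac)
      then show "\<psi> (w \<oplus>\<^bsub>P\<^esub> w') = \<psi> w \<oplus>\<^bsub>M\<^esub> \<psi> w'" using m m' \<psi>_eq L_closed by simp
    qed (simp add: \<psi>_def)
    moreover have "\<psi> (\<phi> m) = m" if "m \<in> carrier M" for m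
      using \<psi>_eq[OF that subgroup.one_closed[OF KL(2)]] that in_P by simp
    ultimately show "\<exists>\<phi>\<in>bimod_hom R M P. \<exists>\<psi>\<in>bimod_hom R P M. \<forall>m\<in>carrier M. \<psi> (\<phi> m) = m"
      using \<phi>P by blast
  next
    fix \<phi> \<psi> assume \<phi>: "\<phi> \<in> bimod_hom R M P" and \<psi>: "\<psi> \<in> bimod_hom R P M"
      and inv: "\<forall>m\<in>carrier M. \<psi> (\<phi> m) = m"
    note \<phi>D = bimod_homD[OF \<phi>] and \<psi>D = bimod_homD[OF \<psi>]
    interpret f: abelian_group_hom M P \<phi>
      using bimod_hom_imp_abelian_group_hom[OF M.bimod_axioms P.bimod_axioms \<phi>] .
    interpret g: abelian_group_hom P M \<psi>
      using bimod_hom_imp_abelian_group_hom[OF P.bimod_axioms M.bimod_axioms \<psi>] .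
    let ?K = "\<phi> ` carrier M" and ?L = "{w \<in> carrier P. \<psi> w = \<zero>\<^bsub>M\<^esub>}"
    have "sub_bimodule R ?K P"
      unfolding sub_bimodule_def
    proof (intro conjI ballI)
      show "subgroup ?K (add_monoid P)"
        using group_hom.img_is_subgroup[OF f.a_group_hom] by simp
      show "r \<odot>\<^bsub>P\<^esub> w \<in> ?K" "w \<boxdot>\<^bsub>P\<^esub> r \<in> ?K" if "r \<in> carrier R" "w \<in> ?K" for r w
        using that \<phi>D(4,5)[symmetric] M.closed by auto
    qed
    moreover have "sub_bimodule R ?L P"
      unfolding sub_bimodule_def
    proof (intro conjI ballI)
      show "subgroup ?L (add_monoid P)"
        using group_hom.subgroup_kernel[OF g.a_group_hom] by (simp add: kernel_def)
      show "r \<odot>\<^bsub>P\<^esub> w \<in> ?L" "w \<boxdot>\<^bsub>P\<^esub> r \<in> ?L" if "r \<in> carrier R" "w \<in> ?L" for r w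
        using that \<psi>D(4,5) P.closed by (auto simp: M.smult_zero M.rsmult_zero)
    qed
    moreover have "?K \<inter> ?L = {\<zero>\<^bsub>P\<^esub>}"
      using inv f.hom_zero g.hom_zero by (force simp del: f.hom_zero g.hom_zero)
    moreover have "?K <+>\<^bsub>P\<^esub> ?L = carrier P"
    proof
      show "?K <+>\<^bsub>P\<^esub> ?L \<subseteq> carrier P" by (auto simp: set_add_def')
      show "carrier P \<subseteq> ?K <+>\<^bsub>P\<^esub> ?L"
      proof
        fix w assume w: "w \<in> carrier P"
        let ?l = "\<ominus>\<^bsub>P\<^esub> \<phi> (\<psi> w) \<oplus>\<^bsub>P\<^esub> w"
        have "?l \<in> ?L" using w inv by (simp add: M.M.l_neg)
        moreover have "\<phi> (\<psi> w) \<oplus>\<^bsub>P\<^esub> ?l = w" using w by (simp add: P.M.r_neg2)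
        ultimately show "w \<in> ?K <+>\<^bsub>P\<^esub> ?L"
          using w unfolding set_add_def' by (blast intro: sym g.hom_closed)
      qed
    qed
    ultimately have "bimod_direct_summand R ?K P"
      unfolding bimod_direct_summand_def by blast
    moreover have "\<phi> \<in> bimod_hom R M (P\<lparr>carrier := ?K\<rparr>)"
      using \<phi>D by (intro bimod_homI) auto
    moreover have "inj_on \<phi> (carrier M)" using inv by (metis inj_onI)
    ultimately show "\<exists>K. bimod_direct_summand R K P \<and> bimod_isomorphic R M (P\<lparr>carrier := K\<rparr>)"
      unfolding bimod_isomorphic_def by (intro exI[of _ ?K]) (auto simp: bij_betw_def)
  qed
qed

text \<open>
  A factorization of the identity of \<open>M\<close> through \<open>N\<^sup>q\<close>, in coordinates. For one-sided modules and \<open>N\<close>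
  the ring itself, the maps \<open>u\<^sub>i\<close> are elements of \<open>M\<close> and this is the dual basis of a finitely generated
  projective module.
\<close>

definition dual_basis ::
  "('a, 'x) ring_scheme \<Rightarrow> ('a, 'b, 'y) bimodule_scheme \<Rightarrow> ('a, 'c, 'z) bimodule_scheme \<Rightarrow>
   nat \<Rightarrow> (nat \<Rightarrow> 'b \<Rightarrow> 'c) \<Rightarrow> (nat \<Rightarrow> 'c \<Rightarrow> 'b) \<Rightarrow> bool"
  where "dual_basis R M N q b u \<longleftrightarrow>
    b \<in> {..<q} \<rightarrow> bimod_hom R M N \<and> u \<in> {..<q} \<rightarrow> bimod_hom R N M \<and>
    (\<forall>m\<in>carrier M. (\<Oplus>\<^bsub>M\<^esub>i\<in>{..<q}. u i (b i m)) = m)"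

text \<open>
  Maps into and out of \<open>N\<^sup>q\<close> are families of \<open>q\<close> maps, the latter because every vector is the sum of
  its coordinates, each placed at its position.
\<close>

lemma retract_power_iff_dual_basis:
  assumes "bimod R M" "bimod R N"
  shows "(\<exists>\<phi>\<in>bimod_hom R M (bimod_power q N). \<exists>\<psi>\<in>bimod_hom R (bimod_power q N) M.
      \<forall>m\<in>carrier M. \<psi> (\<phi> m) = m) \<longleftrightarrow> (\<exists>b u. dual_basis R M N q b u)"
proof -
  interpret M: bimod R M by fact
  interpret N: bimod R N by fact
  let ?P = "bimod_power q N"
  interpret P: bimod R ?P by (rule bimod_bimod_power) fact
  show ?thesis
  proof (intro iffI; (elim exE bexE)?)
    fix \<phi> \<psi> assume \<phi>: "\<phi> \<in> bimod_hom R M ?P" and \<psi>: "\<psi> \<in> bimod_hom R ?P M"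
      and inv: "\<forall>m\<in>carrier M. \<psi> (\<phi> m) = m"
    define inj where "inj i r = (\<lambda>j\<in>{..<q}. if j = i then r else \<zero>\<^bsub>N\<^esub>)" for i r
    have inj: "inj i \<in> carrier N \<rightarrow> carrier ?P" for i by (auto simp: inj_def)
    have "(\<Oplus>\<^bsub>?P\<^esub>i\<in>{..<q}. inj i (w i)) = w" if w: "w \<in> carrier ?P" for w
    proof (rule PiE_ext[of _ "{..<q}" "\<lambda>_. carrier N"])
      have wi: "w i \<in> carrier N" if "i < q" for i using w that by auto
      then have terms: "(\<lambda>i. inj i (w i)) \<in> {..<q} \<rightarrow> carrier ?P"
        using inj by (simp add: Pi_iff del: bimod_power_simps)
      show "(\<Oplus>\<^bsub>?P\<^esub>i\<in>{..<q}. inj i (w i)) \<in> {..<q} \<rightarrow>\<^sub>E carrier N"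
        using P.M.finsum_closed[OF terms] by simp
      fix j assume j: "j \<in> {..<q}"
      have "abelian_group_hom ?P N (\<lambda>w. w j)"
        using j by (intro additive_imp_abelian_group_hom P.M.abelian_group_axioms N.M.abelian_group_axioms)
          auto
      from abelian_group_hom.hom_finsum[OF this _ terms]
      have "(\<Oplus>\<^bsub>?P\<^esub>i\<in>{..<q}. inj i (w i)) j = (\<Oplus>\<^bsub>N\<^esub>i\<in>{..<q}. inj i (w i) j)" by simp
      also have "\<dots> = (\<Oplus>\<^bsub>N\<^esub>i\<in>{..<q}. if j = i then w i else \<zero>\<^bsub>N\<^esub>)"
        using j wi by (intro N.M.finsum_cong' refl) (simp_all add: inj_def Pi_iff)
      also have "\<dots> = w j" using j wi by (intro N.M.finsum_singleton) (simp_all add: Pi_iff)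
      finally show "(\<Oplus>\<^bsub>?P\<^esub>i\<in>{..<q}. inj i (w i)) j = w j" .
    qed (use w in simp)
    note decomp = this
    define b where "b i = (\<lambda>m\<in>carrier M. \<phi> m i)" for i
    define u where "u i = (\<lambda>r\<in>carrier N. \<psi> (inj i r))" for i
    have \<phi>P: "\<phi> m \<in> {..<q} \<rightarrow>\<^sub>E carrier N" if "m \<in> carrier M" for m
      using bimod_homD(2)[OF \<phi> that] by simp
    have "b i \<in> bimod_hom R M N" if "i < q" for i
      using that bimod_homD(3-5)[OF \<phi>] PiE_mem[OF \<phi>P] unfolding b_def
      by (intro bimod_homI) (auto simp: M.closed)
    moreover have "u i \<in> bimod_hom R N M" if "i < q" for i
    proof (rule bimod_homI)
      show "u i \<in> extensional (carrier N)" by (simp add: u_def)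
      fix r assume r: "r \<in> carrier N"
      then show "u i r \<in> carrier M"
        using inj[of i] bimod_homD(2)[OF \<psi>, of "inj i r"] by (auto simp: u_def)
      have ir: "inj i r \<in> carrier ?P" using inj r by auto
      {
        fix s assume s: "s \<in> carrier N"
        have "inj i (r \<oplus>\<^bsub>N\<^esub> s) = inj i r \<oplus>\<^bsub>?P\<^esub> inj i s" by (auto simp: inj_def fun_eq_iff)
        moreover have "inj i s \<in> carrier ?P" using inj s by auto
        ultimately show "u i (r \<oplus>\<^bsub>N\<^esub> s) = u i r \<oplus>\<^bsub>M\<^esub> u i s"
          using r s ir bimod_homD(3)[OF \<psi>] by (simp add: u_def del: bimod_power_simps)
      next
        fix a assume a: "a \<in> carrier R"
        have "inj i (a \<odot>\<^bsub>N\<^esub> r) = a \<odot>\<^bsub>?P\<^esub> inj i r" "inj i (r \<boxdot>\<^bsub>N\<^esub> a) = inj i r \<boxdot>\<^bsub>?P\<^esub> a"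
          using a by (auto simp: inj_def fun_eq_iff N.smult_zero N.rsmult_zero)
        then show "u i (a \<odot>\<^bsub>N\<^esub> r) = a \<odot>\<^bsub>M\<^esub> u i r" "u i (r \<boxdot>\<^bsub>N\<^esub> a) = u i r \<boxdot>\<^bsub>M\<^esub> a"
          using r a ir bimod_homD(4,5)[OF \<psi>] N.closed by (simp_all add: u_def del: bimod_power_simps)
      }
    qed
    moreover have "(\<Oplus>\<^bsub>M\<^esub>i\<in>{..<q}. u i (b i m)) = m" if m: "m \<in> carrier M" for m
    proof -
      interpret \<psi>: abelian_group_hom ?P M \<psi>
        using bimod_hom_imp_abelian_group_hom[OF P.bimod_axioms M.bimod_axioms \<psi>] .
      have mi: "\<phi> m i \<in> carrier N" if "i < q" for i using \<phi>P[OF m] that by auto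
      have "(\<Oplus>\<^bsub>M\<^esub>i\<in>{..<q}. u i (b i m)) = (\<Oplus>\<^bsub>M\<^esub>i\<in>{..<q}. \<psi> (inj i (\<phi> m i)))"
        using m mi inj by (intro M.M.finsum_cong' refl) (auto simp: b_def u_def Pi_iff simp del: bimod_power_simps)
      also have "\<dots> = \<psi> (\<Oplus>\<^bsub>?P\<^esub>i\<in>{..<q}. inj i (\<phi> m i))"
        using inj mi by (intro \<psi>.hom_finsum[symmetric]) (auto simp: Pi_iff simp del: bimod_power_simps)
      finally show ?thesis using decomp[of "\<phi> m"] \<phi>P m inv by simp
    qed
    ultimately show "\<exists>b u. dual_basis R M N q b u"
      unfolding dual_basis_def by blast
  next
    fix b u assume bu: "dual_basis R M N q b u"
    then have b: "b i \<in> bimod_hom R M N" and u: "u i \<in> bimod_hom R N M" if "i < q" for i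
      using that by (auto simp: dual_basis_def)
    note bD = bimod_homD(2-5)[OF b] and uD = bimod_homD(2-5)[OF u]
    define \<phi> where "\<phi> = (\<lambda>m\<in>carrier M. \<lambda>i\<in>{..<q}. b i m)"
    define \<psi> where "\<psi> = (\<lambda>w\<in>carrier ?P. \<Oplus>\<^bsub>M\<^esub>i\<in>{..<q}. u i (w i))"
    have "\<phi> \<in> bimod_hom R M ?P"
      using bD by (intro bimod_homI) (auto simp: \<phi>_def M.closed fun_eq_iff)
    moreover have "\<psi> \<in> bimod_hom R ?P M"
    proof (rule bimod_homI)
      show "\<psi> \<in> extensional (carrier ?P)" by (simp add: \<psi>_def)
      fix v assume v: "v \<in> carrier ?P"
      then have v': "i < q \<Longrightarrow> v i \<in> carrier N" for i by auto
      then show "\<psi> v \<in> carrier M" using v uD by (auto simp: \<psi>_def intro!: M.M.finsum_closed)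
      {
        fix w assume w: "w \<in> carrier ?P"
        then have w': "i < q \<Longrightarrow> w i \<in> carrier N" for i by auto
        have "(\<Oplus>\<^bsub>M\<^esub>i\<in>{..<q}. u i ((v \<oplus>\<^bsub>?P\<^esub> w) i)) = (\<Oplus>\<^bsub>M\<^esub>i\<in>{..<q}. u i (v i) \<oplus>\<^bsub>M\<^esub> u i (w i))"
          using v' w' uD by (intro M.M.finsum_cong' refl) auto
        also have "\<dots> = (\<Oplus>\<^bsub>M\<^esub>i\<in>{..<q}. u i (v i)) \<oplus>\<^bsub>M\<^esub> (\<Oplus>\<^bsub>M\<^esub>i\<in>{..<q}. u i (w i))"
          using v' w' uD by (intro M.M.finsum_addf) auto
        finally show "\<psi> (v \<oplus>\<^bsub>?P\<^esub> w) = \<psi> v \<oplus>\<^bsub>M\<^esub> \<psi> w"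
          using v w P.M.a_closed[OF v w] by (simp add: \<psi>_def)
      next
        fix r assume r: "r \<in> carrier R"
        have "(\<Oplus>\<^bsub>M\<^esub>i\<in>{..<q}. u i ((r \<odot>\<^bsub>?P\<^esub> v) i)) = (\<Oplus>\<^bsub>M\<^esub>i\<in>{..<q}. r \<odot>\<^bsub>M\<^esub> u i (v i))"
          using v' uD r by (intro M.M.finsum_cong' refl) (auto simp: M.closed)
        also have "\<dots> = r \<odot>\<^bsub>M\<^esub> (\<Oplus>\<^bsub>M\<^esub>i\<in>{..<q}. u i (v i))"
          using v' uD by (intro abelian_group_hom.hom_finsum[OF M.smult_hom[OF r], symmetric]) auto
        finally show "\<psi> (r \<odot>\<^bsub>?P\<^esub> v) = r \<odot>\<^bsub>M\<^esub> \<psi> v"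
          using v P.smult_closed[OF r v] by (simp add: \<psi>_def)
        have "(\<Oplus>\<^bsub>M\<^esub>i\<in>{..<q}. u i ((v \<boxdot>\<^bsub>?P\<^esub> r) i)) = (\<Oplus>\<^bsub>M\<^esub>i\<in>{..<q}. u i (v i) \<boxdot>\<^bsub>M\<^esub> r)"
          using v' uD r by (intro M.M.finsum_cong' refl) (auto simp: M.closed)
        also have "\<dots> = (\<Oplus>\<^bsub>M\<^esub>i\<in>{..<q}. u i (v i)) \<boxdot>\<^bsub>M\<^esub> r"
          using v' uD by (intro abelian_group_hom.hom_finsum[OF M.rsmult_hom[OF r], symmetric]) auto
        finally show "\<psi> (v \<boxdot>\<^bsub>?P\<^esub> r) = \<psi> v \<boxdot>\<^bsub>M\<^esub> r"
          using v P.rsmult_closed[OF r v] by (simp add: \<psi>_def)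
      }
    qed
    moreover have "\<psi> (\<phi> m) = m" if m: "m \<in> carrier M" for m
    proof -
      have "\<psi> (\<phi> m) = (\<Oplus>\<^bsub>M\<^esub>i\<in>{..<q}. u i (\<phi> m i))"
        using m bD by (simp add: \<psi>_def \<phi>_def)
      also have "\<dots> = (\<Oplus>\<^bsub>M\<^esub>i\<in>{..<q}. u i (b i m))"
        using m bD uD by (intro M.M.finsum_cong' refl) (auto simp: \<phi>_def)
      finally show ?thesis using bu m by (simp add: dual_basis_def)
    qed
    ultimately show "\<exists>\<phi>\<in>bimod_hom R M ?P. \<exists>\<psi>\<in>bimod_hom R ?P M. \<forall>m\<in>carrier M. \<psi> (\<phi> m) = m" by blast
  qed
qed


section \<open>Full idempotents\<close>

lemma (in abelian_monoid) finsum_concat: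
  fixes q k :: nat
  assumes "f \<in> {..<q} \<rightarrow> carrier G" "g \<in> {..<k} \<rightarrow> carrier G"
  shows "(\<Oplus>i\<in>{..<q + k}. if i < q then f i else g (i - q)) = (\<Oplus>i\<in>{..<q}. f i) \<oplus> (\<Oplus>i\<in>{..<k}. g i)"
  using assms(2)
proof (induction k)
  case 0
  have "(\<Oplus>i\<in>{..<q}. if i < q then f i else g (i - q)) = (\<Oplus>i\<in>{..<q}. f i)"
    using assms(1) by (intro finsum_cong') auto
  with assms(1) show ?case by simp
next
  case (Suc k)
  let ?h = "\<lambda>i. if i < q then f i else g (i - q)"
  have "?h \<in> {..<q + k} \<rightarrow> carrier G"
    using assms(1) Suc.prems by (auto simp: Pi_iff)
  then have "(\<Oplus>i\<in>{..<q + Suc k}. ?h i) = g k \<oplus> (\<Oplus>i\<in>{..<q + k}. ?h i)"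
    using Suc.prems finsum_insert[of "{..<q + k}" "q + k" ?h] by (simp add: lessThan_Suc Pi_iff)
  also have "\<dots> = g k \<oplus> ((\<Oplus>i\<in>{..<q}. f i) \<oplus> (\<Oplus>i\<in>{..<k}. g i))"
    using Suc by (simp add: Pi_iff)
  also have "\<dots> = (\<Oplus>i\<in>{..<q}. f i) \<oplus> (g k \<oplus> (\<Oplus>i\<in>{..<k}. g i))"
    using assms(1) Suc.prems by (intro a_lcomm finsum_closed) (auto simp: Pi_iff)
  also have "g k \<oplus> (\<Oplus>i\<in>{..<k}. g i) = (\<Oplus>i\<in>{..<Suc k}. g i)"
    using Suc.prems finsum_insert[of "{..<k}" k g] by (simp add: lessThan_Suc Pi_iff)
  finally show ?case .
qed

text \<open>
  The ideal generated by \<open>e\<close> is the whole ring if and only if it contains \<open>1\<close>, and signs can be moved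
  into the left factors of its elements. The sum can be chosen to be nonempty, which gives a
  positive number of copies of \<open>R\<close> in the definition of H-separability.
\<close>

lemma (in ring) full_idempotent_iff:
  "full_idempotent R e \<longleftrightarrow> e \<in> carrier R \<and> e \<otimes> e = e \<and>
    (\<exists>q>0. \<exists>x\<in>{..<q} \<rightarrow> carrier R. \<exists>y\<in>{..<q} \<rightarrow> carrier R.
       (\<Oplus>i\<in>{..<q::nat}. x i \<otimes> e \<otimes> y i) = \<one>)"
proof (cases "e \<in> carrier R")
  case e: True
  let ?X = "{t \<otimes> e \<otimes> t' | t t'. t \<in> carrier R \<and> t' \<in> carrier R}"
  let ?G = "generate (add_monoid R) ?X"
  have sum_closed: "(\<lambda>i. x i \<otimes> e \<otimes> y i) \<in> {..<q} \<rightarrow> carrier R"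
    if "x \<in> {..<q} \<rightarrow> carrier R" "y \<in> {..<q} \<rightarrow> carrier R" for q :: nat and x y
    using that e by (auto simp: Pi_iff)
  have "?X \<subseteq> carrier R" using e by auto
  then have sub: "?G \<subseteq> carrier R" using add.generate_incl[of ?X] by simp
  \<comment> \<open>Zero is the sum consisting of the single term \<open>0 e 0\<close>, so that \<open>q\<close> stays positive.\<close>
  have as_sum: "\<exists>q>0. \<exists>x\<in>{..<q} \<rightarrow> carrier R. \<exists>y\<in>{..<q} \<rightarrow> carrier R. z = (\<Oplus>i\<in>{..<q::nat}. x i \<otimes> e \<otimes> y i)"
    if "z \<in> ?G" for z
    using that
  proof (induction rule: generate.induct)
    case one
    have "(\<Oplus>i\<in>{..<1::nat}. \<zero> \<otimes> e \<otimes> \<zero>) = \<zero>" using e by (simp add: finsum_singleton lessThan_Suc)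
    then show ?case using e by (intro exI[of _ 1] conjI bexI[of _ "\<lambda>_. \<zero>"]) auto
  next
    case (incl h)
    then obtain t t' where t: "t \<in> carrier R" "t' \<in> carrier R" "h = t \<otimes> e \<otimes> t'" by blast
    then have "(\<Oplus>i\<in>{..<1::nat}. t \<otimes> e \<otimes> t') = h" using e by (simp add: lessThan_Suc)
    then show ?case using t by (intro exI[of _ 1] conjI bexI[of _ "\<lambda>_. t"] bexI[of _ "\<lambda>_. t'"]) auto
  next
    case (inv h)
    then obtain t t' where t: "t \<in> carrier R" "t' \<in> carrier R" "h = t \<otimes> e \<otimes> t'" by blast
    then have "(\<Oplus>i\<in>{..<1::nat}. \<ominus> t \<otimes> e \<otimes> t') = inv\<^bsub>add_monoid R\<^esub> h"
      using e by (simp add: lessThan_Suc l_minus flip: a_inv_def)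
    then show ?case
      using t by (intro exI[of _ 1] conjI bexI[of _ "\<lambda>_. \<ominus> t"] bexI[of _ "\<lambda>_. t'"]) auto
  next
    case (eng h1 h2)
    obtain q x y where 1: "q > 0" "x \<in> {..<q} \<rightarrow> carrier R" "y \<in> {..<q} \<rightarrow> carrier R"
      "h1 = (\<Oplus>i\<in>{..<q::nat}. x i \<otimes> e \<otimes> y i)" using eng.IH(1) by blast
    obtain k x' y' where 2: "x' \<in> {..<k} \<rightarrow> carrier R" "y' \<in> {..<k} \<rightarrow> carrier R"
      "h2 = (\<Oplus>i\<in>{..<k::nat}. x' i \<otimes> e \<otimes> y' i)" using eng.IH(2) by blast
    let ?x = "\<lambda>i. if i < q then x i else x' (i - q)" and ?y = "\<lambda>i. if i < q then y i else y' (i - q)"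
    have xy: "?x \<in> {..<q + k} \<rightarrow> carrier R" "?y \<in> {..<q + k} \<rightarrow> carrier R"
      using 1 2 by (auto simp: Pi_iff)
    have "(\<Oplus>i\<in>{..<q + k}. ?x i \<otimes> e \<otimes> ?y i)
        = (\<Oplus>i\<in>{..<q + k}. if i < q then x i \<otimes> e \<otimes> y i else x' (i - q) \<otimes> e \<otimes> y' (i - q))"
      using 1 2 e by (intro finsum_cong') (auto simp: Pi_iff)
    also have "\<dots> = h1 \<oplus> h2"
      using finsum_concat[OF sum_closed[OF 1(2,3)] sum_closed[OF 2(1,2)]] 1 2 by simp
    finally have "h1 \<oplus> h2 = (\<Oplus>i\<in>{..<q + k}. ?x i \<otimes> e \<otimes> ?y i)" ..
    then show ?case
      using xy 1(1) by (intro exI[of _ "q + k"] conjI bexI[OF _ xy(1)] bexI[OF _ xy(2)]) simp_all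
  qed
  have sum_in: "(\<Oplus>i\<in>{..<q::nat}. g i) \<in> ?G" if "g \<in> {..<q} \<rightarrow> ?X" for q g
    using that
  proof (induction q)
    case 0
    show ?case using generate.one[of "add_monoid R" ?X] by simp
  next
    case (Suc q)
    have "g \<in> {..<Suc q} \<rightarrow> carrier R" using Suc.prems \<open>?X \<subseteq> carrier R\<close> by blast
    then have "(\<Oplus>i\<in>{..<Suc q}. g i) = g q \<oplus> (\<Oplus>i\<in>{..<q}. g i)"
      using finsum_insert[of "{..<q}" q g] by (simp add: lessThan_Suc Pi_iff)
    moreover have "g q \<in> ?G" using Suc.prems by (intro generate.incl) auto
    moreover have "(\<Oplus>i\<in>{..<q}. g i) \<in> ?G" using Suc by (simp add: Pi_iff)
    ultimately show ?case using generate.eng[of "g q" "add_monoid R" ?X] by simp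
  qed
  have "?G = carrier R"
    if x: "x \<in> {..<q} \<rightarrow> carrier R" and y: "y \<in> {..<q} \<rightarrow> carrier R"
      and 1: "(\<Oplus>i\<in>{..<q::nat}. x i \<otimes> e \<otimes> y i) = \<one>" for q x y
  proof (intro equalityI sub subsetI)
    fix t assume t: "t \<in> carrier R"
    have "t = t \<otimes> (\<Oplus>i\<in>{..<q::nat}. x i \<otimes> e \<otimes> y i)" using 1 t by simp
    also have "\<dots> = (\<Oplus>i\<in>{..<q}. t \<otimes> (x i \<otimes> e \<otimes> y i))"
      using t sum_closed[OF x y] by (intro finsum_rdistr) auto
    also have "\<dots> = (\<Oplus>i\<in>{..<q}. (t \<otimes> x i) \<otimes> e \<otimes> y i)"
      using t x y e by (intro finsum_cong') (auto simp: Pi_iff m_assoc)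
    also have "\<dots> \<in> ?G"
    proof (intro sum_in Pi_I)
      fix i assume "i \<in> {..<q}"
      then have "t \<otimes> x i \<in> carrier R" "y i \<in> carrier R" using t x y by auto
      then show "(t \<otimes> x i) \<otimes> e \<otimes> y i \<in> ?X" by blast
    qed
    finally show "t \<in> ?G" .
  qed
  then have "?G = carrier R" if "\<exists>q>0. \<exists>x\<in>{..<q} \<rightarrow> carrier R. \<exists>y\<in>{..<q} \<rightarrow> carrier R.
      (\<Oplus>i\<in>{..<q::nat}. x i \<otimes> e \<otimes> y i) = \<one>"
    using that by blast
  moreover have "\<exists>q>0. \<exists>x\<in>{..<q} \<rightarrow> carrier R. \<exists>y\<in>{..<q} \<rightarrow> carrier R.
      (\<Oplus>i\<in>{..<q::nat}. x i \<otimes> e \<otimes> y i) = \<one>" if "?G = carrier R"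
    using as_sum[of \<one>] unfolding that by (simp add: eq_commute[of \<one>])
  ultimately show ?thesis
    unfolding full_idempotent_def using e by argo
qed (simp add: full_idempotent_def)

lemma full_idempotent_ring_iso:
  assumes "ring E" "ring T" and h: "h \<in> ring_iso E T" and e: "e \<in> carrier E"
  shows "full_idempotent T (h e) \<longleftrightarrow> full_idempotent E e"
proof -
  interpret E: ring E by fact
  interpret T: ring T by fact
  note h' = ring_iso_memE[OF h]
  interpret h: abelian_group_hom E T h
    using h'(1,3) by (intro additive_imp_abelian_group_hom E.abelian_group_axioms T.abelian_group_axioms) auto
  have inj: "h a = h b \<longleftrightarrow> a = b" if "a \<in> carrier E" "b \<in> carrier E" for a b
    using h'(5) that by (auto simp: bij_betw_def inj_on_eq_iff)
  have sum: "(\<Oplus>\<^bsub>T\<^esub>i\<in>{..<q}. h (x i) \<otimes>\<^bsub>T\<^esub> h e \<otimes>\<^bsub>T\<^esub> h (y i)) = \<one>\<^bsub>T\<^esub> \<longleftrightarrow>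
      (\<Oplus>\<^bsub>E\<^esub>i\<in>{..<q}. x i \<otimes>\<^bsub>E\<^esub> e \<otimes>\<^bsub>E\<^esub> y i) = \<one>\<^bsub>E\<^esub>"
    if xy: "x \<in> {..<q} \<rightarrow> carrier E" "y \<in> {..<q} \<rightarrow> carrier E" for x y and q :: nat
  proof -
    have terms: "(\<lambda>i. x i \<otimes>\<^bsub>E\<^esub> e \<otimes>\<^bsub>E\<^esub> y i) \<in> {..<q} \<rightarrow> carrier E" using xy e by (auto simp: Pi_iff)
    have "(\<Oplus>\<^bsub>T\<^esub>i\<in>{..<q}. h (x i) \<otimes>\<^bsub>T\<^esub> h e \<otimes>\<^bsub>T\<^esub> h (y i)) = (\<Oplus>\<^bsub>T\<^esub>i\<in>{..<q}. h (x i \<otimes>\<^bsub>E\<^esub> e \<otimes>\<^bsub>E\<^esub> y i))"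
      using xy e by (intro T.finsum_cong') (auto simp: h' Pi_iff)
    also have "\<dots> = h (\<Oplus>\<^bsub>E\<^esub>i\<in>{..<q}. x i \<otimes>\<^bsub>E\<^esub> e \<otimes>\<^bsub>E\<^esub> y i)"
      by (rule h.hom_finsum[symmetric]) (use terms in auto)
    finally show ?thesis
      using inj[OF E.finsum_closed[OF terms] E.one_closed] by (simp add: h'(4))
  qed
  let ?g = "inv_into (carrier E) h"
  have g: "?g t \<in> carrier E" "h (?g t) = t" if "t \<in> carrier T" for t
    using h'(5) that by (auto simp: bij_betw_def inv_into_into f_inv_into_f)
  have "(\<exists>x\<in>{..<q} \<rightarrow> carrier T. \<exists>y\<in>{..<q} \<rightarrow> carrier T. (\<Oplus>\<^bsub>T\<^esub>i\<in>{..<q}. x i \<otimes>\<^bsub>T\<^esub> h e \<otimes>\<^bsub>T\<^esub> y i) = \<one>\<^bsub>T\<^esub>)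
      \<longleftrightarrow> (\<exists>x\<in>{..<q} \<rightarrow> carrier E. \<exists>y\<in>{..<q} \<rightarrow> carrier E. (\<Oplus>\<^bsub>E\<^esub>i\<in>{..<q}. x i \<otimes>\<^bsub>E\<^esub> e \<otimes>\<^bsub>E\<^esub> y i) = \<one>\<^bsub>E\<^esub>)"
    (is "?T \<longleftrightarrow> ?E") for q :: nat
  proof
    assume ?T
    then obtain x y where xy: "x \<in> {..<q} \<rightarrow> carrier T" "y \<in> {..<q} \<rightarrow> carrier T"
      "(\<Oplus>\<^bsub>T\<^esub>i\<in>{..<q}. x i \<otimes>\<^bsub>T\<^esub> h e \<otimes>\<^bsub>T\<^esub> y i) = \<one>\<^bsub>T\<^esub>" by blast
    have "(\<Oplus>\<^bsub>T\<^esub>i\<in>{..<q}. h (?g (x i)) \<otimes>\<^bsub>T\<^esub> h e \<otimes>\<^bsub>T\<^esub> h (?g (y i))) = (\<Oplus>\<^bsub>T\<^esub>i\<in>{..<q}. x i \<otimes>\<^bsub>T\<^esub> h e \<otimes>\<^bsub>T\<^esub> y i)"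
      using xy e by (intro T.finsum_cong') (auto simp: g Pi_iff)
    moreover have gxy: "(\<lambda>i. ?g (x i)) \<in> {..<q} \<rightarrow> carrier E" "(\<lambda>i. ?g (y i)) \<in> {..<q} \<rightarrow> carrier E"
      using xy g by (auto simp: Pi_iff)
    ultimately have "(\<Oplus>\<^bsub>E\<^esub>i\<in>{..<q}. ?g (x i) \<otimes>\<^bsub>E\<^esub> e \<otimes>\<^bsub>E\<^esub> ?g (y i)) = \<one>\<^bsub>E\<^esub>"
      using sum[OF gxy] xy(3) by simp
    then show ?E using gxy by (intro bexI[of _ "\<lambda>i. ?g (x i)"] bexI[of _ "\<lambda>i. ?g (y i)"])
  next
    assume ?E
    then obtain x y where xy: "x \<in> {..<q} \<rightarrow> carrier E" "y \<in> {..<q} \<rightarrow> carrier E"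
      "(\<Oplus>\<^bsub>E\<^esub>i\<in>{..<q}. x i \<otimes>\<^bsub>E\<^esub> e \<otimes>\<^bsub>E\<^esub> y i) = \<one>\<^bsub>E\<^esub>" by blast
    then show ?T
      using sum[OF xy(1,2)] h'(1)
      by (intro bexI[of _ "\<lambda>i. h (x i)"] bexI[of _ "\<lambda>i. h (y i)"]) (auto simp: Pi_iff)
  qed
  moreover have "h e \<otimes>\<^bsub>T\<^esub> h e = h e \<longleftrightarrow> e \<otimes>\<^bsub>E\<^esub> e = e"
    using e inj[of "e \<otimes>\<^bsub>E\<^esub> e" e] h'(2)[OF e e] by simp
  ultimately show ?thesis
    unfolding E.full_idempotent_iff T.full_idempotent_iff using e by simp
qed

section \<open>Bimodules that contain the regular bimodule as a direct summand\<close>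

lemma (in ring) ring_ring_center: "ring (ring_center R)"
proof -
  have "subring {z \<in> carrier R. \<forall>r\<in>carrier R. z \<otimes> r = r \<otimes> z} R"
  proof (rule subringI; (elim CollectE conjE)?)
    fix z w assume z: "z \<in> carrier R" "\<forall>r\<in>carrier R. z \<otimes> r = r \<otimes> z"
    show "\<ominus> z \<in> {z \<in> carrier R. \<forall>r\<in>carrier R. z \<otimes> r = r \<otimes> z}" using z by (simp add: l_minus r_minus)
    assume w: "w \<in> carrier R" "\<forall>r\<in>carrier R. w \<otimes> r = r \<otimes> w"
    show "z \<oplus> w \<in> {z \<in> carrier R. \<forall>r\<in>carrier R. z \<otimes> r = r \<otimes> z}"
      using z w by (simp add: l_distr r_distr)
    have zw: "z \<otimes> w \<otimes> r = r \<otimes> (z \<otimes> w)" if "r \<in> carrier R" for r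
      using z w that by (metis m_assoc)
    then show "z \<otimes> w \<in> {z \<in> carrier R. \<forall>r\<in>carrier R. z \<otimes> r = r \<otimes> z}"
      using z(1) w(1) by (intro CollectI conjI ballI zw m_closed)
  qed auto
  then show ?thesis unfolding ring_center_def by (rule subring_is_ring)
qed

text \<open>
  What a separability element makes of the tensor square: the multiplication \<open>\<mu>\<close> is split by a
  bimodule homomorphism \<open>\<sigma>\<close>. Whether, conversely, \<open>M\<close> is a summand of a power of \<open>R\<close> can then be read
  off from the idempotent \<open>\<sigma> \<mu>\<close>.
\<close>

locale split_bimod = bimod R M
  for R :: "('a, 'x) ring_scheme" and M :: "('a, 'b, 'y) bimodule_scheme" +
  fixes \<mu> :: "'b \<Rightarrow> 'a" and \<sigma> :: "'a \<Rightarrow> 'b"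
  assumes mu_hom: "\<mu> \<in> bimod_hom R M (regular_bimodule R)"
    and sigma_hom: "\<sigma> \<in> bimod_hom R (regular_bimodule R) M"
    and mu_sigma [simp]: "r \<in> carrier R \<Longrightarrow> \<mu> (\<sigma> r) = r"
begin

abbreviation E :: "('b \<Rightarrow> 'b) ring" where "E \<equiv> bimod_End R M"

definition \<epsilon> :: "'b \<Rightarrow> 'b" where "\<epsilon> = compose (carrier M) \<sigma> \<mu>"

lemmas muD = bimod_homD(2-5)[OF mu_hom, simplified]
lemmas sigmaD = bimod_homD(2-5)[OF sigma_hom, simplified]

lemma eps_hom: "\<epsilon> \<in> bimod_hom R M M"
  unfolding \<epsilon>_def by (rule bimod_hom_compose[OF bimod_axioms mu_hom sigma_hom])

lemma eps_apply: "m \<in> carrier M \<Longrightarrow> \<epsilon> m = \<sigma> (\<mu> m)"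
  by (simp add: \<epsilon>_def compose_eq)

text \<open>
  The translation is \<open>x\<^sub>i = u\<^sub>i \<mu>\<close>, \<open>y\<^sub>i = \<sigma> b\<^sub>i\<close> in one direction and \<open>u\<^sub>i = x\<^sub>i \<sigma>\<close>, \<open>b\<^sub>i = \<mu> y\<^sub>i\<close> in the
  other; both turn \<open>u\<^sub>i b\<^sub>i\<close> into \<open>x\<^sub>i \<epsilon> y\<^sub>i\<close> because \<open>\<mu> \<sigma> = id\<close>.
\<close>

lemma dual_basis_iff_full:
  "(\<exists>q>0. \<exists>b u. dual_basis R M (regular_bimodule R) q b u) \<longleftrightarrow> full_idempotent E \<epsilon>"
proof -
  interpret E: ring E by (rule ring_bimod_End)
  note Rb = bimod_regular[OF A.ring_axioms]
  have "\<epsilon> \<otimes>\<^bsub>E\<^esub> \<epsilon> = \<epsilon>"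
  proof (rule bimod_hom_eqI[OF _ eps_hom])
    show "\<epsilon> \<otimes>\<^bsub>E\<^esub> \<epsilon> \<in> bimod_hom R M M" using E.m_closed[of \<epsilon> \<epsilon>] eps_hom by simp
  qed (simp add: compose_eq eps_apply muD sigmaD)
  moreover have "(\<exists>x\<in>{..<q} \<rightarrow> carrier E. \<exists>y\<in>{..<q} \<rightarrow> carrier E.
        (\<Oplus>\<^bsub>E\<^esub>i\<in>{..<q}. x i \<otimes>\<^bsub>E\<^esub> \<epsilon> \<otimes>\<^bsub>E\<^esub> y i) = \<one>\<^bsub>E\<^esub>)
      \<longleftrightarrow> (\<exists>b u. dual_basis R M (regular_bimodule R) q b u)" (is "?F \<longleftrightarrow> ?D") for q
  proof
    assume ?F
    then obtain x y where x: "\<And>i. i < q \<Longrightarrow> x i \<in> bimod_hom R M M"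
      and y: "\<And>i. i < q \<Longrightarrow> y i \<in> bimod_hom R M M"
      and one: "(\<Oplus>\<^bsub>E\<^esub>i\<in>{..<q}. x i \<otimes>\<^bsub>E\<^esub> \<epsilon> \<otimes>\<^bsub>E\<^esub> y i) = \<one>\<^bsub>E\<^esub>"
      by (auto simp: Pi_iff)
    let ?b = "\<lambda>i. compose (carrier M) \<mu> (y i)" and ?u = "\<lambda>i. compose (carrier R) (x i) \<sigma>"
    have terms: "(\<lambda>i. x i \<otimes>\<^bsub>E\<^esub> \<epsilon> \<otimes>\<^bsub>E\<^esub> y i) \<in> {..<q} \<rightarrow> carrier E"
      using x y eps_hom by (intro Pi_I E.m_closed) auto
    have "(\<Oplus>\<^bsub>M\<^esub>i\<in>{..<q}. ?u i (?b i m)) = m" if m: "m \<in> carrier M" for m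
    proof -
      have "(\<Oplus>\<^bsub>M\<^esub>i\<in>{..<q}. ?u i (?b i m)) = (\<Oplus>\<^bsub>M\<^esub>i\<in>{..<q}. (x i \<otimes>\<^bsub>E\<^esub> \<epsilon> \<otimes>\<^bsub>E\<^esub> y i) m)"
        using m bimod_homD(2)[OF x] bimod_homD(2)[OF y] muD(1) sigmaD(1)
        by (intro M.finsum_cong' refl) (auto simp: compose_eq eps_apply)
      also have "\<dots> = (\<Oplus>\<^bsub>E\<^esub>i\<in>{..<q}. x i \<otimes>\<^bsub>E\<^esub> \<epsilon> \<otimes>\<^bsub>E\<^esub> y i) m"
        using terms m by (intro End_finsum_apply[symmetric]) auto
      finally show ?thesis using m one by simp
    qed
    moreover have "?b i \<in> bimod_hom R M (regular_bimodule R)" "?u i \<in> bimod_hom R (regular_bimodule R) M"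
      if "i < q" for i
      using bimod_hom_compose[OF bimod_axioms y[OF that] mu_hom]
        bimod_hom_compose[OF Rb sigma_hom x[OF that]] by simp_all
    ultimately show ?D
      unfolding dual_basis_def by (intro exI[of _ ?b] exI[of _ ?u]) auto
  next
    assume ?D
    then obtain b u where bu: "dual_basis R M (regular_bimodule R) q b u" by blast
    have b: "b i \<in> bimod_hom R M (regular_bimodule R)" and u: "u i \<in> bimod_hom R (regular_bimodule R) M"
      if "i < q" for i using bu that by (auto simp: dual_basis_def)
    have sum: "(\<Oplus>\<^bsub>M\<^esub>i\<in>{..<q}. u i (b i m)) = m" if "m \<in> carrier M" for m
      using bu that by (simp add: dual_basis_def)
    let ?x = "\<lambda>i. compose (carrier M) (u i) \<mu>" and ?y = "\<lambda>i. compose (carrier M) \<sigma> (b i)"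
    have x: "?x \<in> {..<q} \<rightarrow> carrier E" and y: "?y \<in> {..<q} \<rightarrow> carrier E"
      using bimod_hom_compose[OF bimod_axioms mu_hom u] bimod_hom_compose[OF bimod_axioms b sigma_hom]
      by auto
    have terms: "(\<lambda>i. ?x i \<otimes>\<^bsub>E\<^esub> \<epsilon> \<otimes>\<^bsub>E\<^esub> ?y i) \<in> {..<q} \<rightarrow> carrier E"
      using x y eps_hom by (intro Pi_I E.m_closed) auto
    have "(\<Oplus>\<^bsub>E\<^esub>i\<in>{..<q}. ?x i \<otimes>\<^bsub>E\<^esub> \<epsilon> \<otimes>\<^bsub>E\<^esub> ?y i) = \<one>\<^bsub>E\<^esub>"
    proof (rule bimod_hom_eqI)
      show "(\<Oplus>\<^bsub>E\<^esub>i\<in>{..<q}. ?x i \<otimes>\<^bsub>E\<^esub> \<epsilon> \<otimes>\<^bsub>E\<^esub> ?y i) \<in> bimod_hom R M M" "\<one>\<^bsub>E\<^esub> \<in> bimod_hom R M M"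
        using E.finsum_closed[OF terms] E.one_closed by simp_all
      fix m assume m: "m \<in> carrier M"
      have "(\<Oplus>\<^bsub>E\<^esub>i\<in>{..<q}. ?x i \<otimes>\<^bsub>E\<^esub> \<epsilon> \<otimes>\<^bsub>E\<^esub> ?y i) m = (\<Oplus>\<^bsub>M\<^esub>i\<in>{..<q}. (?x i \<otimes>\<^bsub>E\<^esub> \<epsilon> \<otimes>\<^bsub>E\<^esub> ?y i) m)"
        using terms m by (intro End_finsum_apply) auto
      also have "\<dots> = (\<Oplus>\<^bsub>M\<^esub>i\<in>{..<q}. u i (b i m))"
        using m bimod_homD(2)[OF b, simplified] bimod_homD(2)[OF u, simplified] muD(1) sigmaD(1)
        by (intro M.finsum_cong' refl) (auto simp: compose_eq eps_apply)
      finally show "(\<Oplus>\<^bsub>E\<^esub>i\<in>{..<q}. ?x i \<otimes>\<^bsub>E\<^esub> \<epsilon> \<otimes>\<^bsub>E\<^esub> ?y i) m = \<one>\<^bsub>E\<^esub> m" using sum[OF m] m by simp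
    qed
    then show ?F using x y by (intro bexI[of _ ?x] bexI[of _ ?y])
  qed
  ultimately show ?thesis
    unfolding E.full_idempotent_iff using eps_hom by simp
qed

text \<open>
  The endomorphism \<open>\<mu> f \<sigma>\<close> of the regular bimodule is determined by its value \<open>z\<close> at \<open>1\<close>: left
  linearity makes it \<open>r \<mapsto> r z\<close> and right linearity makes it \<open>r \<mapsto> z r\<close>. Hence \<open>z\<close> is central, and it
  describes \<open>\<epsilon> f \<epsilon> = \<sigma> (\<mu> f \<sigma>) \<mu>\<close> completely.
\<close>

lemma corner_of_End_is_center:
  assumes f: "f \<in> bimod_hom R M M"
  defines "z \<equiv> \<mu> (f (\<sigma> \<one>\<^bsub>R\<^esub>))"
  shows "z \<in> carrier (ring_center R)"
    and "m \<in> carrier M \<Longrightarrow> \<epsilon> (f (\<epsilon> m)) = \<sigma> (z \<otimes>\<^bsub>R\<^esub> \<mu> m)"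
proof -
  note fD = bimod_homD(2-5)[OF f]
  have s: "\<sigma> r = r \<odot>\<^bsub>M\<^esub> \<sigma> \<one>\<^bsub>R\<^esub>" "\<sigma> r = \<sigma> \<one>\<^bsub>R\<^esub> \<boxdot>\<^bsub>M\<^esub> r" if "r \<in> carrier R" for r
    using sigmaD(3)[of r "\<one>\<^bsub>R\<^esub>"] sigmaD(4)[of r "\<one>\<^bsub>R\<^esub>"] that by simp_all
  have left: "\<mu> (f (\<sigma> r)) = r \<otimes>\<^bsub>R\<^esub> z" if "r \<in> carrier R" for r
    unfolding s(1)[OF that] z_def using that by (simp add: muD sigmaD(1) fD)
  have right: "\<mu> (f (\<sigma> r)) = z \<otimes>\<^bsub>R\<^esub> r" if "r \<in> carrier R" for r
    unfolding s(2)[OF that] z_def using that by (simp add: muD sigmaD(1) fD)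
  have "z \<in> carrier R" by (simp add: z_def muD sigmaD fD)
  then show "z \<in> carrier (ring_center R)"
    using left right by (auto simp: ring_center_def)
  show "m \<in> carrier M \<Longrightarrow> \<epsilon> (f (\<epsilon> m)) = \<sigma> (z \<otimes>\<^bsub>R\<^esub> \<mu> m)"
    by (simp add: eps_apply muD(1) sigmaD(1) fD(1) right)
qed

theorem morita_equivalent_center_End:
  assumes "full_idempotent E \<epsilon>" "infinite (UNIV :: 'u set)"
  shows "morita_equivalent TYPE('u) (ring_center R) E"
proof -
  interpret E: ring E by (rule ring_bimod_End)
  interpret Z: ring "ring_center R" by (rule A.ring_ring_center)
  have Z: "z \<in> carrier R" if "z \<in> carrier (ring_center R)" for z
    using that by (simp add: ring_center_def)
  have comm: "z \<otimes>\<^bsub>R\<^esub> r = r \<otimes>\<^bsub>R\<^esub> z" if "z \<in> carrier (ring_center R)" "r \<in> carrier R" for z r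
    using that by (simp add: ring_center_def)
  have [simp]: "\<one>\<^bsub>ring_center R\<^esub> = \<one>\<^bsub>R\<^esub>" "a \<otimes>\<^bsub>ring_center R\<^esub> b = a \<otimes>\<^bsub>R\<^esub> b"
    "a \<oplus>\<^bsub>ring_center R\<^esub> b = a \<oplus>\<^bsub>R\<^esub> b" for a b by (simp_all add: ring_center_def)
  \<comment> \<open>Left linearity of \<open>\<iota> z\<close> is where centrality of \<open>z\<close> is needed; \<open>\<iota>(1) = \<epsilon>\<close>.\<close>
  define \<iota> where "\<iota> z = (\<lambda>m\<in>carrier M. \<sigma> (z \<otimes>\<^bsub>R\<^esub> \<mu> m))" for z
  have \<iota>_hom: "\<iota> z \<in> bimod_hom R M M" if "z \<in> carrier (ring_center R)" for z
  proof (rule bimod_homI)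
    fix r m assume r: "r \<in> carrier R" and m: "m \<in> carrier M"
    have "z \<otimes>\<^bsub>R\<^esub> (r \<otimes>\<^bsub>R\<^esub> \<mu> m) = r \<otimes>\<^bsub>R\<^esub> (z \<otimes>\<^bsub>R\<^esub> \<mu> m)"
      using Z[OF that] comm[OF that] r m muD(1) by (metis A.m_assoc)
    then show "\<iota> z (r \<odot>\<^bsub>M\<^esub> m) = r \<odot>\<^bsub>M\<^esub> \<iota> z m"
      using that r m by (simp add: \<iota>_def muD Z closed flip: sigmaD(3))
    show "\<iota> z (m \<boxdot>\<^bsub>M\<^esub> r) = \<iota> z m \<boxdot>\<^bsub>M\<^esub> r"
      using that r m by (simp add: \<iota>_def muD Z closed A.m_assoc flip: sigmaD(4))
  qed (use that in \<open>auto simp: \<iota>_def muD sigmaD(1,2) Z A.r_distr\<close>)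
  have \<iota>_one: "\<iota> \<one>\<^bsub>R\<^esub> = \<epsilon>"
    by (auto simp: \<iota>_def \<epsilon>_def compose_def muD)
  obtain q x y where "x \<in> {..<q} \<rightarrow> carrier E" "y \<in> {..<q} \<rightarrow> carrier E"
    "(\<Oplus>\<^bsub>E\<^esub>i\<in>{..<q::nat}. x i \<otimes>\<^bsub>E\<^esub> \<epsilon> \<otimes>\<^bsub>E\<^esub> y i) = \<one>\<^bsub>E\<^esub>"
    using assms(1) E.full_idempotent_iff by blast
  then interpret corner: full_corner "ring_center R" E \<iota> q x y
  proof unfold_locales
    fix z w assume z: "z \<in> carrier (ring_center R)" and w: "w \<in> carrier (ring_center R)"
    show "\<iota> z \<in> carrier E" using \<iota>_hom[OF z] by simp
    show "\<iota> (z \<oplus>\<^bsub>ring_center R\<^esub> w) = \<iota> z \<oplus>\<^bsub>E\<^esub> \<iota> w"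
      using z w by (auto simp: \<iota>_def Z muD sigmaD(1,2) A.l_distr)
    show "\<iota> (z \<otimes>\<^bsub>ring_center R\<^esub> w) = \<iota> z \<otimes>\<^bsub>E\<^esub> \<iota> w"
      using z w by (auto simp: \<iota>_def Z muD sigmaD(1,2) A.m_assoc compose_def)
  next
    show "inj_on \<iota> (carrier (ring_center R))"
    proof (rule inj_onI)
      fix z w assume z: "z \<in> carrier (ring_center R)" and w: "w \<in> carrier (ring_center R)" and "\<iota> z = \<iota> w"
      then have "\<mu> (\<iota> z (\<sigma> \<one>\<^bsub>R\<^esub>)) = \<mu> (\<iota> w (\<sigma> \<one>\<^bsub>R\<^esub>))" by simp
      then show "z = w" using z w by (simp add: \<iota>_def Z muD sigmaD(1,2))
    qed
  next
    fix f assume f: "f \<in> carrier E"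
    let ?z = "\<mu> (f (\<sigma> \<one>\<^bsub>R\<^esub>))"
    have "\<epsilon> \<otimes>\<^bsub>E\<^esub> f \<otimes>\<^bsub>E\<^esub> \<epsilon> = \<iota> ?z"
    proof (rule bimod_hom_eqI)
      show "\<epsilon> \<otimes>\<^bsub>E\<^esub> f \<otimes>\<^bsub>E\<^esub> \<epsilon> \<in> bimod_hom R M M"
        using E.m_closed[OF E.m_closed[of \<epsilon> f], of \<epsilon>] f eps_hom by simp
      show "\<iota> ?z \<in> bimod_hom R M M"
        using f corner_of_End_is_center(1) \<iota>_hom by simp
      fix m assume m: "m \<in> carrier M"
      then show "(\<epsilon> \<otimes>\<^bsub>E\<^esub> f \<otimes>\<^bsub>E\<^esub> \<epsilon>) m = \<iota> ?z m"
        using corner_of_End_is_center(2)[of f m] f bimod_homD(2)[OF eps_hom m]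
        by (simp add: compose_eq \<iota>_def)
    qed
    then show "\<iota> \<one>\<^bsub>ring_center R\<^esub> \<otimes>\<^bsub>E\<^esub> f \<otimes>\<^bsub>E\<^esub> \<iota> \<one>\<^bsub>ring_center R\<^esub> \<in> \<iota> ` carrier (ring_center R)"
      using corner_of_End_is_center(1)[of f] f \<iota>_one by auto
  qed (auto simp: \<iota>_one Pi_iff)
  show ?thesis by (rule corner.morita_equivalent_corner) fact
qed

end

section \<open>The universal property of the tensor square\<close>

locale ring_extension = ring R for R :: "('a, 'x) ring_scheme" (structure) and S :: "'a set" +
  assumes subring: "subring S R"
begin

lemma S_closed [simp]: "s \<in> S \<Longrightarrow> s \<in> carrier R"
  using subringE(1)[OF subring] by blast

abbreviation G :: "('a \<times> 'a \<Rightarrow>\<^sub>0 int) monoid" where "G \<equiv> free_Abelian_group (carrier R \<times> carrier R)"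
abbreviation K :: "('a \<times> 'a \<Rightarrow>\<^sub>0 int) set" where "K \<equiv> tensor_kernel R S"
abbreviation W :: "'a tensor ring" where "W \<equiv> tensor_group R S"
abbreviation t :: "'a \<Rightarrow> 'a \<Rightarrow> 'a tensor" where "t \<equiv> tens R S"

definition cls :: "('a \<times> 'a \<Rightarrow>\<^sub>0 int) \<Rightarrow> 'a tensor" where "cls c = K #>\<^bsub>G\<^esub> c"

sublocale G: comm_group G
  by (rule abelian_free_Abelian_group)

lemma relations_closed: "tensor_relations R S \<subseteq> carrier G"
proof -
  have "frag_of p - frag_of q \<in> carrier G" if "p \<in> carrier R \<times> carrier R" "q \<in> carrier R \<times> carrier R" for p q
    using that keys_diff[of "frag_of p" "frag_of q"] by auto
  moreover have "frag_of p - frag_of q - frag_of r \<in> carrier G"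
    if "p \<in> carrier R \<times> carrier R" "q \<in> carrier R \<times> carrier R" "r \<in> carrier R \<times> carrier R" for p q r
    using that keys_diff[of "frag_of p" "frag_of q"] keys_diff[of "frag_of p - frag_of q" "frag_of r"] by auto
  ultimately show ?thesis
    unfolding tensor_relations_def by (auto simp del: carrier_free_Abelian_group_iff)
qed

lemma subgroup_K: "subgroup K G"
  unfolding tensor_kernel_def by (intro G.generate_is_subgroup relations_closed)

lemma normal_K: "K \<lhd> G"
  by (intro G.subgroup_imp_normal subgroup_K)

lemma carrier_W: "carrier W = cls ` carrier G"
  by (simp add: tensor_group_def Let_def carrier_FactGroup cls_def)

lemma zero_W: "\<zero>\<^bsub>W\<^esub> = cls 0"
proof -
  have "cls 0 = K"
    unfolding cls_def using G.coset_join2[OF _ subgroup_K, of 0] subgroup.one_closed[OF subgroup_K] by simp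
  then show ?thesis by (simp add: tensor_group_def Let_def)
qed

lemma cls_add: "\<lbrakk>c \<in> carrier G; d \<in> carrier G\<rbrakk> \<Longrightarrow> cls c \<oplus>\<^bsub>W\<^esub> cls d = cls (c + d)"
  using normal.rcos_sum[OF normal_K] by (simp add: tensor_group_def Let_def cls_def)

lemma cls_closed: "c \<in> carrier G \<Longrightarrow> cls c \<in> carrier W"
  by (simp add: carrier_W)

lemma cls_eqI:
  assumes "c \<in> carrier G" "d \<in> carrier G" "c - d \<in> K"
  shows "cls c = cls d"
proof -
  have "(c - d) \<otimes>\<^bsub>G\<^esub> d \<in> cls d"
    unfolding cls_def using assms by (intro G.rcosI subgroup.subset[OF subgroup_K])
  then show ?thesis
    unfolding cls_def using G.repr_independence[OF _ assms(2) subgroup_K] by simp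
qed

lemma abelian_group_W: "abelian_group W"
proof (rule abelian_groupI; unfold carrier_W zero_W)
  have plus: "c + d \<in> carrier G" if "c \<in> carrier G" "d \<in> carrier G" for c d
    using G.m_closed[OF that] by simp
  have zero: "0 \<in> carrier G" by simp
  note [simp del] = carrier_free_Abelian_group_iff
  note [simp] = plus zero cls_add
  fix x assume x: "x \<in> cls ` carrier G"
  then show "cls 0 \<oplus>\<^bsub>W\<^esub> x = x" by auto
  obtain c where c: "c \<in> carrier G" "x = cls c" using x by blast
  have "- c \<in> carrier G" using c G.inv_closed[of c] by (simp add: carrier_free_Abelian_group_iff)
  then show "\<exists>y\<in>cls ` carrier G. y \<oplus>\<^bsub>W\<^esub> x = cls 0" using c by (intro bexI[of _ "cls (- c)"]) auto
  fix y assume y: "y \<in> cls ` carrier G"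
  then show "x \<oplus>\<^bsub>W\<^esub> y \<in> cls ` carrier G" "x \<oplus>\<^bsub>W\<^esub> y = y \<oplus>\<^bsub>W\<^esub> x"
    using x by (auto simp: add.commute)
  fix z assume "z \<in> cls ` carrier G"
  then show "x \<oplus>\<^bsub>W\<^esub> y \<oplus>\<^bsub>W\<^esub> z = x \<oplus>\<^bsub>W\<^esub> (y \<oplus>\<^bsub>W\<^esub> z)" using x y by (auto simp: add.assoc)
qed simp

sublocale W: abelian_group W by (rule abelian_group_W)

definition balanced :: "('c, 'z) ring_scheme \<Rightarrow> ('a \<Rightarrow> 'a \<Rightarrow> 'c) \<Rightarrow> bool"
  where "balanced H f \<longleftrightarrow>
    (\<forall>a\<in>carrier R. \<forall>b\<in>carrier R. f a b \<in> carrier H) \<and>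
    (\<forall>a\<in>carrier R. \<forall>a'\<in>carrier R. \<forall>b\<in>carrier R. f (a \<oplus> a') b = f a b \<oplus>\<^bsub>H\<^esub> f a' b) \<and>
    (\<forall>a\<in>carrier R. \<forall>b\<in>carrier R. \<forall>b'\<in>carrier R. f a (b \<oplus> b') = f a b \<oplus>\<^bsub>H\<^esub> f a b') \<and>
    (\<forall>a\<in>carrier R. \<forall>s\<in>S. \<forall>b\<in>carrier R. f (a \<otimes> s) b = f a (s \<otimes> b))"

text \<open>
  This links the homomorphism that the universal property of the free abelian group provides with the
  explicit sum by which maps out of the tensor square are evaluated.
\<close>

lemma hom_free_eq_finsum:
  assumes "abelian_group H" "h \<in> hom G (add_monoid H)" "c \<in> carrier G"
  shows "h c = (\<Oplus>\<^bsub>H\<^esub>p\<in>Poly_Mapping.keys c. [Poly_Mapping.lookup c p] \<cdot>\<^bsub>H\<^esub> h (frag_of p))"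
proof -
  interpret H: abelian_group H by fact
  interpret h: group_hom G "add_monoid H" h
    by (intro group_hom.intro group_hom_axioms.intro G.is_group H.a_group assms)
  let ?g = "\<lambda>p. frag_cmul (Poly_Mapping.lookup c p) (frag_of p)"
  have frag: "frag_of p \<in> carrier G" if "p \<in> Poly_Mapping.keys c" for p
    using that assms(3) by auto
  have g: "?g p = frag_of p [^]\<^bsub>G\<^esub> Poly_Mapping.lookup c p" if "p \<in> Poly_Mapping.keys c" for p
    using that frag by simp
  have "sum ?g I \<in> carrier G \<and> h (sum ?g I) = (\<Oplus>\<^bsub>H\<^esub>p\<in>I. [Poly_Mapping.lookup c p] \<cdot>\<^bsub>H\<^esub> h (frag_of p))"
    if "finite I" "I \<subseteq> Poly_Mapping.keys c" for I
    using that
  proof (induction I rule: finite_induct)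
    case empty
    then show ?case using h.hom_one by simp
  next
    case (insert p I)
    have terms: "[Poly_Mapping.lookup c q] \<cdot>\<^bsub>H\<^esub> h (frag_of q) \<in> carrier H" if "q \<in> insert p I" for q
    proof -
      have "q \<in> Poly_Mapping.keys c" using that insert.prems by auto
      then show ?thesis using h.hom_closed[OF frag, of q] by (simp add: H.add.int_pow_closed)
    qed
    have p: "?g p \<in> carrier G" "h (?g p) = [Poly_Mapping.lookup c p] \<cdot>\<^bsub>H\<^esub> h (frag_of p)"
      using g[of p] frag[of p] insert.prems h.hom_int_pow[of "frag_of p"] G.int_pow_closed[of "frag_of p"]
      by (simp_all add: add_pow_def del: carrier_free_Abelian_group_iff int_pow_free_Abelian_group)
    have IH: "sum ?g I \<in> carrier G" "h (sum ?g I) = (\<Oplus>\<^bsub>H\<^esub>p\<in>I. [Poly_Mapping.lookup c p] \<cdot>\<^bsub>H\<^esub> h (frag_of p))"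
      using insert by simp_all
    then show ?case
      using insert(1,2) terms p h.hom_mult[OF p(1) IH(1)] G.m_closed[OF p(1) IH(1)]
      by (simp add: Pi_iff del: carrier_free_Abelian_group_iff)
  qed
  from this[OF finite_keys order_refl] show ?thesis
    using frag_expansion[of c] by (simp add: frag_extend_def)
qed

text \<open>
  Independence of the chosen representative: a balanced map extends to a homomorphism on the free
  abelian group that kills the relations, hence is constant on cosets.
\<close>

lemma tensor_lift_cls:
  assumes "abelian_group H" and f: "balanced H f"
  obtains h where "h \<in> hom G (add_monoid H)"
    and "\<And>a b. \<lbrakk>a \<in> carrier R; b \<in> carrier R\<rbrakk> \<Longrightarrow> h (frag_of (a, b)) = f a b"
    and "\<And>c. c \<in> carrier G \<Longrightarrow> tensor_lift H f (cls c) = h c"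
proof -
  interpret H: abelian_group H by fact
  have "(\<lambda>p. f (fst p) (snd p)) ` (carrier R \<times> carrier R) \<subseteq> carrier (add_monoid H)"
    using f by (auto simp: balanced_def)
  from comm_group.free_Abelian_group_universal[OF H.a_comm_group this]
  obtain h where h: "h \<in> hom G (add_monoid H)"
    and hf: "\<And>p. p \<in> carrier R \<times> carrier R \<Longrightarrow> h (frag_of p) = f (fst p) (snd p)" by metis
  interpret h: group_hom G "add_monoid H" h
    by (intro group_hom.intro group_hom_axioms.intro G.is_group H.a_group h)
  have diff: "c - d \<in> carrier G \<and> h (c - d) = h c \<ominus>\<^bsub>H\<^esub> h d"
    if "c \<in> carrier G" "d \<in> carrier G" for c d
  proof -
    have "c \<otimes>\<^bsub>G\<^esub> inv\<^bsub>G\<^esub> d = c - d" using that by simp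
    then show ?thesis
      using that h.hom_mult[of c "inv\<^bsub>G\<^esub> d"] G.m_closed[of c "inv\<^bsub>G\<^esub> d"] h.hom_inv[of d]
      by (simp add: a_minus_def a_inv_def del: carrier_free_Abelian_group_iff mult_free_Abelian_group)
  qed
  have frag: "frag_of (a, b) \<in> carrier G" if "a \<in> carrier R" "b \<in> carrier R" for a b using that by simp
  note [simp] = frag diff[THEN conjunct1] diff[THEN conjunct2] hf
  have cancel: "u \<oplus>\<^bsub>H\<^esub> v \<ominus>\<^bsub>H\<^esub> u \<ominus>\<^bsub>H\<^esub> v = \<zero>\<^bsub>H\<^esub>" if "u \<in> carrier H" "v \<in> carrier H" for u v
  proof -
    have "u \<oplus>\<^bsub>H\<^esub> v \<ominus>\<^bsub>H\<^esub> u \<ominus>\<^bsub>H\<^esub> v = (u \<oplus>\<^bsub>H\<^esub> v) \<ominus>\<^bsub>H\<^esub> (u \<oplus>\<^bsub>H\<^esub> v)"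
      using that by (simp add: a_minus_def H.minus_add H.a_assoc)
    then show ?thesis using that by (simp add: a_minus_def H.r_neg)
  qed
  have "h k = \<zero>\<^bsub>H\<^esub>" if "k \<in> tensor_relations R S" for k
    using that f cancel unfolding tensor_relations_def balanced_def
    by (auto simp del: carrier_free_Abelian_group_iff simp: a_minus_def[of H "f _ _"] H.r_neg)
  then have "tensor_relations R S \<subseteq> kernel G (add_monoid H) h"
    using relations_closed by (auto simp: kernel_def simp del: carrier_free_Abelian_group_iff)
  then have "K \<subseteq> kernel G (add_monoid H) h"
    unfolding tensor_kernel_def by (intro G.generate_subgroup_incl h.subgroup_kernel)
  then have hK: "h k = \<zero>\<^bsub>H\<^esub>" if "k \<in> K" for k using that by (auto simp: kernel_def)
  have lift: "tensor_lift H f (cls c) = h c" if c: "c \<in> carrier G" for c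
  proof -
    \<comment> \<open>\<open>d\<close> is the representative selected in the definition of the lift; it differs from \<open>c\<close> by \<open>k \<in> K\<close>.\<close>
    have "c \<in> cls c" unfolding cls_def using c by (intro G.rcos_self subgroup_K)
    then have "(SOME d. d \<in> cls c) \<in> cls c" by (rule someI)
    moreover define d where "d = (SOME d. d \<in> cls c)"
    ultimately obtain k where k: "k \<in> K" "d = k \<otimes>\<^bsub>G\<^esub> c"
      by (auto simp: cls_def r_coset_def)
    have kG: "k \<in> carrier G" using k subgroup.subset[OF subgroup_K] by blast
    have d: "d \<in> carrier G" unfolding k(2) by (intro G.m_closed kG c)
    have "tensor_lift H f (cls c)
        = (\<Oplus>\<^bsub>H\<^esub>p\<in>Poly_Mapping.keys d. [Poly_Mapping.lookup d p] \<cdot>\<^bsub>H\<^esub> f (fst p) (snd p))"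
      by (simp add: tensor_lift_def d_def Let_def)
    also have "\<dots> = (\<Oplus>\<^bsub>H\<^esub>p\<in>Poly_Mapping.keys d. [Poly_Mapping.lookup d p] \<cdot>\<^bsub>H\<^esub> h (frag_of p))"
    proof (intro H.finsum_cong' refl funcsetI)
      fix p assume "p \<in> Poly_Mapping.keys d"
      then have p: "p \<in> carrier R \<times> carrier R" using d by auto
      then have "f (fst p) (snd p) \<in> carrier H" using f by (auto simp: balanced_def)
      then show "[Poly_Mapping.lookup d p] \<cdot>\<^bsub>H\<^esub> h (frag_of p) \<in> carrier H"
        using hf[OF p] by (simp add: H.add.int_pow_closed)
      show "[Poly_Mapping.lookup d p] \<cdot>\<^bsub>H\<^esub> f (fst p) (snd p) = [Poly_Mapping.lookup d p] \<cdot>\<^bsub>H\<^esub> h (frag_of p)"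
        using hf[OF p] by simp
    qed
    also have "\<dots> = h d" by (rule hom_free_eq_finsum[symmetric]) fact+
    also have "\<dots> = h c"
      unfolding k(2) using h.hom_mult[OF kG c] hK[OF k(1)] h.hom_closed[OF c]
      by (simp del: mult_free_Abelian_group carrier_free_Abelian_group_iff)
    finally show ?thesis .
  qed
  show ?thesis using hf by (intro that[OF h _ lift]) auto
qed

lemma tens_eq_cls: "t a b = cls (frag_of (a, b))"
  by (simp add: tens_def cls_def)

lemma tens_closed [simp]: "\<lbrakk>a \<in> carrier R; b \<in> carrier R\<rbrakk> \<Longrightarrow> t a b \<in> carrier W"
  by (simp add: tens_eq_cls cls_closed)

lemma
  assumes "abelian_group H" "balanced H f"
  shows tensor_lift_hom: "abelian_group_hom W H (tensor_lift H f)"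
    and tensor_lift_tens: "\<lbrakk>a \<in> carrier R; b \<in> carrier R\<rbrakk> \<Longrightarrow> tensor_lift H f (t a b) = f a b"
proof -
  obtain h where h: "h \<in> hom G (add_monoid H)"
    and hf: "\<And>a b. \<lbrakk>a \<in> carrier R; b \<in> carrier R\<rbrakk> \<Longrightarrow> h (frag_of (a, b)) = f a b"
    and lift: "\<And>c. c \<in> carrier G \<Longrightarrow> tensor_lift H f (cls c) = h c"
    using tensor_lift_cls[OF assms] by metis
  show "tensor_lift H f (t a b) = f a b" if "a \<in> carrier R" "b \<in> carrier R"
    using that by (simp add: tens_eq_cls lift hf)
  show "abelian_group_hom W H (tensor_lift H f)"
  proof (rule additive_imp_abelian_group_hom[OF abelian_group_W assms(1)])
    show "tensor_lift H f \<in> carrier W \<rightarrow> carrier H"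
      using hom_in_carrier[OF h] by (auto simp: carrier_W lift simp del: carrier_free_Abelian_group_iff)
    fix x y assume "x \<in> carrier W" "y \<in> carrier W"
    then obtain c d where c: "c \<in> carrier G" "x = cls c" and d: "d \<in> carrier G" "y = cls d"
      by (auto simp: carrier_W simp del: carrier_free_Abelian_group_iff)
    then show "tensor_lift H f (x \<oplus>\<^bsub>W\<^esub> y) = tensor_lift H f x \<oplus>\<^bsub>H\<^esub> tensor_lift H f y"
      using hom_mult[OF h c(1) d(1)] G.m_closed[OF c(1) d(1)]
      by (simp add: cls_add lift del: carrier_free_Abelian_group_iff)
  qed
qed

text \<open>
  The case of differences stands for sums and negatives together: pure tensors generate the tensor
  square as a group.
\<close>

lemma tensor_induct [consumes 1, case_names zero tens diff]:
  assumes "z \<in> carrier W" "P \<zero>\<^bsub>W\<^esub>"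
    and "\<And>a b. \<lbrakk>a \<in> carrier R; b \<in> carrier R\<rbrakk> \<Longrightarrow> P (t a b)"
    and "\<And>x y. \<lbrakk>x \<in> carrier W; y \<in> carrier W; P x; P y\<rbrakk> \<Longrightarrow> P (x \<ominus>\<^bsub>W\<^esub> y)"
  shows "P z"
proof -
  obtain c where c: "Poly_Mapping.keys c \<subseteq> carrier R \<times> carrier R" "z = cls c"
    using assms(1) by (auto simp: carrier_W)
  have "c \<in> carrier G \<and> P (cls c)"
    using c(1)
  proof (induction c rule: frag_induction)
    case (diff c d)
    have "c - d \<in> carrier G" using diff keys_diff[of c d] by auto
    then have "cls (c - d) \<oplus>\<^bsub>W\<^esub> cls d = cls c" using diff by (simp add: cls_add)
    then have "cls (c - d) = cls c \<ominus>\<^bsub>W\<^esub> cls d"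
      using W.add.inv_solve_right[of "cls (c - d)" "cls c" "cls d"] cls_closed diff \<open>c - d \<in> carrier G\<close>
      by (metis a_minus_def)
    then show ?case using assms(4) diff cls_closed \<open>c - d \<in> carrier G\<close> by metis
  qed (use assms(2,3) in \<open>auto simp: zero_W tens_eq_cls\<close>)
  then show ?thesis using c(2) by simp
qed

lemma tensor_hom_eqI:
  assumes "abelian_group_hom W H f" "abelian_group_hom W H g"
    and "\<And>a b. \<lbrakk>a \<in> carrier R; b \<in> carrier R\<rbrakk> \<Longrightarrow> f (t a b) = g (t a b)" and z: "z \<in> carrier W"
  shows "f z = g z"
proof -
  interpret f: abelian_group_hom W H f by fact
  interpret g: abelian_group_hom W H g by fact
  show ?thesis
    using z by (induction z rule: tensor_induct) (simp_all add: assms(3) a_minus_def)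
qed

lemma balanced_tens: "balanced W t"
proof -
  note rel = generate.incl[of _ "tensor_relations R S" G, folded tensor_kernel_def]
  have frag: "frag_of (a, b) \<in> carrier G" if "a \<in> carrier R" "b \<in> carrier R" for a b using that by simp
  have plus: "c + d \<in> carrier G" if "c \<in> carrier G" "d \<in> carrier G" for c d
    using G.m_closed[OF that] by simp
  have "t (a \<oplus> a') b = t a b \<oplus>\<^bsub>W\<^esub> t a' b" if "a \<in> carrier R" "a' \<in> carrier R" "b \<in> carrier R" for a a' b
  proof -
    have "frag_of (a \<oplus> a', b) - frag_of (a, b) - frag_of (a', b) \<in> tensor_relations R S"
      unfolding tensor_relations_def using that by blast
    then have "cls (frag_of (a \<oplus> a', b)) = cls (frag_of (a, b) + frag_of (a', b))"
      using that by (intro cls_eqI frag plus) (simp_all add: rel flip: diff_diff_eq)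
    then show ?thesis using that by (simp add: tens_eq_cls cls_add)
  qed
  moreover have "t a (b \<oplus> b') = t a b \<oplus>\<^bsub>W\<^esub> t a b'" if "a \<in> carrier R" "b \<in> carrier R" "b' \<in> carrier R" for a b b'
  proof -
    have "frag_of (a, b \<oplus> b') - frag_of (a, b) - frag_of (a, b') \<in> tensor_relations R S"
      unfolding tensor_relations_def using that by blast
    then have "cls (frag_of (a, b \<oplus> b')) = cls (frag_of (a, b) + frag_of (a, b'))"
      using that by (intro cls_eqI frag plus) (simp_all add: rel flip: diff_diff_eq)
    then show ?thesis using that by (simp add: tens_eq_cls cls_add)
  qed
  moreover have "t (a \<otimes> s) b = t a (s \<otimes> b)" if "a \<in> carrier R" "s \<in> S" "b \<in> carrier R" for a s b
    unfolding tens_eq_cls using that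
    by (intro cls_eqI frag rel) (simp_all add: tensor_relations_def, blast)
  ultimately show ?thesis by (simp add: balanced_def)
qed

lemmas tens_add_left = balanced_tens[unfolded balanced_def, THEN conjunct2, THEN conjunct1, rule_format]
lemmas tens_add_right =
  balanced_tens[unfolded balanced_def, THEN conjunct2, THEN conjunct2, THEN conjunct1, rule_format]
lemmas tens_balanced =
  balanced_tens[unfolded balanced_def, THEN conjunct2, THEN conjunct2, THEN conjunct2, rule_format]

section \<open>The tensor square as a bimodule\<close>

abbreviation M :: "('a, 'a tensor) bimodule" where "M \<equiv> tensor_bimodule R S"

lemma M_simps [simp]: "carrier M = carrier W" "\<zero>\<^bsub>M\<^esub> = \<zero>\<^bsub>W\<^esub>" "x \<oplus>\<^bsub>M\<^esub> y = x \<oplus>\<^bsub>W\<^esub> y"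
  by (simp_all add: tensor_bimodule_def)

lemma
  assumes r: "r \<in> carrier R"
  shows smult_hom: "abelian_group_hom W W (\<lambda>z. r \<odot>\<^bsub>M\<^esub> z)"
    and smult_tens: "\<lbrakk>a \<in> carrier R; b \<in> carrier R\<rbrakk> \<Longrightarrow> r \<odot>\<^bsub>M\<^esub> t a b = t (r \<otimes> a) b"
    and rsmult_hom: "abelian_group_hom W W (\<lambda>z. z \<boxdot>\<^bsub>M\<^esub> r)"
    and rsmult_tens: "\<lbrakk>a \<in> carrier R; b \<in> carrier R\<rbrakk> \<Longrightarrow> t a b \<boxdot>\<^bsub>M\<^esub> r = t a (b \<otimes> r)"
proof -
  have "t (r \<otimes> (a \<otimes> s)) b = t (r \<otimes> a) (s \<otimes> b)" "t (a \<otimes> s) (b \<otimes> r) = t a (s \<otimes> b \<otimes> r)"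
    if "a \<in> carrier R" "s \<in> S" "b \<in> carrier R" for a s b
    using r that tens_balanced[of "r \<otimes> a" s b] tens_balanced[of a s "b \<otimes> r"] by (simp_all add: m_assoc)
  then have "balanced W (\<lambda>a b. t (r \<otimes> a) b)" "balanced W (\<lambda>a b. t a (b \<otimes> r))"
    using r by (simp_all add: balanced_def r_distr l_distr tens_add_left tens_add_right)
  note lift = tensor_lift_hom[OF abelian_group_W this(1)] tensor_lift_tens[OF abelian_group_W this(1)]
    tensor_lift_hom[OF abelian_group_W this(2)] tensor_lift_tens[OF abelian_group_W this(2)]
  show "abelian_group_hom W W (\<lambda>z. r \<odot>\<^bsub>M\<^esub> z)" "abelian_group_hom W W (\<lambda>z. z \<boxdot>\<^bsub>M\<^esub> r)"
    using lift(1,3) by (simp_all add: tensor_bimodule_def)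
  show "r \<odot>\<^bsub>M\<^esub> t a b = t (r \<otimes> a) b" "t a b \<boxdot>\<^bsub>M\<^esub> r = t a (b \<otimes> r)" if "a \<in> carrier R" "b \<in> carrier R"
    using lift(2,4)[OF that] by (simp_all add: tensor_bimodule_def)
qed

lemmas smult_closed = abelian_group_hom.hom_closed[OF smult_hom]
lemmas rsmult_closed = abelian_group_hom.hom_closed[OF rsmult_hom]

lemma add_hom:
  assumes "abelian_group_hom W W f" "abelian_group_hom W W g"
  shows "abelian_group_hom W W (\<lambda>z. f z \<oplus>\<^bsub>W\<^esub> g z)"
proof -
  interpret f: abelian_group_hom W W f by fact
  interpret g: abelian_group_hom W W g by fact
  show ?thesis by (intro additive_imp_abelian_group_hom abelian_group_W) (auto simp: W.a_ac)
qed

lemma comp_hom: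
  assumes "abelian_group_hom W W f" "abelian_group_hom W H g"
  shows "abelian_group_hom W H (\<lambda>z. g (f z))"
proof -
  interpret f: abelian_group_hom W W f by fact
  interpret g: abelian_group_hom W H g by fact
  show ?thesis by (intro additive_imp_abelian_group_hom abelian_group_W g.H.abelian_group_axioms) auto
qed

lemma id_hom: "abelian_group_hom W W (\<lambda>z. z)"
  by (intro additive_imp_abelian_group_hom abelian_group_W) auto

lemma bimod_tensor: "bimod R M"
proof -
  have "\<exists>w\<in>carrier W. w \<oplus>\<^bsub>W\<^esub> z = \<zero>\<^bsub>W\<^esub>" if "z \<in> carrier W" for z
    using that W.l_neg W.a_inv_closed by blast
  then have "abelian_group M"
    by (intro abelian_groupI) (simp_all add: W.a_ac)
  show ?thesis
  proof (intro bimod.intro bimod_axioms.intro left_module.intro left_module_axioms.intro ring_axioms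
      \<open>abelian_group M\<close>; unfold M_simps)
    fix r s z assume r: "r \<in> carrier R" and s: "s \<in> carrier R" and z: "z \<in> carrier W"
    note homs = smult_hom[OF r] smult_hom[OF s] rsmult_hom[OF r] rsmult_hom[OF s]
    note tens = r s smult_tens rsmult_tens l_distr r_distr tens_add_left tens_add_right
    show "(r \<oplus> s) \<odot>\<^bsub>M\<^esub> z = r \<odot>\<^bsub>M\<^esub> z \<oplus>\<^bsub>W\<^esub> s \<odot>\<^bsub>M\<^esub> z"
      by (rule tensor_hom_eqI[OF smult_hom[OF a_closed[OF r s]] add_hom[OF homs(1,2)] _ z]) (simp add: tens)
    show "z \<boxdot>\<^bsub>M\<^esub> (r \<oplus> s) = z \<boxdot>\<^bsub>M\<^esub> r \<oplus>\<^bsub>W\<^esub> z \<boxdot>\<^bsub>M\<^esub> s"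
      by (rule tensor_hom_eqI[OF rsmult_hom[OF a_closed[OF r s]] add_hom[OF homs(3,4)] _ z]) (simp add: tens)
    show "(r \<otimes> s) \<odot>\<^bsub>M\<^esub> z = r \<odot>\<^bsub>M\<^esub> (s \<odot>\<^bsub>M\<^esub> z)"
      by (rule tensor_hom_eqI[OF smult_hom[OF m_closed[OF r s]] comp_hom[OF homs(2,1)] _ z])
        (simp add: tens m_assoc)
    show "z \<boxdot>\<^bsub>M\<^esub> (r \<otimes> s) = (z \<boxdot>\<^bsub>M\<^esub> r) \<boxdot>\<^bsub>M\<^esub> s"
      by (rule tensor_hom_eqI[OF rsmult_hom[OF m_closed[OF r s]] comp_hom[OF homs(3,4)] _ z])
        (simp add: tens m_assoc)
    show "(r \<odot>\<^bsub>M\<^esub> z) \<boxdot>\<^bsub>M\<^esub> s = r \<odot>\<^bsub>M\<^esub> (z \<boxdot>\<^bsub>M\<^esub> s)"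
      by (rule tensor_hom_eqI[OF comp_hom[OF homs(1,4)] comp_hom[OF homs(4,1)] _ z]) (simp add: tens)
  next
    fix z assume z: "z \<in> carrier W"
    show "\<one> \<odot>\<^bsub>M\<^esub> z = z"
      by (rule tensor_hom_eqI[OF smult_hom[OF one_closed] id_hom _ z]) (simp add: smult_tens)
    show "z \<boxdot>\<^bsub>M\<^esub> \<one> = z"
      by (rule tensor_hom_eqI[OF rsmult_hom[OF one_closed] id_hom _ z]) (simp add: rsmult_tens)
  next
    fix r z w assume "r \<in> carrier R" "z \<in> carrier W" "w \<in> carrier W"
    then show "r \<odot>\<^bsub>M\<^esub> (z \<oplus>\<^bsub>W\<^esub> w) = r \<odot>\<^bsub>M\<^esub> z \<oplus>\<^bsub>W\<^esub> r \<odot>\<^bsub>M\<^esub> w"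
      "(z \<oplus>\<^bsub>W\<^esub> w) \<boxdot>\<^bsub>M\<^esub> r = z \<boxdot>\<^bsub>M\<^esub> r \<oplus>\<^bsub>W\<^esub> w \<boxdot>\<^bsub>M\<^esub> r"
      using abelian_group_hom.hom_add[OF smult_hom] abelian_group_hom.hom_add[OF rsmult_hom] by auto
  qed (auto simp: smult_closed rsmult_closed)
qed

sublocale M: bimod R M by (rule bimod_tensor)

lemma
  shows tensor_mu_hom: "abelian_group_hom W R (tensor_mu R)"
    and tensor_mu_tens: "\<lbrakk>a \<in> carrier R; b \<in> carrier R\<rbrakk> \<Longrightarrow> tensor_mu R (t a b) = a \<otimes> b"
proof -
  have "balanced R (\<lambda>a b. a \<otimes> b)" by (auto simp: balanced_def l_distr r_distr m_assoc)
  then show "abelian_group_hom W R (tensor_mu R)"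
    "\<lbrakk>a \<in> carrier R; b \<in> carrier R\<rbrakk> \<Longrightarrow> tensor_mu R (t a b) = a \<otimes> b"
    unfolding tensor_mu_def by (auto intro: tensor_lift_hom tensor_lift_tens abelian_group_axioms)
qed

lemma tensor_mu_bimod_hom: "restrict (tensor_mu R) (carrier M) \<in> bimod_hom R M (regular_bimodule R)"
proof (rule bimod_homI)
  interpret \<mu>: abelian_group_hom W R "tensor_mu R" by (rule tensor_mu_hom)
  fix r z assume r: "r \<in> carrier R" and z: "z \<in> carrier M"
  then have z: "z \<in> carrier W" by simp
  have mult: "abelian_group_hom W R (\<lambda>z. r \<otimes> tensor_mu R z)" "abelian_group_hom W R (\<lambda>z. tensor_mu R z \<otimes> r)"
    using r by (auto intro!: additive_imp_abelian_group_hom abelian_group_W abelian_group_axioms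
        simp: l_distr r_distr)
  have "tensor_mu R (r \<odot>\<^bsub>M\<^esub> z) = r \<otimes> tensor_mu R z"
    by (rule tensor_hom_eqI[OF comp_hom[OF smult_hom[OF r] tensor_mu_hom] mult(1) _ z])
      (use r in \<open>simp add: smult_tens tensor_mu_tens m_assoc\<close>)
  then show "restrict (tensor_mu R) (carrier M) (r \<odot>\<^bsub>M\<^esub> z)
      = r \<odot>\<^bsub>regular_bimodule R\<^esub> restrict (tensor_mu R) (carrier M) z"
    using r z by (simp add: smult_closed)
  have "tensor_mu R (z \<boxdot>\<^bsub>M\<^esub> r) = tensor_mu R z \<otimes> r"
    by (rule tensor_hom_eqI[OF comp_hom[OF rsmult_hom[OF r] tensor_mu_hom] mult(2) _ z])
      (use r in \<open>simp add: rsmult_tens tensor_mu_tens m_assoc\<close>)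
  then show "restrict (tensor_mu R) (carrier M) (z \<boxdot>\<^bsub>M\<^esub> r)
      = restrict (tensor_mu R) (carrier M) z \<boxdot>\<^bsub>regular_bimodule R\<^esub> r"
    using r z by (simp add: rsmult_closed)
qed (auto simp: abelian_group_hom.hom_closed[OF tensor_mu_hom] abelian_group_hom.hom_add[OF tensor_mu_hom])

section \<open>The ring of \<open>S\<close>-central tensors\<close>

abbreviation T :: "'a tensor ring" where "T \<equiv> tensor_T R S"

lemma T_simps:
  "z \<in> carrier T \<longleftrightarrow> z \<in> carrier W \<and> (\<forall>s\<in>S. s \<odot>\<^bsub>M\<^esub> z = z \<boxdot>\<^bsub>M\<^esub> s)"
  "z \<otimes>\<^bsub>T\<^esub> w = tensor_lift W (\<lambda>a b. (a \<odot>\<^bsub>M\<^esub> z) \<boxdot>\<^bsub>M\<^esub> b) w"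
  "\<one>\<^bsub>T\<^esub> = t \<one> \<one>" "\<zero>\<^bsub>T\<^esub> = \<zero>\<^bsub>W\<^esub>" "z \<oplus>\<^bsub>T\<^esub> w = z \<oplus>\<^bsub>W\<^esub> w"
  by (auto simp: tensor_T_def)

lemma
  assumes z: "z \<in> carrier T"
  shows T_mult_hom: "abelian_group_hom W W (\<lambda>w. z \<otimes>\<^bsub>T\<^esub> w)"
    and T_mult_tens: "\<lbrakk>a \<in> carrier R; b \<in> carrier R\<rbrakk> \<Longrightarrow> z \<otimes>\<^bsub>T\<^esub> t a b = (a \<odot>\<^bsub>M\<^esub> z) \<boxdot>\<^bsub>M\<^esub> b"
proof -
  have z': "z \<in> carrier W" and comm: "s \<odot>\<^bsub>M\<^esub> z = z \<boxdot>\<^bsub>M\<^esub> s" if "s \<in> S" for s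
    using z that by (auto simp: T_simps)
  have zW: "z \<in> carrier W" using z by (simp add: T_simps)
  have "balanced W (\<lambda>a b. (a \<odot>\<^bsub>M\<^esub> z) \<boxdot>\<^bsub>M\<^esub> b)"
    unfolding balanced_def
  proof (intro conjI ballI)
    fix a s b assume a: "a \<in> carrier R" and s: "s \<in> S" and b: "b \<in> carrier R"
    have "(a \<otimes> s) \<odot>\<^bsub>M\<^esub> z \<boxdot>\<^bsub>M\<^esub> b = a \<odot>\<^bsub>M\<^esub> (z \<boxdot>\<^bsub>M\<^esub> s) \<boxdot>\<^bsub>M\<^esub> b"
      using a s b zW M.smult_assoc1[of a s z] by (simp add: comm)
    also have "\<dots> = (a \<odot>\<^bsub>M\<^esub> z) \<boxdot>\<^bsub>M\<^esub> (s \<otimes> b)"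
      using a s b zW M.smult_rsmult[of a s z] M.rsmult_assoc[of s b "a \<odot>\<^bsub>M\<^esub> z"] M.smult_closed[of a z]
      by simp
    finally show "(a \<otimes> s) \<odot>\<^bsub>M\<^esub> z \<boxdot>\<^bsub>M\<^esub> b = (a \<odot>\<^bsub>M\<^esub> z) \<boxdot>\<^bsub>M\<^esub> (s \<otimes> b)" .
  next
    fix a a' b assume "a \<in> carrier R" "a' \<in> carrier R" "b \<in> carrier R"
    then show "(a \<oplus> a') \<odot>\<^bsub>M\<^esub> z \<boxdot>\<^bsub>M\<^esub> b = a \<odot>\<^bsub>M\<^esub> z \<boxdot>\<^bsub>M\<^esub> b \<oplus>\<^bsub>W\<^esub> a' \<odot>\<^bsub>M\<^esub> z \<boxdot>\<^bsub>M\<^esub> b"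
      "a \<odot>\<^bsub>M\<^esub> z \<boxdot>\<^bsub>M\<^esub> (a' \<oplus> b) = a \<odot>\<^bsub>M\<^esub> z \<boxdot>\<^bsub>M\<^esub> a' \<oplus>\<^bsub>W\<^esub> a \<odot>\<^bsub>M\<^esub> z \<boxdot>\<^bsub>M\<^esub> b"
      using zW M.smult_l_distr[of a a' z] M.rsmult_l_distr[of b "a \<odot>\<^bsub>M\<^esub> z" "a' \<odot>\<^bsub>M\<^esub> z"]
        M.rsmult_r_distr[of a' b "a \<odot>\<^bsub>M\<^esub> z"] by (simp_all add: smult_closed)
  qed (simp add: smult_closed rsmult_closed zW)
  note lift = tensor_lift_hom[OF abelian_group_W this] tensor_lift_tens[OF abelian_group_W this]
  show "abelian_group_hom W W (\<lambda>w. z \<otimes>\<^bsub>T\<^esub> w)"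
    using lift(1) by (simp add: T_simps(2))
  show "z \<otimes>\<^bsub>T\<^esub> t a b = (a \<odot>\<^bsub>M\<^esub> z) \<boxdot>\<^bsub>M\<^esub> b" if "a \<in> carrier R" "b \<in> carrier R"
    using lift(2)[OF that] by (simp add: T_simps(2))
qed

text \<open>For \<open>f \<in> End(M)\<close>, both \<open>s f(1 \<otimes> 1)\<close> and \<open>f(1 \<otimes> 1) s\<close> equal \<open>f(s \<otimes> 1) = f(1 \<otimes> s)\<close>.\<close>

lemma End_imp_T:
  assumes f: "f \<in> bimod_hom R M M"
  shows "f (t \<one> \<one>) \<in> carrier T"
  unfolding T_simps
proof (intro conjI ballI)
  show "f (t \<one> \<one>) \<in> carrier W" using bimod_homD(2)[OF f, of "t \<one> \<one>"] by simp
  fix s assume s: "s \<in> S"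
  have "s \<odot>\<^bsub>M\<^esub> f (t \<one> \<one>) = f (t (\<one> \<otimes> s) \<one>)"
    using s bimod_homD(4)[OF f, of s "t \<one> \<one>"] by (simp add: smult_tens)
  also have "\<dots> = f (t \<one> (s \<otimes> \<one>))" using s by (subst tens_balanced) auto
  also have "\<dots> = f (t \<one> \<one>) \<boxdot>\<^bsub>M\<^esub> s"
    using s bimod_homD(5)[OF f, of s "t \<one> \<one>"] by (simp add: rsmult_tens)
  finally show "s \<odot>\<^bsub>M\<^esub> f (t \<one> \<one>) = f (t \<one> \<one>) \<boxdot>\<^bsub>M\<^esub> s" .
qed

text \<open>
  An endomorphism is determined by its value at \<open>1 \<otimes> 1\<close>, since \<open>f(a \<otimes> b) = a f(1 \<otimes> 1) b\<close>. In terms of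
  \<open>T\<close>, it is left multiplication by this value, extended from \<open>T\<close> to the whole tensor square.
\<close>

lemma End_eq_T_mult:
  assumes f: "f \<in> bimod_hom R M M" and w: "w \<in> carrier W"
  shows "f (t \<one> \<one>) \<otimes>\<^bsub>T\<^esub> w = f w"
proof -
  have "abelian_group_hom W W f"
    using bimod_homD(2,3)[OF f] by (intro additive_imp_abelian_group_hom abelian_group_W) auto
  moreover have "f (t \<one> \<one>) \<otimes>\<^bsub>T\<^esub> t a b = f (t a b)" if "a \<in> carrier R" "b \<in> carrier R" for a b
  proof -
    have "(a \<odot>\<^bsub>M\<^esub> f (t \<one> \<one>)) \<boxdot>\<^bsub>M\<^esub> b = f ((a \<odot>\<^bsub>M\<^esub> t \<one> \<one>) \<boxdot>\<^bsub>M\<^esub> b)"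
      using that bimod_homD(4)[OF f, of a "t \<one> \<one>"] bimod_homD(5)[OF f, of b "a \<odot>\<^bsub>M\<^esub> t \<one> \<one>"]
      by (simp add: smult_closed)
    then show ?thesis using that by (simp add: T_mult_tens[OF End_imp_T[OF f]] smult_tens rsmult_tens)
  qed
  ultimately show ?thesis
    using tensor_hom_eqI[OF T_mult_hom[OF End_imp_T[OF f]]] w by blast
qed

lemma T_mult_End:
  assumes z: "z \<in> carrier T"
  shows "(\<lambda>w\<in>carrier M. z \<otimes>\<^bsub>T\<^esub> w) \<in> bimod_hom R M M"
proof (rule bimod_homI)
  have zW: "z \<in> carrier W" using z by (simp add: T_simps)
  fix r w assume r: "r \<in> carrier R" and "w \<in> carrier M"
  then have w: "w \<in> carrier W" by simp
  have "z \<otimes>\<^bsub>T\<^esub> (r \<odot>\<^bsub>M\<^esub> w) = r \<odot>\<^bsub>M\<^esub> (z \<otimes>\<^bsub>T\<^esub> w)"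
  proof (rule tensor_hom_eqI[OF comp_hom[OF smult_hom[OF r] T_mult_hom[OF z]]
        comp_hom[OF T_mult_hom[OF z] smult_hom[OF r]] _ w])
    fix a b assume ab: "a \<in> carrier R" "b \<in> carrier R"
    then show "z \<otimes>\<^bsub>T\<^esub> (r \<odot>\<^bsub>M\<^esub> t a b) = r \<odot>\<^bsub>M\<^esub> (z \<otimes>\<^bsub>T\<^esub> t a b)"
      using r zW M.smult_assoc1[of r a z] M.smult_rsmult[of r b "a \<odot>\<^bsub>M\<^esub> z"]
      by (simp add: smult_tens T_mult_tens[OF z] smult_closed)
  qed
  then show "(\<lambda>w\<in>carrier M. z \<otimes>\<^bsub>T\<^esub> w) (r \<odot>\<^bsub>M\<^esub> w) = r \<odot>\<^bsub>M\<^esub> (\<lambda>w\<in>carrier M. z \<otimes>\<^bsub>T\<^esub> w) w"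
    using r w by (simp add: smult_closed)
  have "z \<otimes>\<^bsub>T\<^esub> (w \<boxdot>\<^bsub>M\<^esub> r) = (z \<otimes>\<^bsub>T\<^esub> w) \<boxdot>\<^bsub>M\<^esub> r"
  proof (rule tensor_hom_eqI[OF comp_hom[OF rsmult_hom[OF r] T_mult_hom[OF z]]
        comp_hom[OF T_mult_hom[OF z] rsmult_hom[OF r]] _ w])
    fix a b assume ab: "a \<in> carrier R" "b \<in> carrier R"
    then show "z \<otimes>\<^bsub>T\<^esub> (t a b \<boxdot>\<^bsub>M\<^esub> r) = (z \<otimes>\<^bsub>T\<^esub> t a b) \<boxdot>\<^bsub>M\<^esub> r"
      using r zW M.rsmult_assoc[of b r "a \<odot>\<^bsub>M\<^esub> z"]
      by (simp add: rsmult_tens T_mult_tens[OF z] smult_closed)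
  qed
  then show "(\<lambda>w\<in>carrier M. z \<otimes>\<^bsub>T\<^esub> w) (w \<boxdot>\<^bsub>M\<^esub> r) = (\<lambda>w\<in>carrier M. z \<otimes>\<^bsub>T\<^esub> w) w \<boxdot>\<^bsub>M\<^esub> r"
    using r w by (simp add: rsmult_closed)
qed (auto simp: abelian_group_hom.hom_closed[OF T_mult_hom[OF z]] abelian_group_hom.hom_add[OF T_mult_hom[OF z]])

text \<open>
  Multiplicativity is the instance \<open>w = g(1 \<otimes> 1)\<close> of the preceding description of \<open>f\<close>; the inverse maps \<open>z\<close> to
  left multiplication by \<open>z\<close>. The isomorphism preserves the order of factors.
\<close>

lemma ring_iso_End_T: "(\<lambda>f. f (t \<one> \<one>)) \<in> ring_iso (bimod_End R M) T"
proof (rule ring_iso_memI)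
  let ?H = "bimod_hom R M M"
  fix f g assume "f \<in> carrier (bimod_End R M)" "g \<in> carrier (bimod_End R M)"
  then have f: "f \<in> ?H" and g: "g \<in> ?H" by simp_all
  have "g (t \<one> \<one>) \<in> carrier W" using End_imp_T[OF g] by (simp add: T_simps)
  then show "(f \<otimes>\<^bsub>bimod_End R M\<^esub> g) (t \<one> \<one>) = f (t \<one> \<one>) \<otimes>\<^bsub>T\<^esub> g (t \<one> \<one>)"
    by (simp add: compose_eq End_eq_T_mult[OF f])
  show "(f \<oplus>\<^bsub>bimod_End R M\<^esub> g) (t \<one> \<one>) = f (t \<one> \<one>) \<oplus>\<^bsub>T\<^esub> g (t \<one> \<one>)" by (simp add: T_simps)
next
  have "inj_on (\<lambda>f. f (t \<one> \<one>)) (bimod_hom R M M)"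
  proof (rule inj_onI)
    fix f g assume f: "f \<in> bimod_hom R M M" and g: "g \<in> bimod_hom R M M" and eq: "f (t \<one> \<one>) = g (t \<one> \<one>)"
    show "f = g"
    proof (rule bimod_hom_eqI[OF f g])
      fix w assume "w \<in> carrier M"
      then show "f w = g w" using End_eq_T_mult[OF f, of w] End_eq_T_mult[OF g, of w] eq by simp
    qed
  qed
  moreover have "z \<in> (\<lambda>f. f (t \<one> \<one>)) ` bimod_hom R M M" if z: "z \<in> carrier T" for z
  proof
    have "z \<in> carrier W" using z by (simp add: T_simps)
    then show "z = (\<lambda>w\<in>carrier M. z \<otimes>\<^bsub>T\<^esub> w) (t \<one> \<one>)"
      using M.smult_one[of z] M.rsmult_one[of z] by (simp add: T_mult_tens[OF z])
  qed (rule T_mult_End[OF z])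
  ultimately show "bij_betw (\<lambda>f. f (t \<one> \<one>)) (carrier (bimod_End R M)) (carrier T)"
    using End_imp_T by (auto simp: bij_betw_def)
qed (auto simp: End_imp_T T_simps(3))

text \<open>The ring axioms of \<open>T\<close> are transported along the bijection with the endomorphism ring.\<close>

lemma ring_T: "ring T"
proof -
  have "T\<lparr>ring.zero := \<zero>\<^bsub>bimod_End R M\<^esub> (t \<one> \<one>)\<rparr> = T"
    by (simp add: tensor_T_def)
  then show ?thesis
    using ring.ring_iso_imp_img_ring[OF M.ring_bimod_End ring_iso_End_T] by simp
qed

end

section \<open>Separability\<close>

text \<open>Right linearity of \<open>r \<mapsto> r e\<close> is the condition \<open>r e = e r\<close>, and \<open>\<mu>(r e) = r \<mu>(e) = r\<close>.\<close>

lemma split_bimod_tensor: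
  assumes "ring R" "subring S R" "separability_element R S e"
  shows "split_bimod R (tensor_bimodule R S)
    (restrict (tensor_mu R) (carrier (tensor_bimodule R S)))
    (\<lambda>r\<in>carrier R. r \<odot>\<^bsub>tensor_bimodule R S\<^esub> e)"
proof -
  interpret ring_extension R S
    by (intro ring_extension.intro ring_extension_axioms.intro assms)
  have e: "e \<in> carrier W" "\<And>r. r \<in> carrier R \<Longrightarrow> r \<odot>\<^bsub>M\<^esub> e = e \<boxdot>\<^bsub>M\<^esub> r" "tensor_mu R e = \<one>\<^bsub>R\<^esub>"
    using assms(3) by (auto simp: separability_element_def)
  let ?\<sigma> = "\<lambda>r\<in>carrier R. r \<odot>\<^bsub>M\<^esub> e"
  have hom: "?\<sigma> \<in> bimod_hom R (regular_bimodule R) M"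
  proof (rule bimod_homI)
    fix r x assume "r \<in> carrier R" "x \<in> carrier (regular_bimodule R)"
    then have r: "r \<in> carrier R" and x: "x \<in> carrier R" by simp_all
    then show "?\<sigma> (r \<odot>\<^bsub>regular_bimodule R\<^esub> x) = r \<odot>\<^bsub>M\<^esub> ?\<sigma> x"
      using e(1) M.smult_assoc1[of r x e] by simp
    have "(x \<otimes>\<^bsub>R\<^esub> r) \<odot>\<^bsub>M\<^esub> e = x \<odot>\<^bsub>M\<^esub> (e \<boxdot>\<^bsub>M\<^esub> r)"
      using r x e(1) M.smult_assoc1[of x r e] by (simp add: e(2)[OF r])
    also have "\<dots> = (x \<odot>\<^bsub>M\<^esub> e) \<boxdot>\<^bsub>M\<^esub> r" using r x e(1) M.smult_rsmult[of x r e] by simp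
    finally show "?\<sigma> (x \<boxdot>\<^bsub>regular_bimodule R\<^esub> r) = ?\<sigma> x \<boxdot>\<^bsub>M\<^esub> r" using r x by simp
  qed (use e(1) M.smult_l_distr[of _ _ e] in \<open>auto simp: smult_closed\<close>)
  have "restrict (tensor_mu R) (carrier M) (?\<sigma> r) = r" if r: "r \<in> carrier R" for r
    using bimod_homD(4)[OF tensor_mu_bimod_hom, of r e] r e by (simp add: smult_closed)
  then show ?thesis
    by (intro split_bimod.intro split_bimod_axioms.intro bimod_tensor tensor_mu_bimod_hom hom)
qed

theorem proposition2p1:
  fixes R :: "('a, 'x) ring_scheme"
    and S :: "'a set"
    and e :: "'a tensor"
  assumes "ring R" and "subring S R"
    and "separable_extension R S"
    and "e \<in> carrier (tensor_T R S)"
    and "separability_element R S e"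
  shows "(H_separable_extension R S \<longleftrightarrow> full_idempotent (tensor_T R S) e) \<and>
    (H_separable_extension R S \<longrightarrow> infinite (UNIV :: 'u set) \<longrightarrow>
       morita_equivalent TYPE('u) (ring_center R) (bimod_End R (tensor_bimodule R S)))"
proof -
  interpret ring_extension R S
    by (intro ring_extension.intro ring_extension_axioms.intro assms)
  interpret split: split_bimod R M "restrict (tensor_mu R) (carrier M)" "\<lambda>r\<in>carrier R. r \<odot>\<^bsub>M\<^esub> e"
    by (rule split_bimod_tensor) fact+
  note Rb = bimod_regular[OF assms(1)]
  have e: "e \<in> carrier W" using assms(4) by (simp add: T_simps)
  have "H_separable_extension R S
      \<longleftrightarrow> (\<exists>q>0. \<exists>b u. dual_basis R M (regular_bimodule R) q b u)"
    unfolding H_separable_extension_def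
    by (simp only: summand_iff_retract[OF bimod_tensor bimod_bimod_power[OF Rb]]
        retract_power_iff_dual_basis[OF bimod_tensor Rb])
  then have H: "H_separable_extension R S \<longleftrightarrow> full_idempotent (bimod_End R M) split.\<epsilon>"
    using split.dual_basis_iff_full by simp
  have "split.\<epsilon> (t \<one>\<^bsub>R\<^esub> \<one>\<^bsub>R\<^esub>) = e"
    using split.eps_apply[of "t \<one>\<^bsub>R\<^esub> \<one>\<^bsub>R\<^esub>"] e M.smult_one[of e] by (simp add: tensor_mu_tens)
  then have "full_idempotent (bimod_End R M) split.\<epsilon> \<longleftrightarrow> full_idempotent T e"
    using full_idempotent_ring_iso[OF M.ring_bimod_End ring_T ring_iso_End_T, of split.\<epsilon>] split.eps_hom
    by simp
  then show ?thesis
    using H split.morita_equivalent_center_End by blast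
qed

end
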